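(* Let $X$ be a K3 surface, let $F$ be a simple vector bundle on $X$ with $H^0(F)=H^0(F^* )=0$, let $V^*\subset H^1(F^* )$ be a vector subspace of dimension $v\ge 1$, and let $E$ be the extension bundle associated to $(F,V)$. Then $E$ is simple. Moreover, the map $H^0(E^*\otimes E)\to H^0(E^*\otimes F)$ induced by $E\to F$ is an isomorphism.
   Context: A K3 surface is a smooth connected complex projective surface $X$ with $\omega_X\cong\mathcal{O}_X$ and $H^1(\mathcal{O}_X)=0$. A coherent sheaf $E$ on $X$ is simple if $\mathrm{End}(E)=\mathbb{C}$. The extension bundle $E$ associated to $(F,V)$, where $V^*\subset H^1(F^* )\cong\mathrm{Ext}^1(F,\mathcal{O}_X)$, is the middle term of the extension $0\to V\otimes\mathcal{O}_X\to E\to F\to 0$ whose class $e\in H^1(V\otimes F^* )=\mathrm{Hom}(V^*,H^1(F^* ))$ is the inclusion $V^*\hookrightarrow H^1(F^* )$. *)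

theory Defs
  imports
    "HOL-Analysis.Analysis"
    "Jordan_Normal_Form.Missing_VectorSpace"
begin

text \<open>
  Complex projective varieties are treated classically: a variety is a Zariski closed subset
  \<open>X\<close> of a complex projective space, with its sheaf of regular functions.  Sheaves of modules
  take values in the modules of HOL-Algebra.  The fields \<open>mult\<close> and \<open>one\<close> of a module record
  are irrelevant and are left \<open>undefined\<close>.
\<close>

definition Cfield :: "complex ring" where
  "Cfield = \<lparr>carrier = UNIV, mult = (*), one = 1, zero = 0, add = (+)\<rparr>"

section \<open>Projective varieties and regular functions\<close>

text \<open>A point of the projective space of dimension \<open>CARD('n) - 1\<close> is a line through the origin
  of \<open>complex ^ 'n\<close>.\<close>

type_synonym 'n pt = "(complex ^ 'n) set"

definition proj_space :: "'n::finite pt set" where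
  "proj_space = {L. \<exists>x. x \<noteq> 0 \<and> L = vec.span {x}}"

definition homog_poly :: "nat \<Rightarrow> (complex ^ 'n::finite \<Rightarrow> complex) \<Rightarrow> bool" where
  "homog_poly d p \<longleftrightarrow>
     (\<exists>M c. finite M \<and> (\<forall>m\<in>M. (\<Sum>i\<in>UNIV. m i) = d) \<and>
            p = (\<lambda>x. \<Sum>m\<in>M. c m * (\<Prod>i\<in>UNIV. (x $ i) ^ m i)))"

definition zero_locus :: "(complex ^ 'n::finite \<Rightarrow> complex) set \<Rightarrow> 'n pt set" where
  "zero_locus S = {L \<in> proj_space. \<forall>p\<in>S. \<forall>x\<in>L. p x = 0}"

definition zariski_open :: "'n::finite pt set \<Rightarrow> bool" where
  "zariski_open U \<longleftrightarrow>
     (\<exists>S. S \<subseteq> {p. \<exists>d. homog_poly d p} \<and> U = proj_space - zero_locus S)"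

lemma homog_poly_scale:
  assumes "homog_poly d p"
  shows "p (a *s x) = a ^ d * p x"
proof -
  obtain M c where M: "finite M" "\<forall>m\<in>M. (\<Sum>i\<in>UNIV. m i) = d"
    and p: "p = (\<lambda>x. \<Sum>m\<in>M. c m * (\<Prod>i\<in>UNIV. (x $ i) ^ m i))"
    using assms unfolding homog_poly_def by blast
  have "c m * (\<Prod>i\<in>UNIV. ((a *s x) $ i) ^ m i) = a ^ d * (c m * (\<Prod>i\<in>UNIV. (x $ i) ^ m i))"
    if "m \<in> M" for m
  proof -
    have "(\<Prod>i\<in>UNIV. ((a *s x) $ i) ^ m i) = (\<Prod>i\<in>UNIV. a ^ m i) * (\<Prod>i\<in>UNIV. (x $ i) ^ m i)"
      by (simp add: power_mult_distrib prod.distrib)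
    also have "(\<Prod>i\<in>UNIV. a ^ m i) = a ^ d"
      using M(2) that by (simp flip: power_sum)
    finally show ?thesis by simp
  qed
  then show ?thesis unfolding p sum_distrib_left by (intro sum.cong refl)
qed

lemma homog_poly_mult:
  fixes p q :: "complex ^ 'n::finite \<Rightarrow> complex"
  assumes "homog_poly d p" "homog_poly e q"
  shows "homog_poly (d + e) (\<lambda>x. p x * q x)"
proof -
  obtain M c where M: "finite M" "\<And>m. m \<in> M \<Longrightarrow> (\<Sum>i\<in>UNIV. m i) = d"
    and p: "p = (\<lambda>x. \<Sum>m\<in>M. c m * (\<Prod>i\<in>UNIV. (x $ i) ^ m i))"
    using assms(1) unfolding homog_poly_def by blast
  obtain N b where N: "finite N" "\<And>m. m \<in> N \<Longrightarrow> (\<Sum>i\<in>UNIV. m i) = e"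
    and q: "q = (\<lambda>x. \<Sum>m\<in>N. b m * (\<Prod>i\<in>UNIV. (x $ i) ^ m i))"
    using assms(2) unfolding homog_poly_def by blast
  define h where "h = (\<lambda>(m, n) i::'n. m i + n i :: nat)"
  define K where "K = h ` (M \<times> N)"
  define a where "a = (\<lambda>k. \<Sum>(m, n)\<in>{mn \<in> M \<times> N. h mn = k}. c m * b n)"
  have fin: "finite K" using M(1) N(1) by (simp add: K_def)
  have deg: "(\<Sum>i\<in>UNIV. k i) = d + e" if "k \<in> K" for k
    using that M(2) N(2) by (auto simp: K_def h_def sum.distrib)
  have eq: "p x * q x = (\<Sum>k\<in>K. a k * (\<Prod>i\<in>UNIV. (x $ i) ^ k i))" for x
  proof -
    have "p x * q x = (\<Sum>(m, n)\<in>M \<times> N. c m * b n * (\<Prod>i\<in>UNIV. (x $ i) ^ h (m, n) i))"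
      unfolding p q sum_product sum.cartesian_product
      by (rule sum.cong) (auto simp: h_def power_add prod.distrib)
    also have "\<dots> = (\<Sum>k\<in>K. \<Sum>(m, n)\<in>{mn \<in> M \<times> N. h mn = k}.
                        c m * b n * (\<Prod>i\<in>UNIV. (x $ i) ^ h (m, n) i))"
      unfolding K_def by (rule sum.image_gen) (use M N in auto)
    also have "\<dots> = (\<Sum>k\<in>K. a k * (\<Prod>i\<in>UNIV. (x $ i) ^ k i))"
      unfolding a_def sum_distrib_right by (intro sum.cong refl) auto
    finally show ?thesis .
  qed
  show ?thesis
    unfolding homog_poly_def using fin deg eq by blast
qed

lemma istopology_zariski: "istopology (zariski_open :: 'n::finite pt set \<Rightarrow> bool)"
  unfolding istopology_def
proof (intro conjI allI impI)
  fix U V :: "'n pt set"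
  assume "zariski_open U" "zariski_open V"
  then obtain S T where
    S: "S \<subseteq> {p. \<exists>d. homog_poly d p}" "U = proj_space - zero_locus S" and
    T: "T \<subseteq> {p. \<exists>d. homog_poly d p}" "V = proj_space - zero_locus T"
    unfolding zariski_open_def by blast
  define P where "P = {(\<lambda>x. p x * q x) | p q. p \<in> S \<and> q \<in> T}"
  have "P \<subseteq> {p. \<exists>d. homog_poly d p}"
    using S(1) T(1) unfolding P_def by (blast intro: homog_poly_mult)
  moreover have "U \<inter> V = proj_space - zero_locus P"
  proof (rule Set.set_eqI, rule iffI)
    fix L assume "L \<in> U \<inter> V"
    then obtain p q x y where L: "L \<in> proj_space" and pq: "p \<in> S" "q \<in> T"
      and xy: "x \<in> L" "y \<in> L" "p x \<noteq> 0" "q y \<noteq> 0"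
      using S T by (auto simp: zero_locus_def)
    obtain z where z: "L = vec.span {z}"
      using L by (auto simp: proj_space_def)
    obtain a b where ab: "x = a *s z" "y = b *s z"
      using xy z by (auto simp: vec.span_singleton)
    obtain d e where "homog_poly d p" "homog_poly e q" using pq S T by blast
    then have "p z \<noteq> 0" "q z \<noteq> 0" using xy ab by (auto simp: homog_poly_scale)
    moreover have "z \<in> L" by (simp add: z vec.span_base)
    ultimately show "L \<in> proj_space - zero_locus P"
      using L pq by (force simp: zero_locus_def P_def)
  next
    fix L assume "L \<in> proj_space - zero_locus P"
    then show "L \<in> U \<inter> V"
      using S T by (auto simp: zero_locus_def P_def)
  qed
  ultimately show "zariski_open (U \<inter> V)" unfolding zariski_open_def by blast
next
  fix \<U> :: "'n pt set set"
  assume "\<forall>U\<in>\<U>. zariski_open U"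
  then obtain S where S: "\<And>U. U \<in> \<U> \<Longrightarrow> S U \<subseteq> {p. \<exists>d. homog_poly d p}"
    "\<And>U. U \<in> \<U> \<Longrightarrow> U = proj_space - zero_locus (S U)"
    unfolding zariski_open_def by metis
  have "L \<in> \<Union>\<U> \<longleftrightarrow> L \<in> proj_space - zero_locus (\<Union>(S ` \<U>))" for L
  proof
    assume "L \<in> \<Union>\<U>"
    then obtain U where "U \<in> \<U>" "L \<in> proj_space - zero_locus (S U)" using S(2) by blast
    then show "L \<in> proj_space - zero_locus (\<Union>(S ` \<U>))"
      unfolding zero_locus_def by blast
  next
    assume "L \<in> proj_space - zero_locus (\<Union>(S ` \<U>))"
    then obtain U where "U \<in> \<U>" "L \<in> proj_space - zero_locus (S U)"
      unfolding zero_locus_def by blast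
    then show "L \<in> \<Union>\<U>" using S(2) by blast
  qed
  then have "\<Union>\<U> = proj_space - zero_locus (\<Union>(S ` \<U>))" by blast
  moreover have "\<Union>(S ` \<U>) \<subseteq> {p. \<exists>d. homog_poly d p}" using S(1) by blast
  ultimately show "zariski_open (\<Union>\<U>)" unfolding zariski_open_def by blast
qed

definition zariski :: "'n::finite pt topology" where
  "zariski = topology zariski_open"

lemma openin_zariski: "openin zariski = zariski_open"
  unfolding zariski_def using istopology_zariski by (rule topology_inverse')

abbreviation open_in :: "'n::finite pt set \<Rightarrow> 'n pt set \<Rightarrow> bool" where
  "open_in X U \<equiv> openin (subtopology zariski X) U"

definition regular_at :: "'n::finite pt set \<Rightarrow> 'n pt set \<Rightarrow> ('n pt \<Rightarrow> complex) \<Rightarrow> 'n pt \<Rightarrow> bool" where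
  "regular_at X U f x \<longleftrightarrow>
     (\<exists>V d p q. open_in X V \<and> x \<in> V \<and> V \<subseteq> U \<and> homog_poly d p \<and> homog_poly d q \<and>
        (\<forall>L\<in>V. \<forall>z\<in>L - {0}. q z \<noteq> 0 \<and> f L = p z / q z))"

text \<open>The ring of regular functions on \<open>U\<close>, also used as a module over itself.\<close>

definition reg_ring :: "'n::finite pt set \<Rightarrow> 'n pt set \<Rightarrow> ('n pt \<Rightarrow> complex, 'n pt \<Rightarrow> complex) module" where
  "reg_ring X U =
     \<lparr>carrier = {f \<in> extensional U. \<forall>x\<in>U. regular_at X U f x},
      mult = (\<lambda>f g. \<lambda>x\<in>U. f x * g x), one = (\<lambda>x\<in>U. 1),
      zero = (\<lambda>x\<in>U. 0), add = (\<lambda>f g. \<lambda>x\<in>U. f x + g x),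
      smult = (\<lambda>f g. \<lambda>x\<in>U. f x * g x)\<rparr>"

abbreviation const_fun :: "'p set \<Rightarrow> complex \<Rightarrow> 'p \<Rightarrow> complex" where
  "const_fun U c \<equiv> (\<lambda>x\<in>U. c)"

section \<open>Sheaves of modules\<close>

record ('p, 's) msheaf =
  sec :: "'p set \<Rightarrow> ('p \<Rightarrow> complex, 's) module"
  res :: "'p set \<Rightarrow> 'p set \<Rightarrow> 's \<Rightarrow> 's"

text \<open>\<open>res A U V\<close> is the restriction from \<open>U\<close> to \<open>V\<close>.  The gluing condition for the empty
  cover forces the sections over the empty set to be zero.\<close>

definition mod_sheaf :: "'n::finite pt set \<Rightarrow> ('n pt, 's) msheaf \<Rightarrow> bool" where
  "mod_sheaf X A \<longleftrightarrow>
     (\<forall>U. open_in X U \<longrightarrow> Module.module (reg_ring X U) (sec A U)) \<and>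
     (\<forall>U V. open_in X U \<and> open_in X V \<and> V \<subseteq> U \<longrightarrow>
        res A U V \<in> carrier (sec A U) \<rightarrow> carrier (sec A V) \<and>
        (\<forall>s\<in>carrier (sec A U). \<forall>t\<in>carrier (sec A U).
           res A U V (s \<oplus>\<^bsub>sec A U\<^esub> t) = res A U V s \<oplus>\<^bsub>sec A V\<^esub> res A U V t) \<and>
        (\<forall>f\<in>carrier (reg_ring X U). \<forall>s\<in>carrier (sec A U).
           res A U V (f \<odot>\<^bsub>sec A U\<^esub> s) = restrict f V \<odot>\<^bsub>sec A V\<^esub> res A U V s)) \<and>
     (\<forall>U. open_in X U \<longrightarrow> (\<forall>s\<in>carrier (sec A U). res A U U s = s)) \<and>
     (\<forall>U V W. open_in X U \<and> open_in X V \<and> open_in X W \<and> W \<subseteq> V \<and> V \<subseteq> U \<longrightarrow>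
        (\<forall>s\<in>carrier (sec A U). res A V W (res A U V s) = res A U W s)) \<and>
     (\<forall>\<U> s. (\<forall>U\<in>\<U>. open_in X U \<and> s U \<in> carrier (sec A U)) \<and>
        (\<forall>U\<in>\<U>. \<forall>V\<in>\<U>. res A U (U \<inter> V) (s U) = res A V (U \<inter> V) (s V)) \<longrightarrow>
        (\<exists>!t. t \<in> carrier (sec A (\<Union>\<U>)) \<and> (\<forall>U\<in>\<U>. res A (\<Union>\<U>) U t = s U)))"

definition struct_sheaf :: "'n::finite pt set \<Rightarrow> ('n pt, 'n pt \<Rightarrow> complex) msheaf" where
  "struct_sheaf X = \<lparr>sec = reg_ring X, res = (\<lambda>U V f. restrict f V)\<rparr>"

text \<open>Locally free of finite rank: every point has a neighbourhood with a finite frame.\<close>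

definition vector_bundle :: "'n::finite pt set \<Rightarrow> ('n pt, 's) msheaf \<Rightarrow> bool" where
  "vector_bundle X A \<longleftrightarrow> mod_sheaf X A \<and>
     (\<forall>x\<in>X. \<exists>U r b. open_in X U \<and> x \<in> U \<and> b \<in> {..<r} \<rightarrow> carrier (sec A U) \<and>
        (\<forall>V. open_in X V \<and> V \<subseteq> U \<longrightarrow>
           (\<forall>s\<in>carrier (sec A V). \<exists>!a. a \<in> {..<r::nat} \<rightarrow>\<^sub>E carrier (reg_ring X V) \<and>
              s = (\<Oplus>\<^bsub>sec A V\<^esub>i\<in>{..<r}. a i \<odot>\<^bsub>sec A V\<^esub> res A U V (b i)))))"

definition H0 :: "'n::finite pt set \<Rightarrow> ('n pt, 's) msheaf \<Rightarrow> (complex, 's) module" where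
  "H0 X A = \<lparr>carrier = carrier (sec A X), mult = undefined, one = undefined,
     zero = \<zero>\<^bsub>sec A X\<^esub>, add = add (sec A X),
     smult = (\<lambda>c s. const_fun X c \<odot>\<^bsub>sec A X\<^esub> s)\<rparr>"

text \<open>Morphisms from the restriction of \<open>A\<close> to \<open>U\<close> to that of \<open>B\<close>, as families indexed by the
  open subsets of \<open>U\<close>; extensionality makes equality of families the equality of morphisms.\<close>

definition mor :: "'n::finite pt set \<Rightarrow> ('n pt, 's) msheaf \<Rightarrow> ('n pt, 't) msheaf \<Rightarrow> 'n pt set
    \<Rightarrow> ('n pt set \<Rightarrow> 's \<Rightarrow> 't) set" where
  "mor X A B U =
     {\<phi> \<in> (\<Pi>\<^sub>E V\<in>{V. open_in X V \<and> V \<subseteq> U}.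
             module_hom (reg_ring X V) (sec A V) (sec B V) \<inter> extensional (carrier (sec A V))).
       \<forall>V W. open_in X V \<and> open_in X W \<and> W \<subseteq> V \<and> V \<subseteq> U \<longrightarrow>
         (\<forall>s\<in>carrier (sec A V). res B V W (\<phi> V s) = \<phi> W (res A V W s))}"

definition hom_sheaf :: "'n::finite pt set \<Rightarrow> ('n pt, 's) msheaf \<Rightarrow> ('n pt, 't) msheaf
    \<Rightarrow> ('n pt, 'n pt set \<Rightarrow> 's \<Rightarrow> 't) msheaf" where
  "hom_sheaf X A B =
     \<lparr>sec = (\<lambda>U. \<lparr>carrier = mor X A B U, mult = undefined, one = undefined,
        zero = (\<lambda>V\<in>{V. open_in X V \<and> V \<subseteq> U}. \<lambda>s\<in>carrier (sec A V). \<zero>\<^bsub>sec B V\<^esub>),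
        add = (\<lambda>\<phi> \<psi>. \<lambda>V\<in>{V. open_in X V \<and> V \<subseteq> U}. \<lambda>s\<in>carrier (sec A V).
                 \<phi> V s \<oplus>\<^bsub>sec B V\<^esub> \<psi> V s),
        smult = (\<lambda>f \<phi>. \<lambda>V\<in>{V. open_in X V \<and> V \<subseteq> U}. \<lambda>s\<in>carrier (sec A V).
                 restrict f V \<odot>\<^bsub>sec B V\<^esub> \<phi> V s)\<rparr>),
      res = (\<lambda>U V \<phi>. restrict \<phi> {W. open_in X W \<and> W \<subseteq> V})\<rparr>"

abbreviation dual_sheaf :: "'n::finite pt set \<Rightarrow> ('n pt, 's) msheaf
    \<Rightarrow> ('n pt, 'n pt set \<Rightarrow> 's \<Rightarrow> 'n pt \<Rightarrow> complex) msheaf" where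
  "dual_sheaf X A \<equiv> hom_sheaf X A (struct_sheaf X)"

definition isomorphic_sheaves :: "'n::finite pt set \<Rightarrow> ('n pt, 's) msheaf \<Rightarrow> ('n pt, 't) msheaf \<Rightarrow> bool" where
  "isomorphic_sheaves X A B \<longleftrightarrow>
     (\<exists>\<phi>\<in>mor X A B X. \<forall>U. open_in X U \<longrightarrow> bij_betw (\<phi> U) (carrier (sec A U)) (carrier (sec B U)))"

definition scalar_endo :: "'n::finite pt set \<Rightarrow> ('n pt, 's) msheaf \<Rightarrow> complex \<Rightarrow> 'n pt set \<Rightarrow> 's \<Rightarrow> 's" where
  "scalar_endo X A c =
     (\<lambda>U\<in>{U. open_in X U \<and> U \<subseteq> X}. \<lambda>s\<in>carrier (sec A U). const_fun U c \<odot>\<^bsub>sec A U\<^esub> s)"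

text \<open>Every endomorphism is multiplication by exactly one complex number; in particular the zero
  sheaf is not simple.\<close>

definition simple_sheaf :: "'n::finite pt set \<Rightarrow> ('n pt, 's) msheaf \<Rightarrow> bool" where
  "simple_sheaf X A \<longleftrightarrow> bij_betw (scalar_endo X A) UNIV (mor X A A X)"

section \<open>First cohomology\<close>

text \<open>
  Cech cohomology, the direct limit over all open covers; in degree one it agrees with derived
  functor cohomology on every space.  Covers indexed by the points of \<open>X\<close>, the member \<open>U x\<close>
  containing \<open>x\<close>, are cofinal among all open covers, and two cocycles define the same class iff
  they are cohomologous on a common refinement of this kind.
\<close>

definition pt_cover :: "'n::finite pt set \<Rightarrow> ('n pt \<Rightarrow> 'n pt set) \<Rightarrow> bool" where
  "pt_cover X U \<longleftrightarrow> (\<forall>x\<in>X. open_in X (U x) \<and> x \<in> U x)"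

type_synonym ('n, 's) cochain = "('n pt \<Rightarrow> 'n pt set) \<times> ('n pt \<Rightarrow> 'n pt \<Rightarrow> 's)"

definition cocycles :: "'n::finite pt set \<Rightarrow> ('n pt, 's) msheaf \<Rightarrow> ('n, 's) cochain set" where
  "cocycles X A = {(U, c). pt_cover X U \<and>
     (\<forall>x\<in>X. \<forall>y\<in>X. c x y \<in> carrier (sec A (U x \<inter> U y))) \<and>
     (\<forall>x\<in>X. \<forall>y\<in>X. \<forall>z\<in>X. let T = U x \<inter> U y \<inter> U z in
        res A (U x \<inter> U z) T (c x z) =
          res A (U x \<inter> U y) T (c x y) \<oplus>\<^bsub>sec A T\<^esub> res A (U y \<inter> U z) T (c y z))}"

definition cohomologous :: "'n::finite pt set \<Rightarrow> ('n pt, 's) msheaf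
    \<Rightarrow> (('n, 's) cochain \<times> ('n, 's) cochain) set" where
  "cohomologous X A = {((U, c), (U', c')). (U, c) \<in> cocycles X A \<and> (U', c') \<in> cocycles X A \<and>
     (\<exists>W b. pt_cover X W \<and> (\<forall>x\<in>X. W x \<subseteq> U x \<inter> U' x \<and> b x \<in> carrier (sec A (W x))) \<and>
        (\<forall>x\<in>X. \<forall>y\<in>X. let T = W x \<inter> W y in
           res A (U x \<inter> U y) T (c x y) \<oplus>\<^bsub>sec A T\<^esub> res A (W x) T (b x) =
           res A (U' x \<inter> U' y) T (c' x y) \<oplus>\<^bsub>sec A T\<^esub> res A (W y) T (b y)))}"

definition cochain_add :: "('n::finite pt, 's) msheaf \<Rightarrow> ('n, 's) cochain \<Rightarrow> ('n, 's) cochain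
    \<Rightarrow> ('n, 's) cochain" where
  "cochain_add A = (\<lambda>(U, c) (U', c').
     (\<lambda>x. U x \<inter> U' x,
      \<lambda>x y. let T = (U x \<inter> U' x) \<inter> (U y \<inter> U' y) in
        res A (U x \<inter> U y) T (c x y) \<oplus>\<^bsub>sec A T\<^esub> res A (U' x \<inter> U' y) T (c' x y)))"

definition cochain_smult :: "('n::finite pt, 's) msheaf \<Rightarrow> complex \<Rightarrow> ('n, 's) cochain
    \<Rightarrow> ('n, 's) cochain" where
  "cochain_smult A a = (\<lambda>(U, c).
     (U, \<lambda>x y. const_fun (U x \<inter> U y) a \<odot>\<^bsub>sec A (U x \<inter> U y)\<^esub> c x y))"

definition H1 :: "'n::finite pt set \<Rightarrow> ('n pt, 's) msheaf \<Rightarrow> (complex, ('n, 's) cochain set) module" where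
  "H1 X A = \<lparr>carrier = cocycles X A // cohomologous X A, mult = undefined, one = undefined,
     zero = cohomologous X A `` {(\<lambda>x. X, \<lambda>x y. \<zero>\<^bsub>sec A X\<^esub>)},
     add = (\<lambda>\<xi> \<eta>. \<Union>u\<in>\<xi>. \<Union>v\<in>\<eta>. cohomologous X A `` {cochain_add A u v}),
     smult = (\<lambda>a \<xi>. \<Union>u\<in>\<xi>. cohomologous X A `` {cochain_smult A a u})\<rparr>"

text \<open>The map on first cohomology induced by a sheaf morphism given as \<open>\<phi> U : A(U) \<rightarrow> B(U)\<close>.\<close>

definition H1_map :: "'n::finite pt set \<Rightarrow> ('n pt, 't) msheaf \<Rightarrow> ('n pt set \<Rightarrow> 's \<Rightarrow> 't)
    \<Rightarrow> ('n, 's) cochain set \<Rightarrow> ('n, 't) cochain set" where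
  "H1_map X B \<phi> \<xi> =
     (\<Union>(U, c)\<in>\<xi>. cohomologous X B `` {(U, \<lambda>x y. \<phi> (U x \<inter> U y) (c x y))})"

section \<open>K3 surfaces\<close>

definition irreducible_subset :: "'p topology \<Rightarrow> 'p set \<Rightarrow> bool" where
  "irreducible_subset T S \<longleftrightarrow> S \<subseteq> topspace T \<and> S \<noteq> {} \<and>
     (\<forall>A B. closedin T A \<and> closedin T B \<and> S \<subseteq> A \<union> B \<longrightarrow> S \<subseteq> A \<or> S \<subseteq> B)"

definition irreducible_chain :: "'p topology \<Rightarrow> nat \<Rightarrow> (nat \<Rightarrow> 'p set) \<Rightarrow> bool" where
  "irreducible_chain T d Z \<longleftrightarrow>
     (\<forall>i\<le>d. closedin T (Z i) \<and> irreducible_subset T (Z i)) \<and> (\<forall>i<d. Z i \<subset> Z (Suc i))"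

definition krull_dim :: "'p topology \<Rightarrow> enat" where
  "krull_dim T = (SUP d\<in>{d. \<exists>Z. irreducible_chain T d Z}. enat d)"

text \<open>The Krull dimension of the local ring at \<open>x\<close>: its primes correspond to the irreducible
  closed subsets through \<open>x\<close>.\<close>

definition local_dim :: "'p topology \<Rightarrow> 'p \<Rightarrow> enat" where
  "local_dim T x = (SUP d\<in>{d. \<exists>Z. irreducible_chain T d Z \<and> x \<in> Z 0}. enat d)"

text \<open>The Zariski tangent space at \<open>x\<close>, as the space of complex derivations at \<open>x\<close> of the local
  ring.  A germ is given by a function on a neighbourhood \<open>U\<close>, and \<open>D U f\<close> is the derivative
  of the germ of \<open>f\<close>.\<close>

definition tangent_space :: "'n::finite pt set \<Rightarrow> 'n pt
    \<Rightarrow> (complex, 'n pt set \<Rightarrow> ('n pt \<Rightarrow> complex) \<Rightarrow> complex) module" where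
  "tangent_space X x =
    (let N = {U. open_in X U \<and> x \<in> U}; R = (\<lambda>U. carrier (reg_ring X U)) in
     \<lparr>carrier = {D \<in> (\<Pi>\<^sub>E U\<in>N. R U \<rightarrow>\<^sub>E UNIV).
        (\<forall>U\<in>N. \<forall>f\<in>R U. \<forall>g\<in>R U. D U (f \<oplus>\<^bsub>reg_ring X U\<^esub> g) = D U f + D U g) \<and>
        (\<forall>U\<in>N. \<forall>f\<in>R U. \<forall>c. D U (const_fun U c \<otimes>\<^bsub>reg_ring X U\<^esub> f) = c * D U f) \<and>
        (\<forall>U\<in>N. \<forall>f\<in>R U. \<forall>g\<in>R U. D U (f \<otimes>\<^bsub>reg_ring X U\<^esub> g) = f x * D U g + g x * D U f) \<and>
        (\<forall>U\<in>N. \<forall>V\<in>N. V \<subseteq> U \<longrightarrow> (\<forall>f\<in>R U. D V (restrict f V) = D U f))},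
      mult = undefined, one = undefined,
      zero = (\<lambda>U\<in>N. \<lambda>f\<in>R U. 0),
      add = (\<lambda>D D'. \<lambda>U\<in>N. \<lambda>f\<in>R U. D U f + D' U f),
      smult = (\<lambda>c D. \<lambda>U\<in>N. \<lambda>f\<in>R U. c * D U f)\<rparr>)"

definition smooth_variety :: "'n::finite pt set \<Rightarrow> bool" where
  "smooth_variety X \<longleftrightarrow> (\<forall>x\<in>X. vectorspace.fin_dim Cfield (tangent_space X x) \<and>
     enat (vectorspace.dim Cfield (tangent_space X x)) = local_dim (subtopology zariski X) x)"

text \<open>Regular differential 2-forms: alternating bilinear forms on the tangent spaces which are
  locally finite sums of \<open>g df \<and> dh\<close> with \<open>g, f, h\<close> regular.  On a smooth surface this is the
  canonical sheaf, the second exterior power of the sheaf of differentials.\<close>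

definition regular_2form_at :: "'n::finite pt set \<Rightarrow> 'n pt set
    \<Rightarrow> ('n pt \<Rightarrow> ('n pt set \<Rightarrow> ('n pt \<Rightarrow> complex) \<Rightarrow> complex)
                \<Rightarrow> ('n pt set \<Rightarrow> ('n pt \<Rightarrow> complex) \<Rightarrow> complex) \<Rightarrow> complex)
    \<Rightarrow> 'n pt \<Rightarrow> bool" where
  "regular_2form_at X U \<eta> x \<longleftrightarrow>
     (\<exists>V (k::nat) g f h. open_in X V \<and> x \<in> V \<and> V \<subseteq> U \<and>
        (\<forall>i<k. g i \<in> carrier (reg_ring X V) \<and> f i \<in> carrier (reg_ring X V) \<and>
               h i \<in> carrier (reg_ring X V)) \<and>
        (\<forall>y\<in>V. \<forall>D\<in>carrier (tangent_space X y). \<forall>D'\<in>carrier (tangent_space X y).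
           \<eta> y D D' = (\<Sum>i<k. g i y * (D V (f i) * D' V (h i) - D V (h i) * D' V (f i)))))"

definition canonical_sheaf :: "'n::finite pt set
    \<Rightarrow> ('n pt, 'n pt \<Rightarrow> ('n pt set \<Rightarrow> ('n pt \<Rightarrow> complex) \<Rightarrow> complex)
                   \<Rightarrow> ('n pt set \<Rightarrow> ('n pt \<Rightarrow> complex) \<Rightarrow> complex) \<Rightarrow> complex) msheaf" where
  "canonical_sheaf X =
    (let T = (\<lambda>x. carrier (tangent_space X x)) in
     \<lparr>sec = (\<lambda>U. \<lparr>carrier = {\<eta> \<in> (\<Pi>\<^sub>E x\<in>U. T x \<rightarrow>\<^sub>E T x \<rightarrow>\<^sub>E UNIV). \<forall>x\<in>U. regular_2form_at X U \<eta> x},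
        mult = undefined, one = undefined,
        zero = (\<lambda>x\<in>U. \<lambda>D\<in>T x. \<lambda>D'\<in>T x. 0),
        add = (\<lambda>\<eta> \<theta>. \<lambda>x\<in>U. \<lambda>D\<in>T x. \<lambda>D'\<in>T x. \<eta> x D D' + \<theta> x D D'),
        smult = (\<lambda>f \<eta>. \<lambda>x\<in>U. \<lambda>D\<in>T x. \<lambda>D'\<in>T x. f x * \<eta> x D D')\<rparr>),
      res = (\<lambda>U V \<eta>. restrict \<eta> V)\<rparr>)"

definition K3_surface :: "'n::finite pt set \<Rightarrow> bool" where
  "K3_surface X \<longleftrightarrow>
     closedin zariski X \<and> connected_space (subtopology zariski X) \<and>
     krull_dim (subtopology zariski X) = 2 \<and> smooth_variety X \<and>
     isomorphic_sheaves X (canonical_sheaf X) (struct_sheaf X) \<and>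
     carrier (H1 X (struct_sheaf X)) = {\<zero>\<^bsub>H1 X (struct_sheaf X)\<^esub>}"

section \<open>Tensor products\<close>

text \<open>Elements of the tensor product of two modules are represented by formal sums of pure tensors;
  \<open>tensor_eq\<close> says that two formal sums are equal in the tensor product.\<close>

definition formal_tensors :: "('a, 'b, 'x) module_scheme \<Rightarrow> ('a, 'c, 'y) module_scheme
    \<Rightarrow> ('b \<times> 'c) multiset set" where
  "formal_tensors M N = {l. set_mset l \<subseteq> carrier M \<times> carrier N}"

inductive tensor_eq :: "('a, 'x) ring_scheme \<Rightarrow> ('a, 'b, 'y) module_scheme
    \<Rightarrow> ('a, 'c, 'z) module_scheme \<Rightarrow> ('b \<times> 'c) multiset \<Rightarrow> ('b \<times> 'c) multiset \<Rightarrow> bool"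
  for R M N where
  refl: "l \<in> formal_tensors M N \<Longrightarrow> tensor_eq R M N l l"
| sym: "tensor_eq R M N l k \<Longrightarrow> tensor_eq R M N k l"
| trans: "tensor_eq R M N l k \<Longrightarrow> tensor_eq R M N k j \<Longrightarrow> tensor_eq R M N l j"
| plus: "tensor_eq R M N l k \<Longrightarrow> j \<in> formal_tensors M N \<Longrightarrow> tensor_eq R M N (l + j) (k + j)"
| zero: "b \<in> carrier N \<Longrightarrow> tensor_eq R M N {#(\<zero>\<^bsub>M\<^esub>, b)#} {#}"
| add_left: "a \<in> carrier M \<Longrightarrow> a' \<in> carrier M \<Longrightarrow> b \<in> carrier N \<Longrightarrow>
    tensor_eq R M N {#(a \<oplus>\<^bsub>M\<^esub> a', b)#} {#(a, b), (a', b)#}"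
| add_right: "a \<in> carrier M \<Longrightarrow> b \<in> carrier N \<Longrightarrow> b' \<in> carrier N \<Longrightarrow>
    tensor_eq R M N {#(a, b \<oplus>\<^bsub>N\<^esub> b')#} {#(a, b), (a, b')#}"
| smult: "r \<in> carrier R \<Longrightarrow> a \<in> carrier M \<Longrightarrow> b \<in> carrier N \<Longrightarrow>
    tensor_eq R M N {#(r \<odot>\<^bsub>M\<^esub> a, b)#} {#(a, r \<odot>\<^bsub>N\<^esub> b)#}"

text \<open>
  The tensor product of sheaves is the sheafification of \<open>U \<mapsto> A(U) \<otimes> B(U)\<close>: a section is
  a family of germs which is locally given by a formal sum.  The germ at \<open>x\<close> of a formal sum
  \<open>l\<close> over \<open>U\<close> is the set of all formal sums over neighbourhoods of \<open>x\<close> that agree with \<open>l\<close> in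
  the tensor product over some smaller neighbourhood.
\<close>

type_synonym ('n, 'a, 'b) tensor_germ = "('n pt set \<times> ('a \<times> 'b) multiset) set"

definition res_tensor :: "('n::finite pt, 'a) msheaf \<Rightarrow> ('n pt, 'b) msheaf \<Rightarrow> 'n pt set \<Rightarrow> 'n pt set
    \<Rightarrow> ('a \<times> 'b) multiset \<Rightarrow> ('a \<times> 'b) multiset" where
  "res_tensor A B U V l = image_mset (\<lambda>(a, b). (res A U V a, res B U V b)) l"

definition tensor_germ :: "'n::finite pt set \<Rightarrow> ('n pt, 'a) msheaf \<Rightarrow> ('n pt, 'b) msheaf \<Rightarrow> 'n pt
    \<Rightarrow> 'n pt set \<Rightarrow> ('a \<times> 'b) multiset \<Rightarrow> ('n, 'a, 'b) tensor_germ" where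
  "tensor_germ X A B x U l =
     {(V, k). open_in X V \<and> x \<in> V \<and> k \<in> formal_tensors (sec A V) (sec B V) \<and>
        (\<exists>W. open_in X W \<and> x \<in> W \<and> W \<subseteq> U \<inter> V \<and>
           tensor_eq (reg_ring X W) (sec A W) (sec B W)
             (res_tensor A B U W l) (res_tensor A B V W k))}"

definition tensor_sheaf :: "'n::finite pt set \<Rightarrow> ('n pt, 'a) msheaf \<Rightarrow> ('n pt, 'b) msheaf
    \<Rightarrow> ('n pt, 'n pt \<Rightarrow> ('n, 'a, 'b) tensor_germ) msheaf" where
  "tensor_sheaf X A B =
     \<lparr>sec = (\<lambda>U. \<lparr>carrier = {\<sigma> \<in> extensional U. \<forall>x\<in>U. \<exists>V l. open_in X V \<and> x \<in> V \<and> V \<subseteq> U \<and>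
                     l \<in> formal_tensors (sec A V) (sec B V) \<and>
                     (\<forall>y\<in>V. \<sigma> y = tensor_germ X A B y V l)},
        mult = undefined, one = undefined,
        zero = (\<lambda>x\<in>U. tensor_germ X A B x U {#}),
        add = (\<lambda>\<sigma> \<tau>. \<lambda>x\<in>U. \<Union>(V, l)\<in>\<sigma> x. \<Union>(W, k)\<in>\<tau> x.
                 tensor_germ X A B x (V \<inter> W)
                   (res_tensor A B V (V \<inter> W) l + res_tensor A B W (V \<inter> W) k)),
        smult = (\<lambda>f \<sigma>. \<lambda>x\<in>U. \<Union>(V, l)\<in>\<sigma> x.
                 tensor_germ X A B x (U \<inter> V)
                   (image_mset (\<lambda>(a, b). (restrict f (U \<inter> V) \<odot>\<^bsub>sec A (U \<inter> V)\<^esub> a, b))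
                     (res_tensor A B V (U \<inter> V) l)))\<rparr>),
      res = (\<lambda>U V \<sigma>. restrict \<sigma> V)\<rparr>"

text \<open>The map \<open>H\<^sup>0(A \<otimes> B) \<rightarrow> H\<^sup>0(A \<otimes> C)\<close> induced by \<open>\<phi> : B \<rightarrow> C\<close>.\<close>

definition H0_tensor_map :: "'n::finite pt set \<Rightarrow> ('n pt, 'a) msheaf \<Rightarrow> ('n pt, 'b) msheaf
    \<Rightarrow> ('n pt, 'c) msheaf \<Rightarrow> ('n pt set \<Rightarrow> 'b \<Rightarrow> 'c)
    \<Rightarrow> ('n pt \<Rightarrow> ('n, 'a, 'b) tensor_germ) \<Rightarrow> 'n pt \<Rightarrow> ('n, 'a, 'c) tensor_germ" where
  "H0_tensor_map X A B C \<phi> \<sigma> =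
     (\<lambda>x\<in>X. \<Union>(V, l)\<in>\<sigma> x. tensor_germ X A C x V (image_mset (\<lambda>(a, b). (a, \<phi> V b)) l))"

definition linear_iso :: "(complex, 'a) module \<Rightarrow> (complex, 'b) module \<Rightarrow> ('a \<Rightarrow> 'b) \<Rightarrow> bool" where
  "linear_iso M N f \<longleftrightarrow> f \<in> module_hom Cfield M N \<and> bij_betw f (carrier M) (carrier N)"

section \<open>Extension bundles\<close>

definition dual_space :: "(complex, 'w) module \<Rightarrow> (complex, 'w \<Rightarrow> complex) module" where
  "dual_space M =
     \<lparr>carrier = {l \<in> carrier M \<rightarrow>\<^sub>E UNIV.
        (\<forall>w\<in>carrier M. \<forall>w'\<in>carrier M. l (w \<oplus>\<^bsub>M\<^esub> w') = l w + l w') \<and>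
        (\<forall>c. \<forall>w\<in>carrier M. l (c \<odot>\<^bsub>M\<^esub> w) = c * l w)},
      mult = undefined, one = undefined, zero = (\<lambda>w\<in>carrier M. 0),
      add = (\<lambda>l l'. \<lambda>w\<in>carrier M. l w + l' w),
      smult = (\<lambda>c l. \<lambda>w\<in>carrier M. c * l w)\<rparr>"

text \<open>The trivial bundle \<open>V \<otimes> O_X\<close> with fibre a finite-dimensional space \<open>V\<close>: its sections
  are the regular \<open>V\<close>-valued functions, \<open>v \<otimes> f\<close> being \<open>x \<mapsto> f(x) v\<close>.  Regularity of a
  \<open>V\<close>-valued function means regularity of its composites with all linear functionals.\<close>

definition trivial_bundle :: "'n::finite pt set \<Rightarrow> (complex, 'v) module \<Rightarrow> ('n pt, 'n pt \<Rightarrow> 'v) msheaf" where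
  "trivial_bundle X V =
     \<lparr>sec = (\<lambda>U. \<lparr>carrier = {t \<in> U \<rightarrow>\<^sub>E carrier V.
          \<forall>l\<in>carrier (dual_space V). (\<lambda>x\<in>U. l (t x)) \<in> carrier (reg_ring X U)},
        mult = undefined, one = undefined, zero = (\<lambda>x\<in>U. \<zero>\<^bsub>V\<^esub>),
        add = (\<lambda>s t. \<lambda>x\<in>U. s x \<oplus>\<^bsub>V\<^esub> t x),
        smult = (\<lambda>f t. \<lambda>x\<in>U. f x \<odot>\<^bsub>V\<^esub> t x)\<rparr>),
      res = (\<lambda>U W t. restrict t W)\<rparr>"

definition short_exact :: "'n::finite pt set \<Rightarrow> ('n pt, 'a) msheaf \<Rightarrow> ('n pt, 'e) msheaf
    \<Rightarrow> ('n pt, 's) msheaf \<Rightarrow> ('n pt set \<Rightarrow> 'a \<Rightarrow> 'e) \<Rightarrow> ('n pt set \<Rightarrow> 'e \<Rightarrow> 's) \<Rightarrow> bool" where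
  "short_exact X A E F i p \<longleftrightarrow> i \<in> mor X A E X \<and> p \<in> mor X E F X \<and>
     (\<forall>U. open_in X U \<longrightarrow>
        inj_on (i U) (carrier (sec A U)) \<and>
        (\<forall>e\<in>carrier (sec E U). p U e = \<zero>\<^bsub>sec F U\<^esub> \<longleftrightarrow>
           (\<forall>x\<in>U. \<exists>V. open_in X V \<and> x \<in> V \<and> V \<subseteq> U \<and> res E U V e \<in> i V ` carrier (sec A V))) \<and>
        (\<forall>f\<in>carrier (sec F U).
           \<forall>x\<in>U. \<exists>V. open_in X V \<and> x \<in> V \<and> V \<subseteq> U \<and> res F U V f \<in> p V ` carrier (sec E V)))"

text \<open>Cocycles with values in \<open>Hom(F, A)\<close> of the extension \<open>0 \<rightarrow> A \<rightarrow> E \<rightarrow> F \<rightarrow> 0\<close>: differences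
  \<open>s\<^sub>y - s\<^sub>x\<close> of local splittings.  They represent the image of the identity of \<open>F\<close> under the
  connecting map \<open>H\<^sup>0(Hom(F, F)) \<rightarrow> H\<^sup>1(Hom(F, A))\<close>.\<close>

definition extension_cocycle :: "'n::finite pt set \<Rightarrow> ('n pt, 'a) msheaf \<Rightarrow> ('n pt, 'e) msheaf
    \<Rightarrow> ('n pt, 's) msheaf \<Rightarrow> ('n pt set \<Rightarrow> 'a \<Rightarrow> 'e) \<Rightarrow> ('n pt set \<Rightarrow> 'e \<Rightarrow> 's)
    \<Rightarrow> ('n, 'n pt set \<Rightarrow> 's \<Rightarrow> 'a) cochain \<Rightarrow> bool" where
  "extension_cocycle X A E F i p = (\<lambda>(U, c). (U, c) \<in> cocycles X (hom_sheaf X F A) \<and>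
     (\<exists>s. (\<forall>x\<in>X. s x \<in> mor X F E (U x) \<and>
            (\<forall>V. open_in X V \<and> V \<subseteq> U x \<longrightarrow> (\<forall>f\<in>carrier (sec F V). p V (s x V f) = f))) \<and>
          (\<forall>x\<in>X. \<forall>y\<in>X. \<forall>V. open_in X V \<and> V \<subseteq> U x \<inter> U y \<longrightarrow> (\<forall>f\<in>carrier (sec F V).
             s y V f = s x V f \<oplus>\<^bsub>sec E V\<^esub> i V (c x y V f)))))"

definition extension_class :: "'n::finite pt set \<Rightarrow> ('n pt, 'a) msheaf \<Rightarrow> ('n pt, 'e) msheaf
    \<Rightarrow> ('n pt, 's) msheaf \<Rightarrow> ('n pt set \<Rightarrow> 'a \<Rightarrow> 'e) \<Rightarrow> ('n pt set \<Rightarrow> 'e \<Rightarrow> 's)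
    \<Rightarrow> ('n, 'n pt set \<Rightarrow> 's \<Rightarrow> 'a) cochain set \<Rightarrow> bool" where
  "extension_class X A E F i p e \<longleftrightarrow>
     e \<in> carrier (H1 X (hom_sheaf X F A)) \<and> (\<exists>u\<in>e. extension_cocycle X A E F i p u)"

text \<open>For \<open>w\<close> in the dual of \<open>V\<close>, the map \<open>Hom(F, V \<otimes> O_X) \<rightarrow> Hom(F, O_X)\<close> induced by
  \<open>w : V \<rightarrow> C\<close>.\<close>

definition contract :: "'n::finite pt set \<Rightarrow> ('n pt, 's) msheaf \<Rightarrow> ('v \<Rightarrow> complex) \<Rightarrow> 'n pt set
    \<Rightarrow> ('n pt set \<Rightarrow> 's \<Rightarrow> 'n pt \<Rightarrow> 'v) \<Rightarrow> 'n pt set \<Rightarrow> 's \<Rightarrow> 'n pt \<Rightarrow> complex" where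
  "contract X F w U \<phi> =
     (\<lambda>V\<in>{V. open_in X V \<and> V \<subseteq> U}. \<lambda>f\<in>carrier (sec F V). \<lambda>x\<in>V. w (\<phi> V f x))"

text \<open>
  \<open>W\<close> is the subspace \<open>V\<^sup>*\<close> of \<open>H\<^sup>1(F\<^sup>*)\<close>, so \<open>V\<close> is the dual space of \<open>W\<close>, and \<open>w \<in> W\<close>
  acts on \<open>V\<close> by evaluation.  Under \<open>H\<^sup>1(V \<otimes> F\<^sup>*) = Hom(V\<^sup>*, H\<^sup>1(F\<^sup>*))\<close> a class \<open>e\<close>
  corresponds to sending \<open>w\<close> to the contraction of \<open>e\<close> by \<open>w\<close>; the last condition says that
  this is the inclusion of \<open>W\<close>.
\<close>

definition extension_bundle :: "'n::finite pt set \<Rightarrow> ('n pt, 's) msheaf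
    \<Rightarrow> ('n, 'n pt set \<Rightarrow> 's \<Rightarrow> 'n pt \<Rightarrow> complex) cochain set set
    \<Rightarrow> ('n pt, 'e) msheaf
    \<Rightarrow> ('n pt set \<Rightarrow> ('n pt \<Rightarrow>
          ('n, 'n pt set \<Rightarrow> 's \<Rightarrow> 'n pt \<Rightarrow> complex) cochain set \<Rightarrow> complex) \<Rightarrow> 'e)
    \<Rightarrow> ('n pt set \<Rightarrow> 'e \<Rightarrow> 's) \<Rightarrow> bool" where
  "extension_bundle X F W E i p \<longleftrightarrow>
     (let V = dual_space ((H1 X (dual_sheaf X F))\<lparr>carrier := W\<rparr>); A = trivial_bundle X V in
      mod_sheaf X E \<and> short_exact X A E F i p \<and>
      (\<exists>e. extension_class X A E F i p e \<and>
           (\<forall>w\<in>W. H1_map X (dual_sheaf X F) (contract X F (\<lambda>v. v w)) e = w)))"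

end

theory Submission
  imports Defs
begin

text \<open>
  \<open>Hom(E, O) = 0\<close>: the restriction of a functional on \<open>E\<close> to the trivial subbundle is evaluation at some
  \<open>w \<in> W\<close>, and its composites with the local splittings exhibit the contraction of the extension cocycle
  by \<open>w\<close> as a coboundary.  That contraction represents \<open>w\<close>, so \<open>w = 0\<close>; the functional then factors
  through \<open>F\<close> and vanishes since \<open>H\<^sup>0(F\<^sup>*) = 0\<close>.  Hence an endomorphism of \<open>E\<close> killed by \<open>E \<rightarrow> F\<close> is
  zero.  As \<open>H\<^sup>0(F) = 0\<close>, a homomorphism \<open>E \<rightarrow> F\<close> factors through \<open>F\<close>, and by simplicity of \<open>F\<close> it is a
  multiple of the projection.  So \<open>Hom(E, E) \<rightarrow> Hom(E, F)\<close> is bijective and \<open>End(E)\<close> consists of scalars.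
  Since \<open>E\<close> and \<open>F\<close> are locally free, \<open>E\<^sup>* \<otimes> N = Hom(E, N)\<close> for \<open>N = E, F\<close>.
\<close>


section \<open>Presheaves and sheaves of modules\<close>

text \<open>The long exact sequences behind the overview are never formed. The connecting map enters
  through the local splittings \<open>s x\<close> that come with the extension cocycle: composing a
  functional with them produces a 0-cochain, and gluing such composites factors morphisms through F.
  That a functional on the trivial subbundle is evaluation at a single vector needs global regular
  functions to be constant, and this is drawn from the simplicity of F.

  The middle term E is given only as a sheaf of modules, and sections of a tensor product are
  families of germs of formal sums. Both difficulties are met by dual bases: finite lists of pairs
  (\<beta>, b) such that s is the sum of the \<beta>(s) b. They restrict to smaller opens and pass
  from the outer terms of a locally split extension to the middle one, with no independence to
  maintain. A dual basis of N alone makes the evaluation of formal sums in Hom(E, N) faithful, so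
  equality in the tensor product can be tested on homomorphisms.\<close>

definition mod_presheaf :: "'n::finite pt set \<Rightarrow> ('n pt, 's) msheaf \<Rightarrow> bool" where
  "mod_presheaf X A \<longleftrightarrow>
     (\<forall>U. open_in X U \<longrightarrow> Module.module (reg_ring X U) (sec A U)) \<and>
     (\<forall>U V. open_in X U \<and> open_in X V \<and> V \<subseteq> U \<longrightarrow>
        res A U V \<in> carrier (sec A U) \<rightarrow> carrier (sec A V) \<and>
        (\<forall>s\<in>carrier (sec A U). \<forall>t\<in>carrier (sec A U).
           res A U V (s \<oplus>\<^bsub>sec A U\<^esub> t) = res A U V s \<oplus>\<^bsub>sec A V\<^esub> res A U V t) \<and>
        (\<forall>f\<in>carrier (reg_ring X U). \<forall>s\<in>carrier (sec A U).
           res A U V (f \<odot>\<^bsub>sec A U\<^esub> s) = restrict f V \<odot>\<^bsub>sec A V\<^esub> res A U V s)) \<and>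
     (\<forall>U. open_in X U \<longrightarrow> (\<forall>s\<in>carrier (sec A U). res A U U s = s)) \<and>
     (\<forall>U V W. open_in X U \<and> open_in X V \<and> open_in X W \<and> W \<subseteq> V \<and> V \<subseteq> U \<longrightarrow>
        (\<forall>s\<in>carrier (sec A U). res A V W (res A U V s) = res A U W s))"

text \<open>\<open>mod_presheaf\<close> keeps every clause except gluing. Hom sheaves enter the
  argument, and its cohomology, only as presheaves, so gluing has to be known for the structure
  sheaf, the trivial bundles, E and F alone.\<close>

lemma mod_sheaf_iff:
  "mod_sheaf X A \<longleftrightarrow> mod_presheaf X A \<and>
     (\<forall>\<U> s. (\<forall>U\<in>\<U>. open_in X U \<and> s U \<in> carrier (sec A U)) \<and>
        (\<forall>U\<in>\<U>. \<forall>V\<in>\<U>. res A U (U \<inter> V) (s U) = res A V (U \<inter> V) (s V)) \<longrightarrow>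
        (\<exists>!t. t \<in> carrier (sec A (\<Union>\<U>)) \<and> (\<forall>U\<in>\<U>. res A (\<Union>\<U>) U t = s U)))"
  unfolding mod_sheaf_def mod_presheaf_def by (simp only: conj_assoc)

lemma mod_sheaf_presheaf [intro]: "mod_sheaf X A \<Longrightarrow> mod_presheaf X A"
  by (simp add: mod_sheaf_iff)

context
  fixes X :: "'n::finite pt set" and A :: "('n pt, 's) msheaf"
  assumes pre: "mod_presheaf X A"
begin

lemma presheaf_module: "open_in X U \<Longrightarrow> Module.module (reg_ring X U) (sec A U)"
  using pre[unfolded mod_presheaf_def, THEN conjunct1] by blast

lemma presheaf_group: "open_in X U \<Longrightarrow> abelian_group (sec A U)"
  using presheaf_module Module.module_def by blast

lemma presheaf_cring: "open_in X U \<Longrightarrow> cring (reg_ring X U)"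
  using presheaf_module Module.module_def by blast

lemmas pre_def = pre[unfolded mod_presheaf_def]

lemma res_props:
  assumes "open_in X U" "open_in X V" "V \<subseteq> U"
  shows "res A U V \<in> carrier (sec A U) \<rightarrow> carrier (sec A V) \<and>
     (\<forall>s\<in>carrier (sec A U). \<forall>t\<in>carrier (sec A U).
        res A U V (s \<oplus>\<^bsub>sec A U\<^esub> t) = res A U V s \<oplus>\<^bsub>sec A V\<^esub> res A U V t) \<and>
     (\<forall>f\<in>carrier (reg_ring X U). \<forall>s\<in>carrier (sec A U).
        res A U V (f \<odot>\<^bsub>sec A U\<^esub> s) = restrict f V \<odot>\<^bsub>sec A V\<^esub> res A U V s)"
  by (rule pre_def[THEN conjunct2, THEN conjunct1, THEN spec, THEN spec, THEN mp])
     (intro conjI assms)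

lemma res_closed:
  assumes "open_in X U" "open_in X V" "V \<subseteq> U" "s \<in> carrier (sec A U)"
  shows "res A U V s \<in> carrier (sec A V)"
  using funcset_mem[OF conjunct1[OF res_props[OF assms(1-3)]] assms(4)] .

lemma res_add:
  assumes "open_in X U" "open_in X V" "V \<subseteq> U" "s \<in> carrier (sec A U)" "t \<in> carrier (sec A U)"
  shows "res A U V (s \<oplus>\<^bsub>sec A U\<^esub> t) = res A U V s \<oplus>\<^bsub>sec A V\<^esub> res A U V t"
  using res_props[OF assms(1-3)] assms(4,5) by simp

lemma res_smult:
  assumes "open_in X U" "open_in X V" "V \<subseteq> U" "f \<in> carrier (reg_ring X U)" "s \<in> carrier (sec A U)"
  shows "res A U V (f \<odot>\<^bsub>sec A U\<^esub> s) = restrict f V \<odot>\<^bsub>sec A V\<^esub> res A U V s"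
  using res_props[OF assms(1-3)] assms(4,5) by simp

lemma res_id: "open_in X U \<Longrightarrow> s \<in> carrier (sec A U) \<Longrightarrow> res A U U s = s"
  using pre_def[THEN conjunct2, THEN conjunct2, THEN conjunct1] by blast

lemma res_res:
  assumes "open_in X U" "open_in X V" "open_in X W" "W \<subseteq> V" "V \<subseteq> U" "s \<in> carrier (sec A U)"
  shows "res A V W (res A U V s) = res A U W s"
  using pre_def[THEN conjunct2, THEN conjunct2, THEN conjunct2] assms by blast

lemma res_zero:
  assumes "open_in X U" "open_in X V" "V \<subseteq> U"
  shows "res A U V \<zero>\<^bsub>sec A U\<^esub> = \<zero>\<^bsub>sec A V\<^esub>"
proof -
  interpret U: abelian_group "sec A U" using assms presheaf_group by blast
  interpret V: abelian_group "sec A V" using assms presheaf_group by blast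
  have "res A U V \<zero>\<^bsub>sec A U\<^esub> \<oplus>\<^bsub>sec A V\<^esub> res A U V \<zero>\<^bsub>sec A U\<^esub> = res A U V \<zero>\<^bsub>sec A U\<^esub>"
    using res_add[OF assms, of "\<zero>\<^bsub>sec A U\<^esub>" "\<zero>\<^bsub>sec A U\<^esub>"] by simp
  then show ?thesis
    using res_closed[OF assms, of "\<zero>\<^bsub>sec A U\<^esub>"] by simp
qed

lemma res_neg:
  assumes "open_in X U" "open_in X V" "V \<subseteq> U" "s \<in> carrier (sec A U)"
  shows "res A U V (\<ominus>\<^bsub>sec A U\<^esub> s) = \<ominus>\<^bsub>sec A V\<^esub> res A U V s"
proof -
  interpret U: abelian_group "sec A U" using assms presheaf_group by blast
  interpret V: abelian_group "sec A V" using assms presheaf_group by blast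
  have "res A U V (\<ominus>\<^bsub>sec A U\<^esub> s) \<oplus>\<^bsub>sec A V\<^esub> res A U V s = \<zero>\<^bsub>sec A V\<^esub>"
    using res_add[OF assms(1-3), of "\<ominus>\<^bsub>sec A U\<^esub> s" s] assms by (simp add: U.l_neg res_zero)
  then show ?thesis
    using assms by (intro V.minus_equality[symmetric]) (auto intro: res_closed)
qed

end

lemma open_in_Int: "open_in X U \<Longrightarrow> open_in X V \<Longrightarrow> open_in X (U \<inter> V)"
  by (rule openin_Int)

lemma open_in_subset: "open_in X U \<Longrightarrow> U \<subseteq> X"
  by (rule openin_imp_subset)

lemma sheaf_glue:
  assumes "mod_sheaf X A" and "\<And>V. V \<in> \<U> \<Longrightarrow> open_in X V" "\<Union>\<U> = U"
    and "\<And>V. V \<in> \<U> \<Longrightarrow> s V \<in> carrier (sec A V)"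
    and "\<And>V W. V \<in> \<U> \<Longrightarrow> W \<in> \<U> \<Longrightarrow> res A V (V \<inter> W) (s V) = res A W (V \<inter> W) (s W)"
  shows "\<exists>!t. t \<in> carrier (sec A U) \<and> (\<forall>V\<in>\<U>. res A U V t = s V)"
proof -
  have *: "(\<forall>U\<in>\<U>. open_in X U \<and> s U \<in> carrier (sec A U)) \<and>
        (\<forall>U\<in>\<U>. \<forall>V\<in>\<U>. res A U (U \<inter> V) (s U) = res A V (U \<inter> V) (s V)) \<longrightarrow>
        (\<exists>!t. t \<in> carrier (sec A (\<Union>\<U>)) \<and> (\<forall>U\<in>\<U>. res A (\<Union>\<U>) U t = s U))"
    by (rule assms(1)[unfolded mod_sheaf_iff, THEN conjunct2, THEN spec, THEN spec])
  have "(\<forall>U\<in>\<U>. open_in X U \<and> s U \<in> carrier (sec A U)) \<and>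
        (\<forall>U\<in>\<U>. \<forall>V\<in>\<U>. res A U (U \<inter> V) (s U) = res A V (U \<inter> V) (s V))"
    using assms(2,4,5) by blast
  from *[THEN mp, OF this] show ?thesis unfolding assms(3) .
qed

text \<open>The cover consists of all opens on which s and t have the same restriction. Both then
  glue the one family of restrictions of s, and gluing is unique.\<close>

lemma sheaf_eqI:
  assumes A: "mod_sheaf X A" and U: "open_in X U"
    and s: "s \<in> carrier (sec A U)" and t: "t \<in> carrier (sec A U)"
    and loc: "\<And>x. x \<in> U \<Longrightarrow> \<exists>V. open_in X V \<and> x \<in> V \<and> V \<subseteq> U \<and> res A U V s = res A U V t"
  shows "s = t"
proof -
  note pre = mod_sheaf_presheaf[OF A]
  define \<U> where "\<U> = {V. open_in X V \<and> V \<subseteq> U \<and> res A U V s = res A U V t}"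
  have un: "\<Union>\<U> = U" using loc by (fastforce simp: \<U>_def)
  have "\<exists>!r. r \<in> carrier (sec A U) \<and> (\<forall>V\<in>\<U>. res A U V r = res A U V s)"
  proof (rule sheaf_glue[OF A _ un])
    fix V W assume "V \<in> \<U>" "W \<in> \<U>"
    then have op: "open_in X V" "open_in X W" "V \<subseteq> U" "W \<subseteq> U" by (auto simp: \<U>_def)
    then show "res A V (V \<inter> W) (res A U V s) = res A W (V \<inter> W) (res A U W s)"
      using res_res[OF pre U] s by (simp add: open_in_Int)
  qed (use s t U in \<open>auto simp: \<U>_def intro: res_closed[OF pre]\<close>)
  then show ?thesis using s t by (auto simp: \<U>_def)
qed

lemma mod_sheafI:
  assumes "mod_presheaf X A"
    and "\<And>\<U> s. (\<And>U. U \<in> \<U> \<Longrightarrow> open_in X U) \<Longrightarrow> (\<And>U. U \<in> \<U> \<Longrightarrow> s U \<in> carrier (sec A U)) \<Longrightarrow>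
        (\<And>U V. U \<in> \<U> \<Longrightarrow> V \<in> \<U> \<Longrightarrow> res A U (U \<inter> V) (s U) = res A V (U \<inter> V) (s V)) \<Longrightarrow>
        (\<exists>!t. t \<in> carrier (sec A (\<Union>\<U>)) \<and> (\<forall>U\<in>\<U>. res A (\<Union>\<U>) U t = s U))"
  shows "mod_sheaf X A"
  unfolding mod_sheaf_iff by (intro conjI allI impI assms(1), elim conjE, rule assms(2)) blast+

section \<open>Regular functions\<close>

lemma regular_at_local:
  assumes "regular_at X V g x" "V \<subseteq> U" "\<And>y. y \<in> V \<Longrightarrow> f y = g y"
  shows "regular_at X U f x"
proof -
  obtain T d p q where T: "open_in X T" "x \<in> T" "T \<subseteq> V" "homog_poly d p" "homog_poly d q"
    "\<forall>L\<in>T. \<forall>z\<in>L - {0}. q z \<noteq> 0 \<and> g L = p z / q z"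
    using assms(1) unfolding regular_at_def by blast
  moreover have "T \<subseteq> U" "\<forall>L\<in>T. \<forall>z\<in>L - {0}. q z \<noteq> 0 \<and> f L = p z / q z"
    using T(6) T(3) assms(2,3) by (blast, metis subsetD)
  ultimately show ?thesis unfolding regular_at_def by blast
qed

lemma reg_restrict:
  assumes "f \<in> carrier (reg_ring X U)" "open_in X V" "V \<subseteq> U"
  shows "restrict f V \<in> carrier (reg_ring X V)"
proof -
  have "regular_at X V (restrict f V) x" if "x \<in> V" for x
  proof -
    have "regular_at X U f x" using assms that by (auto simp: reg_ring_def)
    then obtain T d p q where T: "open_in X T" "x \<in> T" "T \<subseteq> U" "homog_poly d p" "homog_poly d q"
      "\<forall>L\<in>T. \<forall>z\<in>L - {0}. q z \<noteq> 0 \<and> f L = p z / q z"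
      unfolding regular_at_def by blast
    have "open_in X (T \<inter> V)" using T assms by (simp add: open_in_Int)
    with T that show ?thesis unfolding regular_at_def
      by (intro exI[of _ "T \<inter> V"] exI[of _ d] exI[of _ p] exI[of _ q]) auto
  qed
  then show ?thesis by (simp add: reg_ring_def)
qed

lemma reg_local:
  assumes "f \<in> extensional U"
    and "\<And>x. x \<in> U \<Longrightarrow> \<exists>V. open_in X V \<and> x \<in> V \<and> V \<subseteq> U \<and> restrict f V \<in> carrier (reg_ring X V)"
  shows "f \<in> carrier (reg_ring X U)"
proof -
  have "regular_at X U f x" if "x \<in> U" for x
  proof -
    from assms(2)[OF that]
    obtain V where V: "x \<in> V" "V \<subseteq> U" "restrict f V \<in> carrier (reg_ring X V)"
      by blast
    then have "regular_at X V (restrict f V) x" by (simp add: reg_ring_def)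
    then show ?thesis by (rule regular_at_local) (use V in auto)
  qed
  with assms(1) show ?thesis by (simp add: reg_ring_def)
qed

lemma homog_poly_const: "homog_poly 0 (\<lambda>x. c)"
  unfolding homog_poly_def by (intro exI[of _ "{\<lambda>i. 0}"] exI[of _ "\<lambda>m. c"]) auto

lemma reg_const:
  assumes "open_in X U"
  shows "const_fun U c \<in> carrier (reg_ring X U)"
proof -
  have "regular_at X U (const_fun U c) x" if "x \<in> U" for x
    unfolding regular_at_def using assms that homog_poly_const
    by (intro exI[of _ U] exI[of _ 0] exI[of _ "\<lambda>x. c"] exI[of _ "\<lambda>x. 1"]) auto
  then show ?thesis by (simp add: reg_ring_def)
qed

lemma reg_ring_simps:
  "f \<oplus>\<^bsub>reg_ring X U\<^esub> g = (\<lambda>x\<in>U. f x + g x)" "f \<otimes>\<^bsub>reg_ring X U\<^esub> g = (\<lambda>x\<in>U. f x * g x)"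
  "f \<odot>\<^bsub>reg_ring X U\<^esub> g = (\<lambda>x\<in>U. f x * g x)"
  "\<zero>\<^bsub>reg_ring X U\<^esub> = (\<lambda>x\<in>U. 0)" "\<one>\<^bsub>reg_ring X U\<^esub> = (\<lambda>x\<in>U. 1)"
  by (simp_all add: reg_ring_def)

lemma reg_ext: "f \<in> carrier (reg_ring X U) \<Longrightarrow> f \<in> extensional U"
  by (simp add: reg_ring_def)

text \<open>Gluing of bare functions, shared by the structure sheaf and the trivial bundles.
  Regularity is a local condition and is checked separately in each case.\<close>

lemma function_glue:
  assumes "\<And>U V x. U \<in> \<U> \<Longrightarrow> V \<in> \<U> \<Longrightarrow> restrict (s U) (U \<inter> V) = restrict (s V) (U \<inter> V)"
    and "\<And>U. U \<in> \<U> \<Longrightarrow> s U \<in> extensional U"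
  shows "\<exists>t\<in>extensional (\<Union>\<U>). \<forall>U\<in>\<U>. restrict t U = s U"
proof -
  \<comment> \<open>The value at x is read off from an arbitrary member of the cover through x;
    agreement on overlaps makes the choice immaterial.\<close>
  define t where "t = (\<lambda>x\<in>\<Union>\<U>. s (SOME U. U \<in> \<U> \<and> x \<in> U) x)"
  have "t x = s U x" if U: "U \<in> \<U>" "x \<in> U" for U x
  proof -
    define V where "V = (SOME U. U \<in> \<U> \<and> x \<in> U)"
    have V: "V \<in> \<U> \<and> x \<in> V" unfolding V_def by (rule someI[of _ U]) (use U in simp)
    have "t x = s V x" using U by (auto simp: t_def V_def)
    also have "\<dots> = restrict (s V) (V \<inter> U) x" using V U by simp
    also have "\<dots> = restrict (s U) (V \<inter> U) x" using V U assms(1)[of V U] by simp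
    finally show ?thesis using V U by simp
  qed
  then have "restrict t U = s U" if "U \<in> \<U>" for U
    using that by (intro extensionalityI[OF restrict_extensional assms(2)]) auto
  moreover have "t \<in> extensional (\<Union>\<U>)" by (simp add: t_def)
  ultimately show ?thesis by blast
qed

lemma extensional_Union_eqI:
  assumes "f \<in> extensional (\<Union>\<U>)" "g \<in> extensional (\<Union>\<U>)" "\<And>U. U \<in> \<U> \<Longrightarrow> restrict f U = restrict g U"
  shows "f = g"
proof (rule extensionalityI[OF assms(1,2)])
  fix x assume "x \<in> \<Union>\<U>"
  then obtain U where "U \<in> \<U>" "x \<in> U" by blast
  then show "f x = g x" using assms(3)[of U] by (metis restrict_apply')
qed

lemma struct_sheaf_simps [simp]:
  "sec (struct_sheaf X) = reg_ring X" "res (struct_sheaf X) U V f = restrict f V"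
  by (simp_all add: struct_sheaf_def)

text \<open>The ring axioms for regular functions are taken as an assumption because any sheaf of
  modules on X supplies them: being a module over \<open>reg_ring X U\<close> includes that this is
  a commutative ring. In the application the sheaf is F.\<close>

lemma struct_sheaf_presheaf:
  assumes "\<And>U. open_in X U \<Longrightarrow> cring (reg_ring X U)"
  shows "mod_presheaf X (struct_sheaf X)"
  unfolding mod_presheaf_def struct_sheaf_simps
proof (intro conjI allI impI ballI funcsetI)
  fix U assume U: "open_in X U"
  interpret cring "reg_ring X U" using assms U by blast
  have sm: "f \<odot>\<^bsub>reg_ring X U\<^esub> g = f \<otimes>\<^bsub>reg_ring X U\<^esub> g" for f g
    by (simp add: reg_ring_simps)
  show "Module.module (reg_ring X U) (reg_ring X U)"
    by (intro moduleI is_cring is_abelian_group) (auto simp: sm l_distr r_distr m_assoc)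
next
  fix U V s t assume "open_in X U \<and> open_in X V \<and> V \<subseteq> U"
  then show "restrict (s \<oplus>\<^bsub>reg_ring X U\<^esub> t) V = restrict s V \<oplus>\<^bsub>reg_ring X V\<^esub> restrict t V"
    "restrict (s \<odot>\<^bsub>reg_ring X U\<^esub> t) V = restrict s V \<odot>\<^bsub>reg_ring X V\<^esub> restrict t V"
    by (auto simp: reg_ring_simps restrict_def fun_eq_iff)
qed (auto simp: reg_restrict Int_absorb1 dest: reg_ext intro: extensional_restrict)

lemma struct_sheaf_sheaf:
  assumes "\<And>U. open_in X U \<Longrightarrow> cring (reg_ring X U)"
  shows "mod_sheaf X (struct_sheaf X)"
proof (rule mod_sheafI[OF struct_sheaf_presheaf[OF assms]], unfold struct_sheaf_simps)
  fix \<U> s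
  assume op: "\<And>U. U \<in> \<U> \<Longrightarrow> open_in X U" and s: "\<And>U. U \<in> \<U> \<Longrightarrow> s U \<in> carrier (reg_ring X U)"
    and "\<And>U V. U \<in> \<U> \<Longrightarrow> V \<in> \<U> \<Longrightarrow> restrict (s U) (U \<inter> V) = restrict (s V) (U \<inter> V)"
  then obtain t where t: "t \<in> extensional (\<Union>\<U>)" "\<And>U. U \<in> \<U> \<Longrightarrow> restrict t U = s U"
    using function_glue[of \<U> s] reg_ext by metis
  have "t \<in> carrier (reg_ring X (\<Union>\<U>))"
  proof (rule reg_local[OF t(1)])
    fix x assume "x \<in> \<Union>\<U>"
    then obtain U where "U \<in> \<U>" "x \<in> U" by blast
    then show "\<exists>V. open_in X V \<and> x \<in> V \<and> V \<subseteq> \<Union>\<U> \<and> restrict t V \<in> carrier (reg_ring X V)"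
      using op s t by (intro exI[of _ U]) auto
  qed
  with t show "\<exists>!t. t \<in> carrier (reg_ring X (\<Union>\<U>)) \<and> (\<forall>U\<in>\<U>. restrict t U = s U)"
    by (intro ex1I[of _ t]) (auto intro: extensional_Union_eqI dest: reg_ext)
qed


section \<open>Morphisms of sheaves\<close>

lemma (in Module.module) smult_left_commute:
  "\<lbrakk>a \<in> carrier R; b \<in> carrier R; x \<in> carrier M\<rbrakk> \<Longrightarrow> a \<odot>\<^bsub>M\<^esub> (b \<odot>\<^bsub>M\<^esub> x) = b \<odot>\<^bsub>M\<^esub> (a \<odot>\<^bsub>M\<^esub> x)"
  by (metis R.m_comm smult_assoc1)

lemma restrict_reg_ring:
  assumes "V \<subseteq> U"
  shows "restrict (f \<oplus>\<^bsub>reg_ring X U\<^esub> g) V = restrict f V \<oplus>\<^bsub>reg_ring X V\<^esub> restrict g V"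
    "restrict (f \<otimes>\<^bsub>reg_ring X U\<^esub> g) V = restrict f V \<otimes>\<^bsub>reg_ring X V\<^esub> restrict g V"
    "restrict \<one>\<^bsub>reg_ring X U\<^esub> V = \<one>\<^bsub>reg_ring X V\<^esub>"
    "restrict \<zero>\<^bsub>reg_ring X U\<^esub> V = \<zero>\<^bsub>reg_ring X V\<^esub>"
  using assms by (auto simp: reg_ring_simps restrict_def fun_eq_iff)

text \<open>The normal form of a morphism: a rule given by any term is cut down to the opens below U
  and to the sections over them, so that equality of families is equality of morphisms, as
  \<open>mor\<close> demands.\<close>

definition hom_family :: "'n::finite pt set \<Rightarrow> ('n pt, 's) msheaf \<Rightarrow> 'n pt set
    \<Rightarrow> ('n pt set \<Rightarrow> 's \<Rightarrow> 't) \<Rightarrow> 'n pt set \<Rightarrow> 's \<Rightarrow> 't" where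
  "hom_family X A U g = (\<lambda>V\<in>{V. open_in X V \<and> V \<subseteq> U}. \<lambda>s\<in>carrier (sec A V). g V s)"

lemma hom_family_apply [simp]:
  "open_in X V \<Longrightarrow> V \<subseteq> U \<Longrightarrow> s \<in> carrier (sec A V) \<Longrightarrow> hom_family X A U g V s = g V s"
  by (simp add: hom_family_def)

lemma hom_family_cong:
  assumes "\<And>V s. open_in X V \<Longrightarrow> V \<subseteq> U \<Longrightarrow> s \<in> carrier (sec A V) \<Longrightarrow> g V s = h V s"
  shows "hom_family X A U g = hom_family X A U h"
  unfolding hom_family_def using assms by (intro restrict_ext) auto

lemma mor_family: "\<phi> \<in> mor X A B U \<Longrightarrow> hom_family X A U \<phi> = \<phi>"
  unfolding hom_family_def mor_def
  by (intro ext) (auto simp: restrict_def PiE_def extensional_def Pi_def)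

lemma mor_hom:
  "\<phi> \<in> mor X A B U \<Longrightarrow> open_in X V \<Longrightarrow> V \<subseteq> U \<Longrightarrow>
     \<phi> V \<in> module_hom (reg_ring X V) (sec A V) (sec B V)"
  unfolding mor_def by (auto simp: PiE_def Pi_def)

lemma mor_closed:
  assumes "\<phi> \<in> mor X A B U" "open_in X V" "V \<subseteq> U" "s \<in> carrier (sec A V)"
  shows "\<phi> V s \<in> carrier (sec B V)"
  using mor_hom[OF assms(1-3)] assms(4) by (auto simp: module_hom_def)

lemma mor_add:
  assumes "\<phi> \<in> mor X A B U" "open_in X V" "V \<subseteq> U" "s \<in> carrier (sec A V)" "t \<in> carrier (sec A V)"
  shows "\<phi> V (s \<oplus>\<^bsub>sec A V\<^esub> t) = \<phi> V s \<oplus>\<^bsub>sec B V\<^esub> \<phi> V t"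
  using mor_hom[OF assms(1-3)] assms(4-) by (auto simp: module_hom_def)

lemma mor_smult:
  assumes "\<phi> \<in> mor X A B U" "open_in X V" "V \<subseteq> U" "f \<in> carrier (reg_ring X V)" "s \<in> carrier (sec A V)"
  shows "\<phi> V (f \<odot>\<^bsub>sec A V\<^esub> s) = f \<odot>\<^bsub>sec B V\<^esub> \<phi> V s"
  using mor_hom[OF assms(1-3)] assms(4-) by (auto simp: module_hom_def)

lemma mor_res:
  assumes "\<phi> \<in> mor X A B U" "open_in X V" "open_in X W" "W \<subseteq> V" "V \<subseteq> U" "s \<in> carrier (sec A V)"
  shows "res B V W (\<phi> V s) = \<phi> W (res A V W s)"
  using assms unfolding mor_def by blast

lemma mor_zero:
  assumes "mod_presheaf X A" "mod_presheaf X B" "\<phi> \<in> mor X A B U" "open_in X V" "V \<subseteq> U"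
  shows "\<phi> V \<zero>\<^bsub>sec A V\<^esub> = \<zero>\<^bsub>sec B V\<^esub>"
proof -
  interpret A: abelian_group "sec A V" using assms presheaf_group by blast
  interpret B: abelian_group "sec B V" using assms presheaf_group by blast
  have "\<phi> V \<zero>\<^bsub>sec A V\<^esub> \<oplus>\<^bsub>sec B V\<^esub> \<phi> V \<zero>\<^bsub>sec A V\<^esub> = \<phi> V \<zero>\<^bsub>sec A V\<^esub>"
    using mor_add[OF assms(3-5) A.zero_closed A.zero_closed] by simp
  then show ?thesis
    using mor_closed[OF assms(3-5) A.zero_closed] by simp
qed

lemma mor_minus:
  assumes "mod_presheaf X A" "mod_presheaf X B" "\<phi> \<in> mor X A B U" "open_in X V" "V \<subseteq> U"
    and "s \<in> carrier (sec A V)" "t \<in> carrier (sec A V)"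
  shows "\<phi> V (s \<ominus>\<^bsub>sec A V\<^esub> t) = \<phi> V s \<ominus>\<^bsub>sec B V\<^esub> \<phi> V t"
proof -
  interpret A: abelian_group "sec A V" using assms presheaf_group by blast
  interpret B: abelian_group "sec B V" using assms presheaf_group by blast
  note cl = mor_closed[OF assms(3-5)]
  have "\<phi> V (s \<ominus>\<^bsub>sec A V\<^esub> t) \<oplus>\<^bsub>sec B V\<^esub> \<phi> V t = \<phi> V s"
    using assms(6,7)
    by (simp flip: mor_add[OF assms(3-5)] add: A.minus_eq A.a_assoc A.l_neg)
  then show ?thesis
    using assms(6,7) cl by (metis A.minus_closed B.add.inv_solve_right B.minus_eq)
qed

lemma mor_eqI:
  assumes "\<phi> \<in> mor X A B U" "\<psi> \<in> mor X A B U"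
    and "\<And>V s. open_in X V \<Longrightarrow> V \<subseteq> U \<Longrightarrow> s \<in> carrier (sec A V) \<Longrightarrow> \<phi> V s = \<psi> V s"
  shows "\<phi> = \<psi>"
  using mor_family[OF assms(1)] mor_family[OF assms(2)] hom_family_cong[of X U A \<phi> \<psi>] assms(3)
  by metis

lemma hom_family_mor:
  assumes "mod_presheaf X A"
    and "\<And>V s. open_in X V \<Longrightarrow> V \<subseteq> U \<Longrightarrow> s \<in> carrier (sec A V) \<Longrightarrow> g V s \<in> carrier (sec B V)"
    and "\<And>V s t. open_in X V \<Longrightarrow> V \<subseteq> U \<Longrightarrow> s \<in> carrier (sec A V) \<Longrightarrow> t \<in> carrier (sec A V) \<Longrightarrow>
      g V (s \<oplus>\<^bsub>sec A V\<^esub> t) = g V s \<oplus>\<^bsub>sec B V\<^esub> g V t"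
    and "\<And>V f s. open_in X V \<Longrightarrow> V \<subseteq> U \<Longrightarrow> f \<in> carrier (reg_ring X V) \<Longrightarrow> s \<in> carrier (sec A V) \<Longrightarrow>
      g V (f \<odot>\<^bsub>sec A V\<^esub> s) = f \<odot>\<^bsub>sec B V\<^esub> g V s"
    and "\<And>V W s. open_in X V \<Longrightarrow> open_in X W \<Longrightarrow> W \<subseteq> V \<Longrightarrow> V \<subseteq> U \<Longrightarrow> s \<in> carrier (sec A V) \<Longrightarrow>
      res B V W (g V s) = g W (res A V W s)"
  shows "hom_family X A U g \<in> mor X A B U"
proof -
  have "hom_family X A U g V \<in> module_hom (reg_ring X V) (sec A V) (sec B V)"
    if V: "open_in X V" "V \<subseteq> U" for V
  proof -
    interpret Module.module "reg_ring X V" "sec A V" by (rule presheaf_module[OF assms(1) V(1)])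
    show ?thesis using V assms(2-4) by (auto simp: module_hom_def)
  qed
  moreover have "hom_family X A U g \<in> extensional {V. open_in X V \<and> V \<subseteq> U}"
    "\<And>V. open_in X V \<Longrightarrow> V \<subseteq> U \<Longrightarrow> hom_family X A U g V \<in> extensional (carrier (sec A V))"
    by (auto simp: hom_family_def)
  moreover have "res B V W (hom_family X A U g V s) = hom_family X A U g W (res A V W s)"
    if "open_in X V" "open_in X W" "W \<subseteq> V" "V \<subseteq> U" "s \<in> carrier (sec A V)" for V W s
    using that assms(5) res_closed[OF assms(1)] by simp
  ultimately show ?thesis unfolding mor_def by (simp add: PiE_def Pi_def)
qed

lemma mor_restrict:
  assumes "mod_presheaf X A" "\<phi> \<in> mor X A B U" "U' \<subseteq> U"
  shows "hom_family X A U' \<phi> \<in> mor X A B U'"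
  by (rule hom_family_mor[OF assms(1)])
    (use assms(2,3) in \<open>auto intro: mor_closed mor_add mor_smult mor_res dest: order_trans\<close>)

definition mor_comp :: "'n::finite pt set \<Rightarrow> ('n pt, 's) msheaf \<Rightarrow> 'n pt set
    \<Rightarrow> ('n pt set \<Rightarrow> 't \<Rightarrow> 'u) \<Rightarrow> ('n pt set \<Rightarrow> 's \<Rightarrow> 't) \<Rightarrow> 'n pt set \<Rightarrow> 's \<Rightarrow> 'u" where
  "mor_comp X A U \<psi> \<phi> = hom_family X A U (\<lambda>V s. \<psi> V (\<phi> V s))"

lemma mor_comp_apply [simp]:
  "open_in X V \<Longrightarrow> V \<subseteq> U \<Longrightarrow> s \<in> carrier (sec A V) \<Longrightarrow> mor_comp X A U \<psi> \<phi> V s = \<psi> V (\<phi> V s)"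
  by (simp add: mor_comp_def)

lemma mor_comp_mor:
  assumes A: "mod_presheaf X A" and \<phi>: "\<phi> \<in> mor X A B U'" and \<psi>: "\<psi> \<in> mor X B C U''"
    and U: "U \<subseteq> U'" "U \<subseteq> U''"
  shows "mor_comp X A U \<psi> \<phi> \<in> mor X A C U"
  unfolding mor_comp_def
proof (rule hom_family_mor[OF A])
  fix V assume V: "open_in X V" "V \<subseteq> U"
  then have V': "V \<subseteq> U'" "V \<subseteq> U''" using U by auto
  show "\<psi> V (\<phi> V s) \<in> carrier (sec C V)" if "s \<in> carrier (sec A V)" for s
    using mor_closed[OF \<psi> V(1) V'(2)] mor_closed[OF \<phi> V(1) V'(1)] that by blast
  show "\<psi> V (\<phi> V (s \<oplus>\<^bsub>sec A V\<^esub> t)) = \<psi> V (\<phi> V s) \<oplus>\<^bsub>sec C V\<^esub> \<psi> V (\<phi> V t)"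
    if "s \<in> carrier (sec A V)" "t \<in> carrier (sec A V)" for s t
    using mor_add[OF \<psi> V(1) V'(2)] mor_add[OF \<phi> V(1) V'(1)] mor_closed[OF \<phi> V(1) V'(1)] that by simp
  show "\<psi> V (\<phi> V (f \<odot>\<^bsub>sec A V\<^esub> s)) = f \<odot>\<^bsub>sec C V\<^esub> \<psi> V (\<phi> V s)"
    if "f \<in> carrier (reg_ring X V)" "s \<in> carrier (sec A V)" for f s
    using mor_smult[OF \<psi> V(1) V'(2)] mor_smult[OF \<phi> V(1) V'(1)] mor_closed[OF \<phi> V(1) V'(1)] that
    by simp
  show "res C V W (\<psi> V (\<phi> V s)) = \<psi> W (\<phi> W (res A V W s))"
    if "open_in X W" "W \<subseteq> V" "s \<in> carrier (sec A V)" for W s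
    using mor_res[OF \<psi> V(1) that(1,2) V'(2)] mor_res[OF \<phi> V(1) that(1,2) V'(1)]
      mor_closed[OF \<phi> V(1) V'(1)] that by simp
qed

lemma scalar_endo_family:
  "scalar_endo X A c = hom_family X A X (\<lambda>U s. const_fun U c \<odot>\<^bsub>sec A U\<^esub> s)"
  by (simp add: scalar_endo_def hom_family_def)

lemma scalar_endo_apply [simp]:
  "open_in X V \<Longrightarrow> s \<in> carrier (sec A V) \<Longrightarrow> scalar_endo X A c V s = const_fun V c \<odot>\<^bsub>sec A V\<^esub> s"
  using open_in_subset[of X V] by (simp add: scalar_endo_family)

text \<open>Commutativity of the ring makes multiplication by f linear over all regular functions.
  Constants give the scalar endomorphisms; an arbitrary f is what later connects regular functions
  with the endomorphisms of a simple bundle.\<close>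

lemma reg_smult_mor:
  assumes A: "mod_presheaf X A" and f: "f \<in> carrier (reg_ring X U)" and U: "open_in X U"
  shows "hom_family X A U (\<lambda>V s. restrict f V \<odot>\<^bsub>sec A V\<^esub> s) \<in> mor X A A U"
proof (rule hom_family_mor[OF A])
  fix V assume V: "open_in X V" "V \<subseteq> U"
  interpret Module.module "reg_ring X V" "sec A V" by (rule presheaf_module[OF A V(1)])
  note fV = reg_restrict[OF f V]
  show "restrict f V \<odot>\<^bsub>sec A V\<^esub> s \<in> carrier (sec A V)" if "s \<in> carrier (sec A V)" for s
    using that fV by simp
  show "restrict f V \<odot>\<^bsub>sec A V\<^esub> (s \<oplus>\<^bsub>sec A V\<^esub> t) =
      restrict f V \<odot>\<^bsub>sec A V\<^esub> s \<oplus>\<^bsub>sec A V\<^esub> restrict f V \<odot>\<^bsub>sec A V\<^esub> t"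
    if "s \<in> carrier (sec A V)" "t \<in> carrier (sec A V)" for s t
    using that fV by (simp add: smult_r_distr)
  show "restrict f V \<odot>\<^bsub>sec A V\<^esub> (g \<odot>\<^bsub>sec A V\<^esub> s) = g \<odot>\<^bsub>sec A V\<^esub> (restrict f V \<odot>\<^bsub>sec A V\<^esub> s)"
    if "g \<in> carrier (reg_ring X V)" "s \<in> carrier (sec A V)" for g s
    using that fV by (simp add: smult_left_commute)
  show "res A V W (restrict f V \<odot>\<^bsub>sec A V\<^esub> s) = restrict f W \<odot>\<^bsub>sec A W\<^esub> res A V W s"
    if "open_in X W" "W \<subseteq> V" "s \<in> carrier (sec A V)" for W s
    using res_smult[OF A V(1) that(1,2) fV that(3)] that by (simp add: Int_absorb1)
qed

lemma restrict_const_fun: "V \<subseteq> U \<Longrightarrow> restrict (const_fun U c) V = const_fun V c"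
  by (auto simp: restrict_def fun_eq_iff)

lemma scalar_endo_mor:
  assumes "mod_presheaf X A" "open_in X X"
  shows "scalar_endo X A c \<in> mor X A A X"
proof -
  have "scalar_endo X A c = hom_family X A X (\<lambda>V s. restrict (const_fun X c) V \<odot>\<^bsub>sec A V\<^esub> s)"
    unfolding scalar_endo_family by (rule hom_family_cong) (simp add: restrict_const_fun del: restrict_restrict)
  then show ?thesis using reg_smult_mor[OF assms(1) reg_const[OF assms(2)] assms(2)] by simp
qed

subsection \<open>The sheaf of homomorphisms\<close>

lemma hom_sheaf_simps:
  "carrier (sec (hom_sheaf X A B) U) = mor X A B U"
  "\<zero>\<^bsub>sec (hom_sheaf X A B) U\<^esub> = hom_family X A U (\<lambda>V s. \<zero>\<^bsub>sec B V\<^esub>)"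
  "\<phi> \<oplus>\<^bsub>sec (hom_sheaf X A B) U\<^esub> \<psi> = hom_family X A U (\<lambda>V s. \<phi> V s \<oplus>\<^bsub>sec B V\<^esub> \<psi> V s)"
  "f \<odot>\<^bsub>sec (hom_sheaf X A B) U\<^esub> \<phi> = hom_family X A U (\<lambda>V s. restrict f V \<odot>\<^bsub>sec B V\<^esub> \<phi> V s)"
  by (simp_all add: hom_sheaf_def hom_family_def)

lemma hom_sheaf_res_eq: "res (hom_sheaf X A B) U V \<phi> = restrict \<phi> {W. open_in X W \<and> W \<subseteq> V}"
  by (simp add: hom_sheaf_def)

text \<open>Each member of a morphism is already extensional on its sections, so discarding the
  opens outside V is the same as passing to the normal form over V.\<close>

lemma hom_sheaf_res:
  assumes "\<phi> \<in> mor X A B U" "V \<subseteq> U"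
  shows "res (hom_sheaf X A B) U V \<phi> = hom_family X A V \<phi>"
proof -
  have "hom_family X A V \<phi> W = \<phi> W" if "open_in X W" "W \<subseteq> V" for W
    using fun_cong[OF mor_family[OF assms(1)], of W] that subset_trans[OF that(2) assms(2)]
    by (simp add: hom_family_def)
  moreover have "hom_family X A V \<phi> W = undefined" if "\<not> (open_in X W \<and> W \<subseteq> V)" for W
    using that by (auto simp: hom_family_def)
  ultimately show ?thesis
    by (auto simp: hom_sheaf_res_eq restrict_def fun_eq_iff)
qed

lemma hom_zero_mor:
  assumes "mod_presheaf X A" "mod_presheaf X B"
  shows "hom_family X A U (\<lambda>V s. \<zero>\<^bsub>sec B V\<^esub>) \<in> mor X A B U"
proof (rule hom_family_mor[OF assms(1)])
  fix V assume V: "open_in X V" "V \<subseteq> U"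
  interpret Module.module "reg_ring X V" "sec B V" by (rule presheaf_module[OF assms(2) V(1)])
  show "\<zero>\<^bsub>sec B V\<^esub> \<in> carrier (sec B V)" "\<zero>\<^bsub>sec B V\<^esub> = \<zero>\<^bsub>sec B V\<^esub> \<oplus>\<^bsub>sec B V\<^esub> \<zero>\<^bsub>sec B V\<^esub>" by simp_all
  show "\<zero>\<^bsub>sec B V\<^esub> = f \<odot>\<^bsub>sec B V\<^esub> \<zero>\<^bsub>sec B V\<^esub>" if "f \<in> carrier (reg_ring X V)" for f
    using that by simp
qed (simp add: res_zero[OF assms(2)])

lemma hom_add_mor:
  assumes A: "mod_presheaf X A" and B: "mod_presheaf X B" and \<phi>: "\<phi> \<in> mor X A B U" and \<psi>: "\<psi> \<in> mor X A B U"
  shows "hom_family X A U (\<lambda>V s. \<phi> V s \<oplus>\<^bsub>sec B V\<^esub> \<psi> V s) \<in> mor X A B U"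
proof (rule hom_family_mor[OF A])
  fix V assume V: "open_in X V" "V \<subseteq> U"
  interpret Module.module "reg_ring X V" "sec B V" by (rule presheaf_module[OF B V(1)])
  note cl = mor_closed[OF \<phi> V] mor_closed[OF \<psi> V]
  show "\<phi> V s \<oplus>\<^bsub>sec B V\<^esub> \<psi> V s \<in> carrier (sec B V)" if "s \<in> carrier (sec A V)" for s
    using that cl by simp
  show "\<phi> V (s \<oplus>\<^bsub>sec A V\<^esub> t) \<oplus>\<^bsub>sec B V\<^esub> \<psi> V (s \<oplus>\<^bsub>sec A V\<^esub> t) =
      (\<phi> V s \<oplus>\<^bsub>sec B V\<^esub> \<psi> V s) \<oplus>\<^bsub>sec B V\<^esub> (\<phi> V t \<oplus>\<^bsub>sec B V\<^esub> \<psi> V t)"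
    if "s \<in> carrier (sec A V)" "t \<in> carrier (sec A V)" for s t
    using that cl by (simp add: mor_add[OF \<phi> V] mor_add[OF \<psi> V] M.a_ac)
  show "\<phi> V (f \<odot>\<^bsub>sec A V\<^esub> s) \<oplus>\<^bsub>sec B V\<^esub> \<psi> V (f \<odot>\<^bsub>sec A V\<^esub> s) = f \<odot>\<^bsub>sec B V\<^esub> (\<phi> V s \<oplus>\<^bsub>sec B V\<^esub> \<psi> V s)"
    if "f \<in> carrier (reg_ring X V)" "s \<in> carrier (sec A V)" for f s
    using that cl by (simp add: mor_smult[OF \<phi> V] mor_smult[OF \<psi> V] smult_r_distr)
  show "res B V W (\<phi> V s \<oplus>\<^bsub>sec B V\<^esub> \<psi> V s) = \<phi> W (res A V W s) \<oplus>\<^bsub>sec B W\<^esub> \<psi> W (res A V W s)"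
    if W: "open_in X W" "W \<subseteq> V" and s: "s \<in> carrier (sec A V)" for W s
    using res_add[OF B V(1) W] cl s mor_res[OF \<phi> V(1) W V(2) s] mor_res[OF \<psi> V(1) W V(2) s] by simp
qed

lemma hom_smult_mor:
  assumes A: "mod_presheaf X A" and B: "mod_presheaf X B" and U: "open_in X U"
    and f: "f \<in> carrier (reg_ring X U)" and \<phi>: "\<phi> \<in> mor X A B U"
  shows "hom_family X A U (\<lambda>V s. restrict f V \<odot>\<^bsub>sec B V\<^esub> \<phi> V s) \<in> mor X A B U"
proof -
  have "mor_comp X A U (hom_family X B U (\<lambda>V s. restrict f V \<odot>\<^bsub>sec B V\<^esub> s)) \<phi> \<in> mor X A B U"
    by (rule mor_comp_mor[OF A \<phi> reg_smult_mor[OF B f U]]) auto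
  also have "mor_comp X A U (hom_family X B U (\<lambda>V s. restrict f V \<odot>\<^bsub>sec B V\<^esub> s)) \<phi> =
      hom_family X A U (\<lambda>V s. restrict f V \<odot>\<^bsub>sec B V\<^esub> \<phi> V s)"
    unfolding mor_comp_def by (rule hom_family_cong) (use \<phi> in \<open>simp add: mor_closed\<close>)
  finally show ?thesis .
qed

lemma hom_presheaf_module:
  assumes A: "mod_presheaf X A" and B: "mod_presheaf X B" and U: "open_in X U"
  shows "Module.module (reg_ring X U) (sec (hom_sheaf X A B) U)"
proof -
  let ?H = "sec (hom_sheaf X A B) U"
  have B': "Module.module (reg_ring X V) (sec B V)" if "open_in X V" for V
    by (rule presheaf_module[OF B that])
  have B'': "abelian_group (sec B V)" if "open_in X V" for V
    by (rule presheaf_group[OF B that])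
  show ?thesis
  proof (intro moduleI abelian_groupI presheaf_cring[OF A U], unfold hom_sheaf_simps(1))
    fix \<phi> \<psi> assume \<phi>: "\<phi> \<in> mor X A B U" and \<psi>: "\<psi> \<in> mor X A B U"
    show *: "\<phi> \<oplus>\<^bsub>?H\<^esub> \<psi> \<in> mor X A B U"
      unfolding hom_sheaf_simps by (rule hom_add_mor[OF A B \<phi> \<psi>])
    show "\<phi> \<oplus>\<^bsub>?H\<^esub> \<psi> = \<psi> \<oplus>\<^bsub>?H\<^esub> \<phi>"
      unfolding hom_sheaf_simps
      using \<phi> \<psi> by (intro hom_family_cong abelian_groupE(4)[OF B'']) (auto simp: mor_closed)
    show "(\<phi> \<oplus>\<^bsub>?H\<^esub> \<psi>) \<oplus>\<^bsub>?H\<^esub> \<eta> = \<phi> \<oplus>\<^bsub>?H\<^esub> (\<psi> \<oplus>\<^bsub>?H\<^esub> \<eta>)" if "\<eta> \<in> mor X A B U" for \<eta>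
      unfolding hom_sheaf_simps
    proof (rule hom_family_cong)
      fix V s assume *: "open_in X V" "V \<subseteq> U" "s \<in> carrier (sec A V)"
      interpret abelian_group "sec B V" by (rule B''[OF *(1)])
      show "hom_family X A U (\<lambda>V s. \<phi> V s \<oplus>\<^bsub>sec B V\<^esub> \<psi> V s) V s \<oplus>\<^bsub>sec B V\<^esub> \<eta> V s =
        \<phi> V s \<oplus>\<^bsub>sec B V\<^esub> hom_family X A U (\<lambda>V s. \<psi> V s \<oplus>\<^bsub>sec B V\<^esub> \<eta> V s) V s"
        using * \<phi> \<psi> that by (simp add: mor_closed a_assoc)
    qed
    fix f assume f: "f \<in> carrier (reg_ring X U)"
    show "f \<odot>\<^bsub>?H\<^esub> (\<phi> \<oplus>\<^bsub>?H\<^esub> \<psi>) = f \<odot>\<^bsub>?H\<^esub> \<phi> \<oplus>\<^bsub>?H\<^esub> f \<odot>\<^bsub>?H\<^esub> \<psi>"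
      unfolding hom_sheaf_simps
    proof (rule hom_family_cong)
      fix V s assume *: "open_in X V" "V \<subseteq> U" "s \<in> carrier (sec A V)"
      interpret Module.module "reg_ring X V" "sec B V" by (rule B'[OF *(1)])
      show "restrict f V \<odot>\<^bsub>sec B V\<^esub> hom_family X A U (\<lambda>V s. \<phi> V s \<oplus>\<^bsub>sec B V\<^esub> \<psi> V s) V s =
        hom_family X A U (\<lambda>V s. restrict f V \<odot>\<^bsub>sec B V\<^esub> \<phi> V s) V s \<oplus>\<^bsub>sec B V\<^esub>
        hom_family X A U (\<lambda>V s. restrict f V \<odot>\<^bsub>sec B V\<^esub> \<psi> V s) V s"
        using * \<phi> \<psi> f by (simp add: mor_closed smult_r_distr reg_restrict)
    qed
  next
    show "\<zero>\<^bsub>?H\<^esub> \<in> mor X A B U" unfolding hom_sheaf_simps by (rule hom_zero_mor[OF A B])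
  next
    fix \<phi> assume \<phi>: "\<phi> \<in> mor X A B U"
    show "\<zero>\<^bsub>?H\<^esub> \<oplus>\<^bsub>?H\<^esub> \<phi> = \<phi>"
      unfolding hom_sheaf_simps
    proof (rule HOL.trans[OF hom_family_cong mor_family[OF \<phi>]])
      fix V s assume *: "open_in X V" "V \<subseteq> U" "s \<in> carrier (sec A V)"
      interpret abelian_group "sec B V" by (rule B''[OF *(1)])
      show "hom_family X A U (\<lambda>V s. \<zero>\<^bsub>sec B V\<^esub>) V s \<oplus>\<^bsub>sec B V\<^esub> \<phi> V s = \<phi> V s"
        using * \<phi> by (simp add: mor_closed)
    qed
    have neg: "hom_family X A U (\<lambda>V s. \<ominus>\<^bsub>sec B V\<^esub> \<phi> V s) \<in> mor X A B U"
    proof (rule hom_family_mor[OF A])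
      fix V assume V: "open_in X V" "V \<subseteq> U"
      interpret Module.module "reg_ring X V" "sec B V" by (rule B'[OF V(1)])
      note cl = mor_closed[OF \<phi> V]
      show "\<ominus>\<^bsub>sec B V\<^esub> \<phi> V s \<in> carrier (sec B V)" if "s \<in> carrier (sec A V)" for s
        using that cl by simp
      show "\<ominus>\<^bsub>sec B V\<^esub> \<phi> V (s \<oplus>\<^bsub>sec A V\<^esub> t) = \<ominus>\<^bsub>sec B V\<^esub> \<phi> V s \<oplus>\<^bsub>sec B V\<^esub> \<ominus>\<^bsub>sec B V\<^esub> \<phi> V t"
        if "s \<in> carrier (sec A V)" "t \<in> carrier (sec A V)" for s t
        using that cl by (simp add: mor_add[OF \<phi> V] M.minus_add)
      show "\<ominus>\<^bsub>sec B V\<^esub> \<phi> V (f \<odot>\<^bsub>sec A V\<^esub> s) = f \<odot>\<^bsub>sec B V\<^esub> (\<ominus>\<^bsub>sec B V\<^esub> \<phi> V s)"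
        if "f \<in> carrier (reg_ring X V)" "s \<in> carrier (sec A V)" for f s
        using that cl by (simp add: mor_smult[OF \<phi> V] smult_r_minus)
      show "res B V W (\<ominus>\<^bsub>sec B V\<^esub> \<phi> V s) = \<ominus>\<^bsub>sec B W\<^esub> \<phi> W (res A V W s)"
        if W: "open_in X W" "W \<subseteq> V" and s: "s \<in> carrier (sec A V)" for W s
        using res_neg[OF B V(1) W] cl s mor_res[OF \<phi> V(1) W V(2) s] by simp
    qed
    have "hom_family X A U (\<lambda>V s. \<ominus>\<^bsub>sec B V\<^esub> \<phi> V s) \<oplus>\<^bsub>?H\<^esub> \<phi> = \<zero>\<^bsub>?H\<^esub>"
      unfolding hom_sheaf_simps
    proof (rule hom_family_cong)
      fix V s assume *: "open_in X V" "V \<subseteq> U" "s \<in> carrier (sec A V)"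
      interpret abelian_group "sec B V" by (rule B''[OF *(1)])
      show "hom_family X A U (\<lambda>V s. \<ominus>\<^bsub>sec B V\<^esub> \<phi> V s) V s \<oplus>\<^bsub>sec B V\<^esub> \<phi> V s = \<zero>\<^bsub>sec B V\<^esub>"
        using * \<phi> by (simp add: mor_closed l_neg)
    qed
    with neg show "\<exists>\<psi>\<in>mor X A B U. \<psi> \<oplus>\<^bsub>?H\<^esub> \<phi> = \<zero>\<^bsub>?H\<^esub>" by blast
    show "\<one>\<^bsub>reg_ring X U\<^esub> \<odot>\<^bsub>?H\<^esub> \<phi> = \<phi>"
      unfolding hom_sheaf_simps
    proof (rule HOL.trans[OF hom_family_cong mor_family[OF \<phi>]])
      fix V s assume *: "open_in X V" "V \<subseteq> U" "s \<in> carrier (sec A V)"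
      interpret Module.module "reg_ring X V" "sec B V" by (rule B'[OF *(1)])
      show "restrict \<one>\<^bsub>reg_ring X U\<^esub> V \<odot>\<^bsub>sec B V\<^esub> \<phi> V s = \<phi> V s"
        using * \<phi> by (simp add: mor_closed restrict_reg_ring)
    qed
    fix f assume f: "f \<in> carrier (reg_ring X U)"
    show "f \<odot>\<^bsub>?H\<^esub> \<phi> \<in> mor X A B U"
      unfolding hom_sheaf_simps by (rule hom_smult_mor[OF A B U f \<phi>])
    fix g assume g: "g \<in> carrier (reg_ring X U)"
    show "(f \<oplus>\<^bsub>reg_ring X U\<^esub> g) \<odot>\<^bsub>?H\<^esub> \<phi> = f \<odot>\<^bsub>?H\<^esub> \<phi> \<oplus>\<^bsub>?H\<^esub> g \<odot>\<^bsub>?H\<^esub> \<phi>"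
      unfolding hom_sheaf_simps
    proof (rule hom_family_cong)
      fix V s assume *: "open_in X V" "V \<subseteq> U" "s \<in> carrier (sec A V)"
      interpret Module.module "reg_ring X V" "sec B V" by (rule B'[OF *(1)])
      show "restrict (f \<oplus>\<^bsub>reg_ring X U\<^esub> g) V \<odot>\<^bsub>sec B V\<^esub> \<phi> V s =
        hom_family X A U (\<lambda>V s. restrict f V \<odot>\<^bsub>sec B V\<^esub> \<phi> V s) V s \<oplus>\<^bsub>sec B V\<^esub>
        hom_family X A U (\<lambda>V s. restrict g V \<odot>\<^bsub>sec B V\<^esub> \<phi> V s) V s"
        using * \<phi> f g by (simp add: mor_closed smult_l_distr reg_restrict restrict_reg_ring)
    qed
    show "(f \<otimes>\<^bsub>reg_ring X U\<^esub> g) \<odot>\<^bsub>?H\<^esub> \<phi> = f \<odot>\<^bsub>?H\<^esub> (g \<odot>\<^bsub>?H\<^esub> \<phi>)"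
      unfolding hom_sheaf_simps
    proof (rule hom_family_cong)
      fix V s assume *: "open_in X V" "V \<subseteq> U" "s \<in> carrier (sec A V)"
      interpret Module.module "reg_ring X V" "sec B V" by (rule B'[OF *(1)])
      show "restrict (f \<otimes>\<^bsub>reg_ring X U\<^esub> g) V \<odot>\<^bsub>sec B V\<^esub> \<phi> V s =
        restrict f V \<odot>\<^bsub>sec B V\<^esub> hom_family X A U (\<lambda>V s. restrict g V \<odot>\<^bsub>sec B V\<^esub> \<phi> V s) V s"
        using * \<phi> f g by (simp add: mor_closed smult_assoc1 reg_restrict restrict_reg_ring)
    qed
  qed
qed

lemma hom_presheaf:
  assumes A: "mod_presheaf X A" and B: "mod_presheaf X B"
  shows "mod_presheaf X (hom_sheaf X A B)"
  unfolding mod_presheaf_def hom_sheaf_simps(1)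
proof (intro conjI allI impI ballI funcsetI)
  fix U V \<phi> assume UV: "open_in X U \<and> open_in X V \<and> V \<subseteq> U" and \<phi>: "\<phi> \<in> mor X A B U"
  let ?H = "hom_sheaf X A B"
  show "res ?H U V \<phi> \<in> mor X A B V"
    using mor_restrict[OF A \<phi>] hom_sheaf_res[OF \<phi>] UV by simp
  show "res ?H U V (\<phi> \<oplus>\<^bsub>sec ?H U\<^esub> \<psi>) = res ?H U V \<phi> \<oplus>\<^bsub>sec ?H V\<^esub> res ?H U V \<psi>"
    if \<psi>: "\<psi> \<in> mor X A B U" for \<psi>
  proof -
    have "res ?H U V (\<phi> \<oplus>\<^bsub>sec ?H U\<^esub> \<psi>) = hom_family X A V (\<phi> \<oplus>\<^bsub>sec ?H U\<^esub> \<psi>)"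
      using UV hom_sheaf_res[of _ X A B U V] hom_add_mor[OF A B \<phi> \<psi>]
      unfolding hom_sheaf_simps(3) by blast
    also have "\<dots> = res ?H U V \<phi> \<oplus>\<^bsub>sec ?H V\<^esub> res ?H U V \<psi>"
      unfolding hom_sheaf_simps(3) using UV \<phi> \<psi>
      by (intro hom_family_cong) (auto simp: hom_sheaf_res)
    finally show ?thesis .
  qed
next
  fix U V f \<phi> assume UV: "open_in X U \<and> open_in X V \<and> V \<subseteq> U" and \<phi>: "\<phi> \<in> mor X A B U"
    and f: "f \<in> carrier (reg_ring X U)"
  let ?H = "hom_sheaf X A B"
  have "res ?H U V (f \<odot>\<^bsub>sec ?H U\<^esub> \<phi>) = hom_family X A V (f \<odot>\<^bsub>sec ?H U\<^esub> \<phi>)"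
    using UV hom_sheaf_res[of _ X A B U V] hom_smult_mor[OF A B _ f \<phi>]
    unfolding hom_sheaf_simps(4) by blast
  also have "\<dots> = restrict f V \<odot>\<^bsub>sec ?H V\<^esub> res ?H U V \<phi>"
    unfolding hom_sheaf_simps(4) using UV \<phi>
    by (intro hom_family_cong) (auto simp: hom_sheaf_res Int_absorb1)
  finally show "res ?H U V (f \<odot>\<^bsub>sec ?H U\<^esub> \<phi>) = restrict f V \<odot>\<^bsub>sec ?H V\<^esub> res ?H U V \<phi>" .
next
  fix U \<phi> assume "open_in X U" and \<phi>: "\<phi> \<in> mor X A B U"
  show "res (hom_sheaf X A B) U U \<phi> = \<phi>"
    using hom_sheaf_res[OF \<phi>, of U] mor_family[OF \<phi>] by simp
next
  fix U V W \<phi> assume "open_in X U \<and> open_in X V \<and> open_in X W \<and> W \<subseteq> V \<and> V \<subseteq> U"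
  then show "res (hom_sheaf X A B) V W (res (hom_sheaf X A B) U V \<phi>) = res (hom_sheaf X A B) U W \<phi>"
    by (auto simp: hom_sheaf_res_eq restrict_def fun_eq_iff)
qed (rule hom_presheaf_module[OF A B])

subsection \<open>Gluing morphisms\<close>

text \<open>Compatibility with restriction moves the comparison of two values over V to
  \<open>V \<inter> T\<close>, where the morphisms agree; separatedness of B brings it back to
  V.\<close>

lemma mor_eq_local:
  assumes A: "mod_presheaf X A" and B: "mod_sheaf X B" and \<phi>: "\<phi> \<in> mor X A B U" and \<psi>: "\<psi> \<in> mor X A B U"
    and loc: "\<And>x. x \<in> U \<Longrightarrow> \<exists>V. open_in X V \<and> x \<in> V \<and>
      (\<forall>W s. open_in X W \<and> W \<subseteq> V \<and> W \<subseteq> U \<and> s \<in> carrier (sec A W) \<longrightarrow> \<phi> W s = \<psi> W s)"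
  shows "\<phi> = \<psi>"
proof (rule mor_eqI[OF \<phi> \<psi>])
  fix V s assume V: "open_in X V" "V \<subseteq> U" and s: "s \<in> carrier (sec A V)"
  show "\<phi> V s = \<psi> V s"
  proof (rule sheaf_eqI[OF B V(1) mor_closed[OF \<phi> V s] mor_closed[OF \<psi> V s]])
    fix x assume x: "x \<in> V"
    then obtain T where T: "open_in X T" "x \<in> T"
      "\<And>W s. open_in X W \<Longrightarrow> W \<subseteq> T \<Longrightarrow> W \<subseteq> U \<Longrightarrow> s \<in> carrier (sec A W) \<Longrightarrow> \<phi> W s = \<psi> W s"
      using loc V(2) by (meson subsetD)
    have TV: "open_in X (V \<inter> T)" using V T open_in_Int by blast
    have "res B V (V \<inter> T) (\<phi> V s) = \<phi> (V \<inter> T) (res A V (V \<inter> T) s)"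
      using mor_res[OF \<phi> V(1) TV _ V(2) s] by simp
    also have "\<dots> = \<psi> (V \<inter> T) (res A V (V \<inter> T) s)"
      using T(3)[OF TV] V(2) res_closed[OF A V(1) TV _ s] by auto
    also have "\<dots> = res B V (V \<inter> T) (\<psi> V s)"
      using mor_res[OF \<psi> V(1) TV _ V(2) s] by simp
    finally show "\<exists>T. open_in X T \<and> x \<in> T \<and> T \<subseteq> V \<and> res B V T (\<phi> V s) = res B V T (\<psi> V s)"
      using TV x T by (intro exI[of _ "V \<inter> T"]) auto
  qed
qed

text \<open>A morphism may be prescribed on a family \<D> of opens that covers U and contains every
  smaller open of each member. The value over an arbitrary V is glued from the prescribed values
  over the members inside V, and linearity follows from uniqueness of gluing.\<close>

lemma mor_glue:
  assumes A: "mod_presheaf X A" and B: "mod_sheaf X B"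
    and D: "\<And>D. D \<in> \<D> \<Longrightarrow> open_in X D" "\<And>D D'. D \<in> \<D> \<Longrightarrow> open_in X D' \<Longrightarrow> D' \<subseteq> D \<Longrightarrow> D' \<in> \<D>"
      "U \<subseteq> \<Union>\<D>"
    and cl: "\<And>V s. V \<in> \<D> \<Longrightarrow> s \<in> carrier (sec A V) \<Longrightarrow> g V s \<in> carrier (sec B V)"
    and add: "\<And>V s t. V \<in> \<D> \<Longrightarrow> s \<in> carrier (sec A V) \<Longrightarrow> t \<in> carrier (sec A V) \<Longrightarrow>
      g V (s \<oplus>\<^bsub>sec A V\<^esub> t) = g V s \<oplus>\<^bsub>sec B V\<^esub> g V t"
    and sm: "\<And>V f s. V \<in> \<D> \<Longrightarrow> f \<in> carrier (reg_ring X V) \<Longrightarrow> s \<in> carrier (sec A V) \<Longrightarrow>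
      g V (f \<odot>\<^bsub>sec A V\<^esub> s) = f \<odot>\<^bsub>sec B V\<^esub> g V s"
    and re: "\<And>V W s. V \<in> \<D> \<Longrightarrow> W \<in> \<D> \<Longrightarrow> W \<subseteq> V \<Longrightarrow> s \<in> carrier (sec A V) \<Longrightarrow>
      res B V W (g V s) = g W (res A V W s)"
  shows "\<exists>\<phi>\<in>mor X A B U. \<forall>V\<in>\<D>. V \<subseteq> U \<longrightarrow> (\<forall>s\<in>carrier (sec A V). \<phi> V s = g V s)"
proof -
  note B' = mod_sheaf_presheaf[OF B]
  \<comment> \<open>\<open>P V s t\<close> says that t has the prescribed restrictions. Since such a
    t is unique, each identity for the extension below is proved by checking \<open>P\<close> for
    its right-hand side.\<close>
  define P where "P V s t \<longleftrightarrow> t \<in> carrier (sec B V) \<and>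
    (\<forall>D\<in>{D \<in> \<D>. D \<subseteq> V}. res B V D t = g D (res A V D s))" for V s t
  have ex: "\<exists>!t. P V s t" if V: "open_in X V" "V \<subseteq> U" and s: "s \<in> carrier (sec A V)" for V s
    unfolding P_def
  proof (rule sheaf_glue[OF B])
    have "x \<in> \<Union>{D \<in> \<D>. D \<subseteq> V}" if x: "x \<in> V" for x
    proof -
      obtain D where "D \<in> \<D>" "x \<in> D" using D(3) V x by blast
      then have "D \<inter> V \<in> \<D>" using D(2)[of D "D \<inter> V"] D(1) V open_in_Int by blast
      with x \<open>x \<in> D\<close> show ?thesis by blast
    qed
    then show "\<Union>{D \<in> \<D>. D \<subseteq> V} = V" by blast
    show "g D (res A V D s) \<in> carrier (sec B D)" if "D \<in> {D \<in> \<D>. D \<subseteq> V}" for D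
      using that V s D(1) by (intro cl res_closed[OF A]) auto
    show "res B D (D \<inter> E) (g D (res A V D s)) = res B E (D \<inter> E) (g E (res A V E s))"
      if "D \<in> {D \<in> \<D>. D \<subseteq> V}" "E \<in> {D \<in> \<D>. D \<subseteq> V}" for D E
    proof -
      have op: "open_in X D" "open_in X E" "open_in X (D \<inter> E)" using that D(1) open_in_Int by auto
      then have DE: "D \<inter> E \<in> \<D>" using that D(2)[of D "D \<inter> E"] by auto
      have "res B D (D \<inter> E) (g D (res A V D s)) = g (D \<inter> E) (res A V (D \<inter> E) s)"
        using re[OF _ DE, of D] that res_res[OF A V(1) op(1,3)] s res_closed[OF A V(1) op(1)] by simp
      moreover have "res B E (D \<inter> E) (g E (res A V E s)) = g (D \<inter> E) (res A V (D \<inter> E) s)"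
        using re[OF _ DE, of E] that res_res[OF A V(1) op(2,3)] s res_closed[OF A V(1) op(2)] by simp
      ultimately show ?thesis by simp
    qed
  qed (use D in auto)
  define h where "h V s = (THE t. P V s t)" for V s
  have h: "P V s (h V s)" if "open_in X V" "V \<subseteq> U" "s \<in> carrier (sec A V)" for V s
    unfolding h_def using theI'[OF ex[OF that]] .
  have hu: "h V s = t" if "open_in X V" "V \<subseteq> U" "s \<in> carrier (sec A V)" "P V s t" for V s t
    using ex[OF that(1-3)] h[OF that(1-3)] that(4) by blast
  have "hom_family X A U h \<in> mor X A B U"
  proof (rule hom_family_mor[OF A])
    fix V assume V: "open_in X V" "V \<subseteq> U"
    interpret A: Module.module "reg_ring X V" "sec A V" by (rule presheaf_module[OF A V(1)])
    interpret B: Module.module "reg_ring X V" "sec B V" by (rule presheaf_module[OF B' V(1)])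
    show hc: "h V s \<in> carrier (sec B V)" if "s \<in> carrier (sec A V)" for s
      using h[OF V that] by (simp add: P_def)
    have hr: "res B V D (h V s) = g D (res A V D s)" if "s \<in> carrier (sec A V)" "D \<in> \<D>" "D \<subseteq> V" for s D
      using h[OF V that(1)] that by (simp add: P_def)
    show "h V (s \<oplus>\<^bsub>sec A V\<^esub> t) = h V s \<oplus>\<^bsub>sec B V\<^esub> h V t"
      if st: "s \<in> carrier (sec A V)" "t \<in> carrier (sec A V)" for s t
    proof (rule hu[OF V A.a_closed[OF st]])
      show "P V (s \<oplus>\<^bsub>sec A V\<^esub> t) (h V s \<oplus>\<^bsub>sec B V\<^esub> h V t)"
        unfolding P_def using st hc D(1) V
        by (auto simp: res_add[OF A] res_add[OF B'] hr add res_closed[OF A])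
    qed
    show "h V (f \<odot>\<^bsub>sec A V\<^esub> s) = f \<odot>\<^bsub>sec B V\<^esub> h V s"
      if fs: "f \<in> carrier (reg_ring X V)" "s \<in> carrier (sec A V)" for f s
    proof (rule hu[OF V A.smult_closed[OF fs]])
      show "P V (f \<odot>\<^bsub>sec A V\<^esub> s) (f \<odot>\<^bsub>sec B V\<^esub> h V s)"
        unfolding P_def using fs hc D(1) V
        by (auto simp: res_smult[OF A] res_smult[OF B'] hr sm res_closed[OF A] reg_restrict)
    qed
    show "res B V W (h V s) = h W (res A V W s)"
      if W: "open_in X W" "W \<subseteq> V" and s: "s \<in> carrier (sec A V)" for W s
    proof (rule hu[symmetric])
      show "P W (res A V W s) (res B V W (h V s))"
        unfolding P_def using W V s hc D(1)
        by (auto simp: res_closed[OF B'] res_res[OF B'] res_res[OF A] hr)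
    qed (use V W s in \<open>auto intro: res_closed[OF A]\<close>)
  qed
  moreover have "h V s = g V s" if "V \<in> \<D>" "V \<subseteq> U" "s \<in> carrier (sec A V)" for V s
  proof (rule hu)
    show "P V s (g V s)"
      unfolding P_def using that cl re by auto
  qed (use that D in auto)
  ultimately show ?thesis
    using D(1) by (intro bexI[of _ "hom_family X A U h"]) auto
qed


section \<open>Sums over multisets\<close>

text \<open>Formal tensors are multisets, so sums have to run over multisets. The membership tests
  inside the fold make its step commute for all arguments, which folding requires; summands outside
  the carrier are skipped.\<close>

definition msum :: "('b, 'c) ring_scheme \<Rightarrow> ('a \<Rightarrow> 'b) \<Rightarrow> 'a multiset \<Rightarrow> 'b" where
  "msum G f = fold_mset (\<lambda>x y. if f x \<in> carrier G \<and> y \<in> carrier G then f x \<oplus>\<^bsub>G\<^esub> y else y) \<zero>\<^bsub>G\<^esub>"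

lemma msum_empty [simp]: "msum G f {#} = \<zero>\<^bsub>G\<^esub>"
  by (simp add: msum_def)

context abelian_monoid
begin

lemma msum_step:
  "msum G f (add_mset x l) =
     (if f x \<in> carrier G \<and> msum G f l \<in> carrier G then f x \<oplus> msum G f l else msum G f l)"
proof -
  interpret comp_fun_commute "\<lambda>x y. if f x \<in> carrier G \<and> y \<in> carrier G then f x \<oplus> y else y"
    by unfold_locales (auto simp: fun_eq_iff a_lcomm)
  show ?thesis by (simp add: msum_def)
qed

lemma msum_closed [simp, intro]: "msum G f l \<in> carrier G"
  by (induction l) (auto simp: msum_step)

lemma msum_add_mset [simp]: "f x \<in> carrier G \<Longrightarrow> msum G f (add_mset x l) = f x \<oplus> msum G f l"
  by (simp add: msum_step)

lemma msum_union: "msum G f (l + k) = msum G f l \<oplus> msum G f k"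
  by (induction l) (auto simp: msum_step a_assoc)

lemma msum_cong: "(\<And>x. x \<in># l \<Longrightarrow> f x = g x) \<Longrightarrow> msum G f l = msum G g l"
  by (induction l) (auto simp: msum_step)

lemma msum_image: "msum G f (image_mset h l) = msum G (\<lambda>x. f (h x)) l"
  by (induction l) (auto simp: msum_step)

lemma msum_zero: "(\<And>x. x \<in># l \<Longrightarrow> f x = \<zero>) \<Longrightarrow> msum G f l = \<zero>"
  by (induction l) (auto simp: msum_step)

lemma msum_mset_set:
  assumes "finite S" "f \<in> S \<rightarrow> carrier G"
  shows "msum G f (mset_set S) = (\<Oplus>i\<in>S. f i)"
  using assms by (induction S rule: finite_induct) (auto simp: finsum_insert Pi_def)

lemma msum_hom:
  assumes "abelian_monoid H" "\<And>x. x \<in># l \<Longrightarrow> f x \<in> carrier G"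
    and "\<And>x. x \<in> carrier G \<Longrightarrow> h x \<in> carrier H"
    and "\<And>x y. x \<in> carrier G \<Longrightarrow> y \<in> carrier G \<Longrightarrow> h (x \<oplus> y) = h x \<oplus>\<^bsub>H\<^esub> h y"
    and "h \<zero> = \<zero>\<^bsub>H\<^esub>"
  shows "h (msum G f l) = msum H (\<lambda>x. h (f x)) l"
proof -
  interpret H: abelian_monoid H by fact
  show ?thesis using assms(2-) by (induction l) auto
qed

end

lemma mor_msum:
  assumes A: "mod_presheaf X A" and B: "mod_presheaf X B" and \<phi>: "\<phi> \<in> mor X A B U"
    and V: "open_in X V" "V \<subseteq> U" and f: "\<And>x. x \<in># l \<Longrightarrow> f x \<in> carrier (sec A V)"
  shows "\<phi> V (msum (sec A V) f l) = msum (sec B V) (\<lambda>x. \<phi> V (f x)) l"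
proof -
  interpret A: abelian_group "sec A V" by (rule presheaf_group[OF A V(1)])
  interpret B: abelian_group "sec B V" by (rule presheaf_group[OF B V(1)])
  show ?thesis
    by (rule A.msum_hom) (use f in \<open>auto simp: mor_closed[OF \<phi> V] mor_add[OF \<phi> V]
        mor_zero[OF A B \<phi> V] intro: B.abelian_monoid_axioms\<close>)
qed

lemma res_msum:
  assumes A: "mod_presheaf X A" and U: "open_in X U" and V: "open_in X V" "V \<subseteq> U"
    and f: "\<And>x. x \<in># l \<Longrightarrow> f x \<in> carrier (sec A U)"
  shows "res A U V (msum (sec A U) f l) = msum (sec A V) (\<lambda>x. res A U V (f x)) l"
proof -
  interpret U: abelian_group "sec A U" by (rule presheaf_group[OF A U(1)])
  interpret V: abelian_group "sec A V" by (rule presheaf_group[OF A V(1)])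
  show ?thesis
    by (rule U.msum_hom) (use f in \<open>auto simp: res_closed[OF A U V] res_add[OF A U V]
        res_zero[OF A U V] intro: V.abelian_monoid_axioms\<close>)
qed

section \<open>First cohomology\<close>

lemma cohomologousD:
  assumes "((U, c), (U', c')) \<in> cohomologous X A"
  obtains W b where "(U, c) \<in> cocycles X A" "(U', c') \<in> cocycles X A" "pt_cover X W"
    "\<forall>x\<in>X. W x \<subseteq> U x" "\<forall>x\<in>X. W x \<subseteq> U' x"
    "\<forall>x\<in>X. b x \<in> carrier (sec A (W x))"
    "\<forall>x\<in>X. \<forall>y\<in>X. let T = W x \<inter> W y in
       res A (U x \<inter> U y) T (c x y) \<oplus>\<^bsub>sec A T\<^esub> res A (W x) T (b x) =
       res A (U' x \<inter> U' y) T (c' x y) \<oplus>\<^bsub>sec A T\<^esub> res A (W y) T (b y)"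
proof -
  from assms obtain W b where *: "(U, c) \<in> cocycles X A" "(U', c') \<in> cocycles X A" "pt_cover X W"
    and 1: "\<forall>x\<in>X. W x \<subseteq> U x \<inter> U' x \<and> b x \<in> carrier (sec A (W x))"
    and 2: "\<forall>x\<in>X. \<forall>y\<in>X. let T = W x \<inter> W y in
           res A (U x \<inter> U y) T (c x y) \<oplus>\<^bsub>sec A T\<^esub> res A (W x) T (b x) =
           res A (U' x \<inter> U' y) T (c' x y) \<oplus>\<^bsub>sec A T\<^esub> res A (W y) T (b y)"
    unfolding cohomologous_def mem_Collect_eq prod.case by (elim conjE exE)
  show thesis
    by (rule that[of W b, OF *]) (use 1 in blast, use 1 in blast, use 1 in blast, rule 2)
qed

lemma cohomologousI:
  assumes "(U, c) \<in> cocycles X A" "(U', c') \<in> cocycles X A" "pt_cover X W"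
    "\<And>x. x \<in> X \<Longrightarrow> W x \<subseteq> U x" "\<And>x. x \<in> X \<Longrightarrow> W x \<subseteq> U' x"
    "\<And>x. x \<in> X \<Longrightarrow> b x \<in> carrier (sec A (W x))"
    "\<And>x y. x \<in> X \<Longrightarrow> y \<in> X \<Longrightarrow> let T = W x \<inter> W y in
       res A (U x \<inter> U y) T (c x y) \<oplus>\<^bsub>sec A T\<^esub> res A (W x) T (b x) =
       res A (U' x \<inter> U' y) T (c' x y) \<oplus>\<^bsub>sec A T\<^esub> res A (W y) T (b y)"
  shows "((U, c), (U', c')) \<in> cohomologous X A"
  unfolding cohomologous_def mem_Collect_eq prod.case
  by (intro conjI exI[of _ W] exI[of _ b] ballI assms Int_greatest)

lemma cocycles_cover: "(U, c) \<in> cocycles X A \<Longrightarrow> pt_cover X U"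
  by (simp add: cocycles_def)

lemma cocycles_closed:
  "(U, c) \<in> cocycles X A \<Longrightarrow> x \<in> X \<Longrightarrow> y \<in> X \<Longrightarrow> c x y \<in> carrier (sec A (U x \<inter> U y))"
  by (simp add: cocycles_def)

lemma pt_cover_open: "pt_cover X U \<Longrightarrow> x \<in> X \<Longrightarrow> open_in X (U x)"
  by (simp add: pt_cover_def)

lemma pt_cover_mem: "pt_cover X U \<Longrightarrow> x \<in> X \<Longrightarrow> x \<in> U x"
  by (simp add: pt_cover_def)

text \<open>The two bounding 0-cochains are added on the common refinement
  \<open>W x \<inter> W' x\<close>. Covers indexed by points need no choice of refinement
  map.\<close>

lemma cohomologous_trans:
  assumes A: "mod_presheaf X A"
    and 1: "((U, c), (U', c')) \<in> cohomologous X A" and 2: "((U', c'), (U'', c'')) \<in> cohomologous X A"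
  shows "((U, c), (U'', c'')) \<in> cohomologous X A"
proof -
  from 1 obtain W b where W0: "(U, c) \<in> cocycles X A" "(U', c') \<in> cocycles X A" "pt_cover X W"
    "\<forall>x\<in>X. W x \<subseteq> U x" "\<forall>x\<in>X. W x \<subseteq> U' x"
    "\<forall>x\<in>X. b x \<in> carrier (sec A (W x))"
    and Wb0: "\<forall>x\<in>X. \<forall>y\<in>X. let T = W x \<inter> W y in
       res A (U x \<inter> U y) T (c x y) \<oplus>\<^bsub>sec A T\<^esub> res A (W x) T (b x) =
       res A (U' x \<inter> U' y) T (c' x y) \<oplus>\<^bsub>sec A T\<^esub> res A (W y) T (b y)"
    by (rule cohomologousD)
  note W = W0[rule_format]
  note Wb = Wb0[rule_format]

  from 2 obtain W' b' where W0': "(U'', c'') \<in> cocycles X A" "pt_cover X W'"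
    "\<forall>x\<in>X. W' x \<subseteq> U' x" "\<forall>x\<in>X. W' x \<subseteq> U'' x"
    "\<forall>x\<in>X. b' x \<in> carrier (sec A (W' x))"
    and Wb0': "\<forall>x\<in>X. \<forall>y\<in>X. let T = W' x \<inter> W' y in
       res A (U' x \<inter> U' y) T (c' x y) \<oplus>\<^bsub>sec A T\<^esub> res A (W' x) T (b' x) =
       res A (U'' x \<inter> U'' y) T (c'' x y) \<oplus>\<^bsub>sec A T\<^esub> res A (W' y) T (b' y)"
    by (rule cohomologousD)
  note W' = W0'[rule_format]
  note Wb' = Wb0'[rule_format]

  note op = pt_cover_open[OF W(3)] pt_cover_open[OF W'(2)] pt_cover_open[OF cocycles_cover[OF W(1)]]
    pt_cover_open[OF cocycles_cover[OF W(2)]] pt_cover_open[OF cocycles_cover[OF W'(1)]] open_in_Int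
  define S where "S x = W x \<inter> W' x" for x
  define d where "d x = res A (W x) (S x) (b x) \<oplus>\<^bsub>sec A (S x)\<^esub> res A (W' x) (S x) (b' x)" for x
  have opS: "open_in X (S x)" if "x \<in> X" for x using that by (simp add: S_def op)
  have d1: "res A (W x) (S x) (b x) \<in> carrier (sec A (S x))" "res A (W' x) (S x) (b' x) \<in> carrier (sec A (S x))"
    if "x \<in> X" for x
    using that by (auto intro!: res_closed[OF A] op opS W W' simp: S_def)
  show ?thesis
  proof (rule cohomologousI[where W = S and b = d])
    show "pt_cover X S"
      using opS pt_cover_mem[OF W(3)] pt_cover_mem[OF W'(2)] by (simp add: pt_cover_def S_def)
    show "d x \<in> carrier (sec A (S x))" if "x \<in> X" for x
      using d1[OF that] abelian_groupE(1)[OF presheaf_group[OF A opS[OF that]]] by (simp add: d_def)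
    fix x y assume xy: "x \<in> X" "y \<in> X"
    define T where T: "T = S x \<inter> S y"
    have opT: "open_in X T" using xy opS T open_in_Int by blast
    interpret T: abelian_group "sec A T" by (rule presheaf_group[OF A opT])
    let ?r = "\<lambda>V. res A V T"
    have rd: "?r (S z) (d z) = ?r (W z) (b z) \<oplus>\<^bsub>sec A T\<^esub> ?r (W' z) (b' z)" if z: "z \<in> X" "T \<subseteq> S z" for z
      unfolding d_def using z d1[OF z(1)] opT opS op
      by (subst res_add[OF A]) (auto simp: S_def res_res[OF A] W W')
    have sub: "T \<subseteq> W x" "T \<subseteq> W y" "T \<subseteq> W' x" "T \<subseteq> W' y" "T \<subseteq> U x \<inter> U y" "T \<subseteq> U' x \<inter> U' y"
      "T \<subseteq> U'' x \<inter> U'' y"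
      using W(4,5)[OF xy(1)] W(4,5)[OF xy(2)] W'(4)[OF xy(1)] W'(4)[OF xy(2)]
      by (auto simp: T S_def)
    have subS: "T \<subseteq> S x" "T \<subseteq> S y" by (simp_all add: T)
    have cl: "?r (W x) (b x) \<in> carrier (sec A T)" "?r (W y) (b y) \<in> carrier (sec A T)"
      "?r (W' x) (b' x) \<in> carrier (sec A T)" "?r (W' y) (b' y) \<in> carrier (sec A T)"
      "?r (U x \<inter> U y) (c x y) \<in> carrier (sec A T)" "?r (U' x \<inter> U' y) (c' x y) \<in> carrier (sec A T)"
      "?r (U'' x \<inter> U'' y) (c'' x y) \<in> carrier (sec A T)"
      using xy W(6) W'(5) sub opT cocycles_closed[OF W(1) xy] cocycles_closed[OF W(2) xy]
        cocycles_closed[OF W'(1) xy]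
      by (simp_all add: res_closed[OF A] op)
    \<comment> \<open>The hypothesis relates the cocycles over \<open>W x \<inter> W y\<close>; it
      is restricted to the smaller \<open>T\<close>, where it can be combined with the second
      relation.\<close>
    have e1: "?r (U x \<inter> U y) (c x y) \<oplus>\<^bsub>sec A T\<^esub> ?r (W x) (b x) =
        ?r (U' x \<inter> U' y) (c' x y) \<oplus>\<^bsub>sec A T\<^esub> ?r (W y) (b y)"
    proof -
      let ?T = "W x \<inter> W y"
      have o: "open_in X ?T" "T \<subseteq> ?T" using xy op T by (auto simp: S_def)
      have "res A ?T T (res A (U x \<inter> U y) ?T (c x y) \<oplus>\<^bsub>sec A ?T\<^esub> res A (W x) ?T (b x)) =
        res A ?T T (res A (U' x \<inter> U' y) ?T (c' x y) \<oplus>\<^bsub>sec A ?T\<^esub> res A (W y) ?T (b y))"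
        using Wb[OF xy] by (simp add: Let_def)
      moreover have "?T \<subseteq> U x \<inter> U y" "?T \<subseteq> U' x \<inter> U' y" using W(4,5) xy by blast+
      ultimately show ?thesis
        using xy o opT cocycles_closed[OF W(1) xy] cocycles_closed[OF W(2) xy] W(6)
        by (simp add: res_add[OF A] res_res[OF A] res_closed[OF A] op)
    qed
    have e2: "?r (U' x \<inter> U' y) (c' x y) \<oplus>\<^bsub>sec A T\<^esub> ?r (W' x) (b' x) =
        ?r (U'' x \<inter> U'' y) (c'' x y) \<oplus>\<^bsub>sec A T\<^esub> ?r (W' y) (b' y)"
    proof -
      let ?T = "W' x \<inter> W' y"
      have o: "open_in X ?T" "T \<subseteq> ?T" using xy op T by (auto simp: S_def)
      have "res A ?T T (res A (U' x \<inter> U' y) ?T (c' x y) \<oplus>\<^bsub>sec A ?T\<^esub> res A (W' x) ?T (b' x)) =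
        res A ?T T (res A (U'' x \<inter> U'' y) ?T (c'' x y) \<oplus>\<^bsub>sec A ?T\<^esub> res A (W' y) ?T (b' y))"
        using Wb'[OF xy] by (simp add: Let_def)
      moreover have "?T \<subseteq> U' x \<inter> U' y" "?T \<subseteq> U'' x \<inter> U'' y" using W'(3,4) xy by blast+
      ultimately show ?thesis
        using xy o opT cocycles_closed[OF W(2) xy] cocycles_closed[OF W'(1) xy] W'(5)
        by (simp add: res_add[OF A] res_res[OF A] res_closed[OF A] op)
    qed
    have "?r (U x \<inter> U y) (c x y) \<oplus>\<^bsub>sec A T\<^esub> ?r (S x) (d x) =
        (?r (U x \<inter> U y) (c x y) \<oplus>\<^bsub>sec A T\<^esub> ?r (W x) (b x)) \<oplus>\<^bsub>sec A T\<^esub> ?r (W' x) (b' x)"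
      using cl subS by (simp add: rd xy T.a_assoc)
    also have "\<dots> = (?r (U' x \<inter> U' y) (c' x y) \<oplus>\<^bsub>sec A T\<^esub> ?r (W' x) (b' x)) \<oplus>\<^bsub>sec A T\<^esub> ?r (W y) (b y)"
      unfolding e1 using cl by (simp add: T.a_ac)
    also have "\<dots> = ?r (U'' x \<inter> U'' y) (c'' x y) \<oplus>\<^bsub>sec A T\<^esub> ?r (S y) (d y)"
      unfolding e2 using cl subS by (simp add: rd xy T.a_ac)
    finally show "let T = S x \<inter> S y in
       res A (U x \<inter> U y) T (c x y) \<oplus>\<^bsub>sec A T\<^esub> res A (S x) T (d x) =
       res A (U'' x \<inter> U'' y) T (c'' x y) \<oplus>\<^bsub>sec A T\<^esub> res A (S y) T (d y)"
      by (simp add: Let_def T)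
  qed (simp_all add: S_def W W' le_infI1 le_infI2)
qed

text \<open>The same refinement serves with the negated 0-cochain: c + b(x) = c' + b(y) is
  rearranged to c' - b(x) = c - b(y).\<close>

lemma cohomologous_sym:
  assumes A: "mod_presheaf X A" and "((U, c), (U', c')) \<in> cohomologous X A"
  shows "((U', c'), (U, c)) \<in> cohomologous X A"
proof -
  from assms(2) obtain W b where W0: "(U, c) \<in> cocycles X A" "(U', c') \<in> cocycles X A" "pt_cover X W"
    "\<forall>x\<in>X. W x \<subseteq> U x" "\<forall>x\<in>X. W x \<subseteq> U' x"
    "\<forall>x\<in>X. b x \<in> carrier (sec A (W x))"
    and eq0: "\<forall>x\<in>X. \<forall>y\<in>X. let T = W x \<inter> W y in
       res A (U x \<inter> U y) T (c x y) \<oplus>\<^bsub>sec A T\<^esub> res A (W x) T (b x) =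
       res A (U' x \<inter> U' y) T (c' x y) \<oplus>\<^bsub>sec A T\<^esub> res A (W y) T (b y)"
    by (rule cohomologousD)
  note W = W0[rule_format]
  note eq = eq0[rule_format]

  note op = pt_cover_open[OF W(3)] pt_cover_open[OF cocycles_cover[OF W(1)]]
    pt_cover_open[OF cocycles_cover[OF W(2)]] open_in_Int
  show ?thesis
  proof (rule cohomologousI[OF W(2,1,3,5,4)])
    show "\<ominus>\<^bsub>sec A (W x)\<^esub> b x \<in> carrier (sec A (W x))" if "x \<in> X" for x
      using W(6)[OF that] abelian_group.a_inv_closed[OF presheaf_group[OF A op(1)[OF that]]] by simp
    fix x y assume xy: "x \<in> X" "y \<in> X"
    define T where "T = W x \<inter> W y"
    have opT: "open_in X T" "T \<subseteq> W x" "T \<subseteq> W y" using xy op by (auto simp: T_def)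
    then have sub: "T \<subseteq> U x \<inter> U y" "T \<subseteq> U' x \<inter> U' y" using W(4,5) xy by blast+
    interpret T: abelian_group "sec A T" by (rule presheaf_group[OF A opT(1)])
    have cl: "res A (W x) T (b x) \<in> carrier (sec A T)" "res A (W y) T (b y) \<in> carrier (sec A T)"
      "res A (U x \<inter> U y) T (c x y) \<in> carrier (sec A T)" "res A (U' x \<inter> U' y) T (c' x y) \<in> carrier (sec A T)"
      using xy opT sub W(6) cocycles_closed[OF W(1)] cocycles_closed[OF W(2)]
      by (simp_all add: res_closed[OF A] op)
    have swap: "c2 \<oplus>\<^bsub>sec A T\<^esub> \<ominus>\<^bsub>sec A T\<^esub> bx = c1 \<oplus>\<^bsub>sec A T\<^esub> \<ominus>\<^bsub>sec A T\<^esub> by"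
      if "c1 \<oplus>\<^bsub>sec A T\<^esub> bx = c2 \<oplus>\<^bsub>sec A T\<^esub> by" "c1 \<in> carrier (sec A T)" "c2 \<in> carrier (sec A T)"
        "bx \<in> carrier (sec A T)" "by \<in> carrier (sec A T)" for c1 c2 bx "by"
    proof -
      have "c1 = c2 \<oplus>\<^bsub>sec A T\<^esub> by \<oplus>\<^bsub>sec A T\<^esub> \<ominus>\<^bsub>sec A T\<^esub> bx"
        using that by (simp add: T.add.inv_solve_right)
      also have "\<dots> = c2 \<oplus>\<^bsub>sec A T\<^esub> \<ominus>\<^bsub>sec A T\<^esub> bx \<oplus>\<^bsub>sec A T\<^esub> by"
        using that by (simp add: T.a_ac)
      finally show ?thesis using that(2-5) by (simp add: T.a_assoc T.r_neg)
    qed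
    show "let T = W x \<inter> W y in
       res A (U' x \<inter> U' y) T (c' x y) \<oplus>\<^bsub>sec A T\<^esub> res A (W x) T (\<ominus>\<^bsub>sec A (W x)\<^esub> b x) =
       res A (U x \<inter> U y) T (c x y) \<oplus>\<^bsub>sec A T\<^esub> res A (W y) T (\<ominus>\<^bsub>sec A (W y)\<^esub> b y)"
      unfolding Let_def T_def[symmetric]
      using xy opT W(6) swap[OF eq[OF xy, unfolded Let_def T_def[symmetric]]] cl
      by (simp add: res_neg[OF A] op)
  qed
qed

lemma zero_cocycle:
  assumes A: "mod_presheaf X A" and X: "open_in X X"
  shows "(\<lambda>x. X, \<lambda>x y. \<zero>\<^bsub>sec A X\<^esub>) \<in> cocycles X A"
proof -
  interpret abelian_group "sec A X" by (rule presheaf_group[OF A X])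
  show ?thesis using X by (simp add: cocycles_def pt_cover_def res_id[OF A])
qed

text \<open>Classes are sets of cocycles, and by symmetry and transitivity the class of any u
  cohomologous to the zero cocycle equals the class of the latter. Vanishing in H^1 thus reduces to
  exhibiting one coboundary.\<close>

lemma H1_zeroI:
  assumes A: "mod_presheaf X A" and X: "open_in X X" and \<xi>: "\<xi> \<in> carrier (H1 X A)"
    and z: "(\<lambda>x. X, \<lambda>x y. \<zero>\<^bsub>sec A X\<^esub>) \<in> \<xi>"
  shows "\<xi> = \<zero>\<^bsub>H1 X A\<^esub>"
proof -
  obtain u where u: "\<xi> = cohomologous X A `` {u}"
    using \<xi> by (auto simp: H1_def quotient_def)
  then have uz: "(u, (\<lambda>x. X, \<lambda>x y. \<zero>\<^bsub>sec A X\<^esub>)) \<in> cohomologous X A" using z by simp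
  then have "cohomologous X A `` {u} = cohomologous X A `` {(\<lambda>x. X, \<lambda>x y. \<zero>\<^bsub>sec A X\<^esub>)}"
    by (cases u) (auto intro: cohomologous_trans[OF A] dest: cohomologous_sym[OF A])
  then show ?thesis by (simp add: u H1_def)
qed


section \<open>Finite-dimensional vector spaces and trivial bundles\<close>

lemma Cfield_simps [simp]:
  "carrier Cfield = UNIV" "a \<oplus>\<^bsub>Cfield\<^esub> b = a + b" "a \<otimes>\<^bsub>Cfield\<^esub> b = a * b"
  "\<zero>\<^bsub>Cfield\<^esub> = 0" "\<one>\<^bsub>Cfield\<^esub> = 1"
  by (simp_all add: Cfield_def)

lemma dual_space_iff:
  "l \<in> carrier (dual_space M) \<longleftrightarrow> l \<in> extensional (carrier M) \<and>
     (\<forall>w\<in>carrier M. \<forall>w'\<in>carrier M. l (w \<oplus>\<^bsub>M\<^esub> w') = l w + l w') \<and>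
     (\<forall>c. \<forall>w\<in>carrier M. l (c \<odot>\<^bsub>M\<^esub> w) = c * l w)"
  by (auto simp: dual_space_def PiE_def)

lemma dual_space_simps:
  "\<zero>\<^bsub>dual_space M\<^esub> = (\<lambda>w\<in>carrier M. 0)"
  "l \<oplus>\<^bsub>dual_space M\<^esub> l' = (\<lambda>w\<in>carrier M. l w + l' w)"
  "c \<odot>\<^bsub>dual_space M\<^esub> l = (\<lambda>w\<in>carrier M. c * l w)"
  by (simp_all add: dual_space_def)

lemma dual_space_eqI:
  assumes "l \<in> carrier (dual_space M)" "l' \<in> carrier (dual_space M)"
    and "\<And>w. w \<in> carrier M \<Longrightarrow> l w = l' w"
  shows "l = l'"
  using assms by (intro extensionalityI[of l "carrier M" l']) (auto simp: dual_space_iff)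

lemma dual_space_zero:
  assumes "Module.module Cfield M" "l \<in> carrier (dual_space M)"
  shows "l \<zero>\<^bsub>M\<^esub> = 0"
proof -
  interpret Module.module Cfield M by fact
  have "l (0 \<odot>\<^bsub>M\<^esub> \<zero>\<^bsub>M\<^esub>) = 0 * l \<zero>\<^bsub>M\<^esub>"
    using assms(2) unfolding dual_space_iff by (elim conjE) (drule spec, erule bspec, simp)
  then show ?thesis using smult_r_null[of 0] by simp
qed

lemma dual_space_module:
  assumes "Module.module Cfield M"
  shows "Module.module Cfield (dual_space M)"
proof -
  interpret Module.module Cfield M by fact
  have sm: "c \<odot>\<^bsub>M\<^esub> w \<in> carrier M" if "w \<in> carrier M" for c w using that by simp
  show ?thesis
  proof (intro moduleI abelian_groupI R.is_cring)
    fix l assume l: "l \<in> carrier (dual_space M)"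
    show "\<exists>k\<in>carrier (dual_space M). k \<oplus>\<^bsub>dual_space M\<^esub> l = \<zero>\<^bsub>dual_space M\<^esub>"
      using l sm by (intro bexI[of _ "\<lambda>w\<in>carrier M. - l w"]) (auto simp: dual_space_iff dual_space_simps fun_eq_iff)
    show "\<zero>\<^bsub>dual_space M\<^esub> \<oplus>\<^bsub>dual_space M\<^esub> l = l" "\<one>\<^bsub>Cfield\<^esub> \<odot>\<^bsub>dual_space M\<^esub> l = l"
      using l sm by (auto simp: dual_space_iff dual_space_simps extensional_def fun_eq_iff)
  qed (auto simp: dual_space_iff dual_space_simps fun_eq_iff algebra_simps sm)
qed

text \<open>Regularity of a section of a trivial bundle is tested by functionals on the fibre. The
  fibre used later is itself a dual space, and the functionals needed on it are these
  evaluations.\<close>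

lemma dual_eval:
  "w \<in> carrier M \<Longrightarrow> Module.module Cfield M \<Longrightarrow>
     (\<lambda>l\<in>carrier (dual_space M). l w) \<in> carrier (dual_space (dual_space M))"
proof -
  assume w: "w \<in> carrier M" and "Module.module Cfield M"
  then interpret D: Module.module Cfield "dual_space M" by (intro dual_space_module)
  show ?thesis
    unfolding dual_space_iff[of _ "dual_space M"]
    using w D.smult_closed D.a_closed by (auto simp: dual_space_simps)
qed

text \<open>A basis with its coordinate functionals, packaged as pairs (l, w) such that m is the sum
  of the l(m) w. Later arguments use only this expansion; the basis itself is forgotten.\<close>

lemma finite_coordinates:
  assumes "vectorspace Cfield M" "vectorspace.fin_dim Cfield M"
  obtains cb where "set_mset cb \<subseteq> carrier (dual_space M) \<times> carrier M"
    "\<And>m. m \<in> carrier M \<Longrightarrow> m = msum M (\<lambda>(l, w). l m \<odot>\<^bsub>M\<^esub> w) cb"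
proof -
  interpret vectorspace Cfield M by fact
  obtain B where B: "finite B" "basis B" using finite_basis_exists assms(2) by blast
  then have BM: "B \<subseteq> carrier M" by (simp add: basis_def)
  have ex: "\<exists>!a. a \<in> B \<rightarrow>\<^sub>E carrier Cfield \<and> lincomb a B = m" if "m \<in> carrier M" for m
    using basis_criterion[OF B(1) BM] B(2) that by blast
  define co where "co m = (THE a. a \<in> B \<rightarrow>\<^sub>E carrier Cfield \<and> lincomb a B = m)" for m
  have co: "co m \<in> B \<rightarrow>\<^sub>E carrier Cfield" "lincomb (co m) B = m" if "m \<in> carrier M" for m
    using theI'[OF ex[OF that]] unfolding co_def by auto
  \<comment> \<open>Uniqueness of coordinates is what makes them linear: the sum or the multiple of
    coordinate vectors represents the sum or the multiple.\<close>
  have cu: "co m = a" if "a \<in> B \<rightarrow>\<^sub>E UNIV" "lincomb a B = m" for a m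
  proof -
    have "m \<in> carrier M" using that BM by auto
    then show ?thesis using ex[of m] co[of m] that by auto
  qed
  have cadd: "co (m \<oplus>\<^bsub>M\<^esub> m') b = co m b + co m' b"
    if "m \<in> carrier M" "m' \<in> carrier M" "b \<in> B" for m m' b
  proof -
    have "co (m \<oplus>\<^bsub>M\<^esub> m') = (\<lambda>b\<in>B. co m b + co m' b)"
    proof (rule cu)
      have "lincomb (\<lambda>b\<in>B. co m b + co m' b) B = (\<Oplus>\<^bsub>M\<^esub>b\<in>B. co m b \<odot>\<^bsub>M\<^esub> b \<oplus>\<^bsub>M\<^esub> co m' b \<odot>\<^bsub>M\<^esub> b)"
        unfolding lincomb_def using BM smult_l_distr by (intro M.finsum_cong') auto
      also have "\<dots> = lincomb (co m) B \<oplus>\<^bsub>M\<^esub> lincomb (co m') B"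
        unfolding lincomb_def using BM by (intro M.finsum_addf) auto
      finally show "lincomb (\<lambda>b\<in>B. co m b + co m' b) B = m \<oplus>\<^bsub>M\<^esub> m'"
        using co that by simp
    qed simp
    then show ?thesis using that by simp
  qed
  have csm: "co (c \<odot>\<^bsub>M\<^esub> m) b = c * co m b" if "m \<in> carrier M" "b \<in> B" for c m b
  proof -
    have "co (c \<odot>\<^bsub>M\<^esub> m) = (\<lambda>b\<in>B. c * co m b)"
    proof (rule cu)
      have "lincomb (\<lambda>b\<in>B. c * co m b) B = (\<Oplus>\<^bsub>M\<^esub>b\<in>B. c \<odot>\<^bsub>M\<^esub> (co m b \<odot>\<^bsub>M\<^esub> b))"
        unfolding lincomb_def using BM smult_assoc1 by (intro M.finsum_cong') auto
      also have "\<dots> = c \<odot>\<^bsub>M\<^esub> lincomb (co m) B"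
        unfolding lincomb_def using BM B(1) by (intro finsum_smult_ldistr[symmetric]) auto
      finally show "lincomb (\<lambda>b\<in>B. c * co m b) B = c \<odot>\<^bsub>M\<^esub> m"
        using co that by simp
    qed simp
    then show ?thesis using that by simp
  qed
  define cb where "cb = image_mset (\<lambda>b. (\<lambda>m\<in>carrier M. co m b, b)) (mset_set B)"
  show thesis
  proof (rule that[of cb])
    show "set_mset cb \<subseteq> carrier (dual_space M) \<times> carrier M"
      using B(1) BM cadd csm smult_closed by (auto simp: cb_def dual_space_iff)
    fix m assume m: "m \<in> carrier M"
    have "msum M (\<lambda>(l, w). l m \<odot>\<^bsub>M\<^esub> w) cb = msum M (\<lambda>b. co m b \<odot>\<^bsub>M\<^esub> b) (mset_set B)"
      unfolding cb_def M.msum_image using m by simp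
    also have "\<dots> = lincomb (co m) B"
      unfolding lincomb_def using BM B(1) by (intro M.msum_mset_set) auto
    finally show "m = msum M (\<lambda>(l, w). l m \<odot>\<^bsub>M\<^esub> w) cb" using co m by simp
  qed
qed

section \<open>Trivial bundles: the sheaf axioms and the expansion of sections in constant
  ones\<close>

lemma trivial_bundle_simps:
  "carrier (sec (trivial_bundle X V) U) = {t \<in> U \<rightarrow>\<^sub>E carrier V.
          \<forall>l\<in>carrier (dual_space V). (\<lambda>x\<in>U. l (t x)) \<in> carrier (reg_ring X U)}"
  "\<zero>\<^bsub>sec (trivial_bundle X V) U\<^esub> = (\<lambda>x\<in>U. \<zero>\<^bsub>V\<^esub>)"
  "s \<oplus>\<^bsub>sec (trivial_bundle X V) U\<^esub> t = (\<lambda>x\<in>U. s x \<oplus>\<^bsub>V\<^esub> t x)"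
  "f \<odot>\<^bsub>sec (trivial_bundle X V) U\<^esub> t = (\<lambda>x\<in>U. f x \<odot>\<^bsub>V\<^esub> t x)"
  "res (trivial_bundle X V) U W t = restrict t W"
  by (simp_all add: trivial_bundle_def)

lemma trivial_bundle_value:
  "t \<in> carrier (sec (trivial_bundle X V) U) \<Longrightarrow> x \<in> U \<Longrightarrow> t x \<in> carrier V"
  by (auto simp: trivial_bundle_simps)

lemma trivial_bundle_regular:
  "t \<in> carrier (sec (trivial_bundle X V) U) \<Longrightarrow> l \<in> carrier (dual_space V) \<Longrightarrow>
     (\<lambda>x\<in>U. l (t x)) \<in> carrier (reg_ring X U)"
  by (auto simp: trivial_bundle_simps)

lemma trivial_bundle_const:
  "open_in X U \<Longrightarrow> v \<in> carrier V \<Longrightarrow> (\<lambda>x\<in>U. v) \<in> carrier (sec (trivial_bundle X V) U)"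
  by (auto simp: trivial_bundle_simps intro: reg_const cong: restrict_cong)

lemma trivial_bundle_eqI:
  assumes "s \<in> carrier (sec (trivial_bundle X V) U)" "t \<in> carrier (sec (trivial_bundle X V) U)"
    and "\<And>x. x \<in> U \<Longrightarrow> s x = t x"
  shows "s = t"
  using assms by (intro extensionalityI[of s U t]) (auto simp: trivial_bundle_simps PiE_def)

lemma trivial_bundle_presheaf:
  assumes R: "\<And>U. open_in X U \<Longrightarrow> cring (reg_ring X U)" and V: "Module.module Cfield V"
  shows "mod_presheaf X (trivial_bundle X V)"
proof -
  interpret V: Module.module Cfield V by fact
  let ?A = "trivial_bundle X V"
  have smV: "c \<odot>\<^bsub>V\<^esub> v \<in> carrier V" if "v \<in> carrier V" for c v using that by simp
  have add: "(\<lambda>x\<in>U. s x \<oplus>\<^bsub>V\<^esub> t x) \<in> carrier (sec ?A U)"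
    if U: "open_in X U" and s: "s \<in> carrier (sec ?A U)" and t: "t \<in> carrier (sec ?A U)" for U s t
    unfolding trivial_bundle_simps(1)
  proof (intro CollectI conjI ballI)
    show "(\<lambda>x\<in>U. s x \<oplus>\<^bsub>V\<^esub> t x) \<in> U \<rightarrow>\<^sub>E carrier V"
      using s t by (auto simp: trivial_bundle_value)
    fix l assume l: "l \<in> carrier (dual_space V)"
    interpret cring "reg_ring X U" by (rule R[OF U])
    have "(\<lambda>x\<in>U. l (s x)) \<oplus>\<^bsub>reg_ring X U\<^esub> (\<lambda>x\<in>U. l (t x)) \<in> carrier (reg_ring X U)"
      using s t l by (intro a_closed trivial_bundle_regular)
    also have "(\<lambda>x\<in>U. l (s x)) \<oplus>\<^bsub>reg_ring X U\<^esub> (\<lambda>x\<in>U. l (t x)) =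
        (\<lambda>x\<in>U. l ((\<lambda>x\<in>U. s x \<oplus>\<^bsub>V\<^esub> t x) x))"
      using l trivial_bundle_value[OF s] trivial_bundle_value[OF t]
      by (auto simp: reg_ring_simps dual_space_iff fun_eq_iff restrict_def)
    finally show "(\<lambda>x\<in>U. l ((\<lambda>x\<in>U. s x \<oplus>\<^bsub>V\<^esub> t x) x)) \<in> carrier (reg_ring X U)" .
  qed
  have smu: "(\<lambda>x\<in>U. f x \<odot>\<^bsub>V\<^esub> t x) \<in> carrier (sec ?A U)"
    if U: "open_in X U" and f: "f \<in> carrier (reg_ring X U)" and t: "t \<in> carrier (sec ?A U)" for U f t
    unfolding trivial_bundle_simps(1)
  proof (intro CollectI conjI ballI)
    show "(\<lambda>x\<in>U. f x \<odot>\<^bsub>V\<^esub> t x) \<in> U \<rightarrow>\<^sub>E carrier V"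
      using t by (auto simp: trivial_bundle_value smV)
    fix l assume l: "l \<in> carrier (dual_space V)"
    interpret cring "reg_ring X U" by (rule R[OF U])
    have "f \<otimes>\<^bsub>reg_ring X U\<^esub> (\<lambda>x\<in>U. l (t x)) \<in> carrier (reg_ring X U)"
      using f t l by (intro m_closed trivial_bundle_regular)
    also have "f \<otimes>\<^bsub>reg_ring X U\<^esub> (\<lambda>x\<in>U. l (t x)) = (\<lambda>x\<in>U. l ((\<lambda>x\<in>U. f x \<odot>\<^bsub>V\<^esub> t x) x))"
      using l trivial_bundle_value[OF t]
      by (auto simp: reg_ring_simps dual_space_iff fun_eq_iff restrict_def)
    finally show "(\<lambda>x\<in>U. l ((\<lambda>x\<in>U. f x \<odot>\<^bsub>V\<^esub> t x) x)) \<in> carrier (reg_ring X U)" .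
  qed
  have "Module.module (reg_ring X U) (sec ?A U)" if U: "open_in X U" for U
  proof (intro moduleI abelian_groupI R U)
    fix s assume s: "s \<in> carrier (sec ?A U)"
    note sv = trivial_bundle_value[OF s]
    have sx: "s \<in> extensional U" using s by (auto simp: trivial_bundle_simps PiE_def)
    show "\<zero>\<^bsub>sec ?A U\<^esub> \<oplus>\<^bsub>sec ?A U\<^esub> s = s" "\<one>\<^bsub>reg_ring X U\<^esub> \<odot>\<^bsub>sec ?A U\<^esub> s = s"
      using sv V.smult_one
      by (auto simp: trivial_bundle_simps reg_ring_simps intro!: extensionalityI[OF _ sx])
    show "\<exists>y\<in>carrier (sec ?A U). y \<oplus>\<^bsub>sec ?A U\<^esub> s = \<zero>\<^bsub>sec ?A U\<^esub>"
    proof (rule bexI)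
      \<comment> \<open>The negative is taken as -1 times s, so its regularity is an instance of
        closure under multiplication by regular functions.\<close>
      show "(\<lambda>x\<in>U. const_fun U (-1) x \<odot>\<^bsub>V\<^esub> s x) \<in> carrier (sec ?A U)"
        by (rule smu[OF U reg_const[OF U] s])
      have "(-1) \<odot>\<^bsub>V\<^esub> v \<oplus>\<^bsub>V\<^esub> v = \<zero>\<^bsub>V\<^esub>" if "v \<in> carrier V" for v
        using V.smult_l_distr[of "-1" 1 v] V.smult_one[OF that] V.smult_l_null[OF that] that by simp
      then show "(\<lambda>x\<in>U. const_fun U (-1) x \<odot>\<^bsub>V\<^esub> s x) \<oplus>\<^bsub>sec ?A U\<^esub> s = \<zero>\<^bsub>sec ?A U\<^esub>"
        using sv by (auto simp: trivial_bundle_simps fun_eq_iff restrict_def)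
    qed
  next
    show "\<zero>\<^bsub>sec ?A U\<^esub> \<in> carrier (sec ?A U)"
      using trivial_bundle_const[OF U V.zero_closed] by (simp add: trivial_bundle_simps(2))
  next
    fix s t assume s: "s \<in> carrier (sec ?A U)" and t: "t \<in> carrier (sec ?A U)"
    note sv = trivial_bundle_value[OF s] trivial_bundle_value[OF t]
    show "s \<oplus>\<^bsub>sec ?A U\<^esub> t \<in> carrier (sec ?A U)"
      unfolding trivial_bundle_simps(3) by (rule add[OF U s t])
    show "s \<oplus>\<^bsub>sec ?A U\<^esub> t = t \<oplus>\<^bsub>sec ?A U\<^esub> s"
      unfolding trivial_bundle_simps(3) by (rule restrict_ext) (simp add: sv V.a_comm)
    fix f assume f: "f \<in> carrier (reg_ring X U)"
    show "f \<odot>\<^bsub>sec ?A U\<^esub> (s \<oplus>\<^bsub>sec ?A U\<^esub> t) = f \<odot>\<^bsub>sec ?A U\<^esub> s \<oplus>\<^bsub>sec ?A U\<^esub> f \<odot>\<^bsub>sec ?A U\<^esub> t"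
      unfolding trivial_bundle_simps(3,4) by (rule restrict_ext) (simp add: sv V.smult_r_distr)
  next
    fix s t r assume "s \<in> carrier (sec ?A U)" "t \<in> carrier (sec ?A U)" "r \<in> carrier (sec ?A U)"
    note sv = this[THEN trivial_bundle_value]
    show "s \<oplus>\<^bsub>sec ?A U\<^esub> t \<oplus>\<^bsub>sec ?A U\<^esub> r = s \<oplus>\<^bsub>sec ?A U\<^esub> (t \<oplus>\<^bsub>sec ?A U\<^esub> r)"
      unfolding trivial_bundle_simps(3) by (rule restrict_ext) (simp add: sv V.a_assoc)
  next
    fix f t assume f: "f \<in> carrier (reg_ring X U)" and t: "t \<in> carrier (sec ?A U)"
    show "f \<odot>\<^bsub>sec ?A U\<^esub> t \<in> carrier (sec ?A U)"
      unfolding trivial_bundle_simps(4) by (rule smu[OF U f t])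
    fix g
    show "(f \<oplus>\<^bsub>reg_ring X U\<^esub> g) \<odot>\<^bsub>sec ?A U\<^esub> t = f \<odot>\<^bsub>sec ?A U\<^esub> t \<oplus>\<^bsub>sec ?A U\<^esub> g \<odot>\<^bsub>sec ?A U\<^esub> t"
      unfolding trivial_bundle_simps(3,4) reg_ring_simps using V.smult_l_distr
      by (intro restrict_ext) (simp add: trivial_bundle_value[OF t])
    show "(f \<otimes>\<^bsub>reg_ring X U\<^esub> g) \<odot>\<^bsub>sec ?A U\<^esub> t = f \<odot>\<^bsub>sec ?A U\<^esub> (g \<odot>\<^bsub>sec ?A U\<^esub> t)"
      unfolding trivial_bundle_simps(3,4) reg_ring_simps using V.smult_assoc1
      by (intro restrict_ext) (simp add: trivial_bundle_value[OF t])
  qed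
  moreover have "restrict t W \<in> carrier (sec ?A W)"
    if "open_in X U" "open_in X W" "W \<subseteq> U" "t \<in> carrier (sec ?A U)" for U W t
    unfolding trivial_bundle_simps(1)
  proof (intro CollectI conjI ballI)
    show "restrict t W \<in> W \<rightarrow>\<^sub>E carrier V"
      using that trivial_bundle_value[OF that(4)] by auto
    fix l assume "l \<in> carrier (dual_space V)"
    from reg_restrict[OF trivial_bundle_regular[OF that(4) this] that(2,3)]
    have "restrict (\<lambda>x\<in>U. l (t x)) W \<in> carrier (reg_ring X W)" .
    also have "restrict (\<lambda>x\<in>U. l (t x)) W = (\<lambda>x\<in>W. l (restrict t W x))"
      using that(3) by (auto simp: restrict_def fun_eq_iff)
    finally show "(\<lambda>x\<in>W. l (restrict t W x)) \<in> carrier (reg_ring X W)" .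
  qed
  ultimately show ?thesis
    unfolding mod_presheaf_def trivial_bundle_simps(5)
    by (intro conjI allI impI ballI funcsetI)
      (auto simp: trivial_bundle_simps(3,4) restrict_def fun_eq_iff PiE_def extensional_def
        simp: trivial_bundle_simps(1))
qed

lemma trivial_bundle_sheaf:
  assumes R: "\<And>U. open_in X U \<Longrightarrow> cring (reg_ring X U)" and V: "Module.module Cfield V"
  shows "mod_sheaf X (trivial_bundle X V)"
proof (rule mod_sheafI[OF trivial_bundle_presheaf[OF R V]], unfold trivial_bundle_simps(5))
  fix \<U> s
  let ?A = "trivial_bundle X V"
  assume op: "\<And>U. U \<in> \<U> \<Longrightarrow> open_in X U" and s: "\<And>U. U \<in> \<U> \<Longrightarrow> s U \<in> carrier (sec ?A U)"
    and eq: "\<And>U V. U \<in> \<U> \<Longrightarrow> V \<in> \<U> \<Longrightarrow> restrict (s U) (U \<inter> V) = restrict (s V) (U \<inter> V)"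
  have ext: "t \<in> extensional U" if "t \<in> carrier (sec ?A U)" for t U
    using that by (auto simp: trivial_bundle_simps PiE_def)
  obtain t where t: "t \<in> extensional (\<Union>\<U>)" "\<And>U. U \<in> \<U> \<Longrightarrow> restrict t U = s U"
    using function_glue[of \<U> s] eq ext s by metis
  have ts: "t x = s U x" if "U \<in> \<U>" "x \<in> U" for U x
    using fun_cong[OF t(2)[OF that(1)], of x] that by simp
  have "t \<in> carrier (sec ?A (\<Union>\<U>))"
    unfolding trivial_bundle_simps(1)
  proof (intro CollectI conjI ballI)
    show "t \<in> \<Union>\<U> \<rightarrow>\<^sub>E carrier V"
      using t(1) ts trivial_bundle_value[OF s] by (auto simp: PiE_def)
    fix l assume l: "l \<in> carrier (dual_space V)"
    show "(\<lambda>x\<in>\<Union>\<U>. l (t x)) \<in> carrier (reg_ring X (\<Union>\<U>))"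
    proof (rule reg_local)
      fix x assume "x \<in> \<Union>\<U>"
      then obtain U where U: "U \<in> \<U>" "x \<in> U" by blast
      have "restrict (\<lambda>x\<in>\<Union>\<U>. l (t x)) U = (\<lambda>x\<in>U. l (s U x))"
        using U ts by (auto simp: restrict_def fun_eq_iff)
      then have "restrict (\<lambda>x\<in>\<Union>\<U>. l (t x)) U \<in> carrier (reg_ring X U)"
        using trivial_bundle_regular[OF s[OF U(1)] l] by simp
      then show "\<exists>V. open_in X V \<and> x \<in> V \<and> V \<subseteq> \<Union>\<U> \<and>
          restrict (\<lambda>x\<in>\<Union>\<U>. l (t x)) V \<in> carrier (reg_ring X V)"
        using U op by (intro exI[of _ U]) auto
    qed simp
  qed
  with t ext show "\<exists>!t. t \<in> carrier (sec ?A (\<Union>\<U>)) \<and> (\<forall>U\<in>\<U>. restrict t U = s U)"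
    by (intro ex1I[of _ t]) (auto intro!: extensional_Union_eqI[of _ \<U> t])
qed

text \<open>A functional t(x) on M is determined by its values on the vectors w of
  \<open>cb\<close>: t(x)(m) is the sum of the l(m) t(x)(w). Hence in the dual of M the two entries
  of a pair exchange their roles: the constants l become the generators and evaluation at w the
  coordinate.\<close>

lemma trivial_bundle_expand:
  assumes R: "\<And>U. open_in X U \<Longrightarrow> cring (reg_ring X U)" and M: "Module.module Cfield M"
    and cb: "set_mset cb \<subseteq> carrier (dual_space M) \<times> carrier M"
      "\<And>m. m \<in> carrier M \<Longrightarrow> m = msum M (\<lambda>(l, w). l m \<odot>\<^bsub>M\<^esub> w) cb"
    and U: "open_in X U" and t: "t \<in> carrier (sec (trivial_bundle X (dual_space M)) U)"
  shows "t = msum (sec (trivial_bundle X (dual_space M)) U)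
    (\<lambda>(l, w). (\<lambda>x\<in>U. t x w) \<odot>\<^bsub>sec (trivial_bundle X (dual_space M)) U\<^esub> (\<lambda>x\<in>U. l)) cb"
    and "w \<in> carrier M \<Longrightarrow> (\<lambda>x\<in>U. t x w) \<in> carrier (reg_ring X U)"
proof -
  let ?V = "dual_space M" and ?A = "trivial_bundle X (dual_space M)"
  interpret M: Module.module Cfield M by fact
  interpret V: Module.module Cfield ?V by (rule dual_space_module[OF M])
  interpret A: Module.module "reg_ring X U" "sec ?A U"
    by (rule presheaf_module[OF trivial_bundle_presheaf[OF R V.module_axioms] U])
  note tv = trivial_bundle_value[OF t]
  show reg: "(\<lambda>x\<in>U. t x w) \<in> carrier (reg_ring X U)" if "w \<in> carrier M" for w
  proof -
    have "(\<lambda>x\<in>U. (\<lambda>l\<in>carrier ?V. l w) (t x)) \<in> carrier (reg_ring X U)"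
      by (rule trivial_bundle_regular[OF t dual_eval[OF that M]])
    also have "(\<lambda>x\<in>U. (\<lambda>l\<in>carrier ?V. l w) (t x)) = (\<lambda>x\<in>U. t x w)"
      by (rule restrict_ext) (simp add: tv)
    finally show ?thesis .
  qed
  define f where "f = (\<lambda>(l, w). (\<lambda>x\<in>U. t x w) \<odot>\<^bsub>sec ?A U\<^esub> (\<lambda>x\<in>U. l))"
  have f: "f z \<in> carrier (sec ?A U)" if "z \<in># cb" for z
  proof -
    have "fst z \<in> carrier ?V" "snd z \<in> carrier M" using that cb(1) by auto
    then show ?thesis
      using reg trivial_bundle_const[OF U, of "fst z"] by (simp add: f_def split_beta)
  qed
  have "t = msum (sec ?A U) f cb"
  proof (rule trivial_bundle_eqI[OF t A.msum_closed])
    fix x assume x: "x \<in> U"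
    have fx: "f z x \<in> carrier ?V" if "z \<in># cb" for z
      by (rule trivial_bundle_value[OF f[OF that] x])
    have "msum (sec ?A U) f cb x = msum ?V (\<lambda>z. f z x) cb"
      using f x by (intro A.msum_hom) (auto simp: trivial_bundle_simps(2,3) trivial_bundle_value
          intro: V.abelian_monoid_axioms)
    \<comment> \<open>Both sides are functionals on M. They are compared at a vector m, whose
      expansion in \<open>cb\<close> is pulled through \<open>t x\<close> by linearity.\<close>
    moreover have "t x = msum ?V (\<lambda>z. f z x) cb"
    proof (rule dual_space_eqI[OF tv[OF x] V.msum_closed])
      fix m assume m: "m \<in> carrier M"
      have "msum ?V (\<lambda>z. f z x) cb m = msum Cfield (\<lambda>z. f z x m) cb"
        using m by (intro V.msum_hom fx) (auto simp: dual_space_simps intro: M.R.abelian_monoid_axioms)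
      also have "\<dots> = msum Cfield (\<lambda>z. t x ((\<lambda>(l, w). l m \<odot>\<^bsub>M\<^esub> w) z)) cb"
      proof (rule M.R.msum_cong)
        fix z assume "z \<in># cb"
        then have z: "fst z \<in> carrier ?V" "snd z \<in> carrier M" using cb(1) by auto
        have "f z x m = t x (snd z) * fst z m"
          using z m x by (simp add: f_def split_beta trivial_bundle_simps(4) dual_space_simps)
        also have "\<dots> = t x (fst z m \<odot>\<^bsub>M\<^esub> snd z)"
          using tv[OF x] z by (simp add: dual_space_iff)
        finally show "f z x m = t x ((\<lambda>(l, w). l m \<odot>\<^bsub>M\<^esub> w) z)" by (simp add: split_beta)
      qed
      also have "\<dots> = t x (msum M (\<lambda>(l, w). l m \<odot>\<^bsub>M\<^esub> w) cb)"
        using cb(1) tv[OF x] dual_space_zero[OF M tv[OF x]] M.smult_closed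
        by (intro M.msum_hom[symmetric]) (auto simp: dual_space_iff intro: M.R.abelian_monoid_axioms)
      finally show "t x m = msum ?V (\<lambda>z. f z x) cb m" using cb(2)[OF m] by simp
    qed
    ultimately show "t x = msum (sec ?A U) f cb x" by simp
  qed
  then show "t = msum (sec ?A U) (\<lambda>(l, w). (\<lambda>x\<in>U. t x w) \<odot>\<^bsub>sec ?A U\<^esub> (\<lambda>x\<in>U. l)) cb"
    by (simp add: f_def)
qed


section \<open>Dual bases and vector bundles\<close>

lemma res_finsum:
  assumes A: "mod_presheaf X A" and U: "open_in X U" and V: "open_in X V" "V \<subseteq> U"
    and S: "finite S" and f: "f \<in> S \<rightarrow> carrier (sec A U)"
  shows "res A U V (\<Oplus>\<^bsub>sec A U\<^esub>i\<in>S. f i) = (\<Oplus>\<^bsub>sec A V\<^esub>i\<in>S. res A U V (f i))"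
proof -
  interpret U: abelian_group "sec A U" by (rule presheaf_group[OF A U(1)])
  interpret V: abelian_group "sec A V" by (rule presheaf_group[OF A V(1)])
  have "res A U V (msum (sec A U) f (mset_set S)) = msum (sec A V) (\<lambda>i. res A U V (f i)) (mset_set S)"
    using S f by (intro res_msum[OF A U V]) auto
  then show ?thesis
    using S f res_closed[OF A U V] by (simp add: U.msum_mset_set V.msum_mset_set Pi_def)
qed

text \<open>The dual basis of a finitely generated projective module, spread over all smaller opens.
  The vectors b may be dependent and no rank is recorded; what matters is that each section is
  recovered from its coordinates \<beta>.\<close>

definition dual_basis :: "'n::finite pt set \<Rightarrow> ('n pt, 's) msheaf \<Rightarrow> 'n pt set
    \<Rightarrow> (('n pt set \<Rightarrow> 's \<Rightarrow> 'n pt \<Rightarrow> complex) \<times> 's) multiset \<Rightarrow> bool" where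
  "dual_basis X N U db \<longleftrightarrow> set_mset db \<subseteq> mor X N (struct_sheaf X) U \<times> carrier (sec N U) \<and>
     (\<forall>V s. open_in X V \<and> V \<subseteq> U \<and> s \<in> carrier (sec N V) \<longrightarrow>
        s = msum (sec N V) (\<lambda>(\<beta>, b). \<beta> V s \<odot>\<^bsub>sec N V\<^esub> res N U V b) db)"

lemma dual_basis_expand:
  "dual_basis X N U db \<Longrightarrow> open_in X V \<Longrightarrow> V \<subseteq> U \<Longrightarrow> s \<in> carrier (sec N V) \<Longrightarrow>
    s = msum (sec N V) (\<lambda>(\<beta>, b). \<beta> V s \<odot>\<^bsub>sec N V\<^esub> res N U V b) db"
  by (simp add: dual_basis_def)

lemma dual_basis_mem:
  "dual_basis X N U db \<Longrightarrow> z \<in># db \<Longrightarrow> fst z \<in> mor X N (struct_sheaf X) U"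
  "dual_basis X N U db \<Longrightarrow> z \<in># db \<Longrightarrow> snd z \<in> carrier (sec N U)"
  by (auto simp: dual_basis_def)

lemma dual_basis_restrict:
  assumes N: "mod_presheaf X N" and db: "dual_basis X N U db"
    and U: "open_in X U" "open_in X U'" "U' \<subseteq> U"
  shows "dual_basis X N U' (image_mset (\<lambda>(\<beta>, b). (hom_family X N U' \<beta>, res N U U' b)) db)"
  unfolding dual_basis_def
proof (intro conjI allI impI)
  let ?db = "image_mset (\<lambda>(\<beta>, b). (hom_family X N U' \<beta>, res N U U' b)) db"
  show "set_mset ?db \<subseteq> mor X N (struct_sheaf X) U' \<times> carrier (sec N U')"
    using dual_basis_mem[OF db] mor_restrict[OF N _ U(3)] res_closed[OF N U] by fastforce
  fix V s assume V: "open_in X V \<and> V \<subseteq> U' \<and> s \<in> carrier (sec N V)"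
  interpret Module.module "reg_ring X V" "sec N V" using V presheaf_module[OF N] by blast
  have "s = msum (sec N V) (\<lambda>(\<beta>, b). \<beta> V s \<odot>\<^bsub>sec N V\<^esub> res N U V b) db"
    by (rule dual_basis_expand[OF db]) (use V U in auto)
  also have "\<dots> = msum (sec N V) (\<lambda>(\<beta>, b). \<beta> V s \<odot>\<^bsub>sec N V\<^esub> res N U' V b) ?db"
    unfolding M.msum_image
    by (rule M.msum_cong) (use V U dual_basis_mem[OF db] in \<open>auto simp: split_beta res_res[OF N]\<close>)
  finally show "s = msum (sec N V) (\<lambda>(\<beta>, b). \<beta> V s \<odot>\<^bsub>sec N V\<^esub> res N U' V b) ?db" .
qed

section \<open>Local frames and their coordinate functionals\<close>

definition frame :: "'n::finite pt set \<Rightarrow> ('n pt, 's) msheaf \<Rightarrow> 'n pt set \<Rightarrow> nat \<Rightarrow> (nat \<Rightarrow> 's) \<Rightarrow> bool" where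
  "frame X A U r b \<longleftrightarrow> b \<in> {..<r} \<rightarrow> carrier (sec A U) \<and>
     (\<forall>V. open_in X V \<and> V \<subseteq> U \<longrightarrow>
        (\<forall>s\<in>carrier (sec A V). \<exists>!a. a \<in> {..<r::nat} \<rightarrow>\<^sub>E carrier (reg_ring X V) \<and>
           s = (\<Oplus>\<^bsub>sec A V\<^esub>i\<in>{..<r}. a i \<odot>\<^bsub>sec A V\<^esub> res A U V (b i))))"

lemma frame_unique:
  assumes "frame X A U r b" "open_in X V" "V \<subseteq> U" "s \<in> carrier (sec A V)"
  shows "\<exists>!a. a \<in> {..<r} \<rightarrow>\<^sub>E carrier (reg_ring X V) \<and>
     s = (\<Oplus>\<^bsub>sec A V\<^esub>i\<in>{..<r}. a i \<odot>\<^bsub>sec A V\<^esub> res A U V (b i))"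
  by (rule assms(1)[unfolded frame_def, THEN conjunct2, rule_format, OF conjI[OF assms(2,3)] assms(4)])

lemma frame_coeffs_eq:
  assumes "frame X A U r b" "open_in X V" "V \<subseteq> U" "s \<in> carrier (sec A V)"
    and a: "a \<in> {..<r} \<rightarrow>\<^sub>E carrier (reg_ring X V)"
      "s = (\<Oplus>\<^bsub>sec A V\<^esub>i\<in>{..<r}. a i \<odot>\<^bsub>sec A V\<^esub> res A U V (b i))"
    and a': "a' \<in> {..<r} \<rightarrow>\<^sub>E carrier (reg_ring X V)"
      "s = (\<Oplus>\<^bsub>sec A V\<^esub>i\<in>{..<r}. a' i \<odot>\<^bsub>sec A V\<^esub> res A U V (b i))"
  shows "a = a'"
proof -
  obtain c where "\<And>a. a \<in> {..<r} \<rightarrow>\<^sub>E carrier (reg_ring X V) \<and>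
     s = (\<Oplus>\<^bsub>sec A V\<^esub>i\<in>{..<r}. a i \<odot>\<^bsub>sec A V\<^esub> res A U V (b i)) \<Longrightarrow> a = c"
    using frame_unique[OF assms(1-4)] by (elim ex1E) (rule that, elim allE, erule mp)
  from this[OF conjI[OF a]] this[OF conjI[OF a']] show ?thesis by simp
qed

lemma vector_bundle_frame:
  "vector_bundle X A \<Longrightarrow> x \<in> X \<Longrightarrow> \<exists>U r b. open_in X U \<and> x \<in> U \<and> frame X A U r b"
  unfolding vector_bundle_def frame_def by (elim conjE) (erule bspec)

text \<open>Because coordinates in a frame are unique over every smaller open, each of them is
  additive, linear over regular functions and compatible with restriction. It is therefore a
  morphism to the structure sheaf.\<close>

lemma frame_dual_basis:
  assumes N: "mod_presheaf X N" and U: "open_in X U" and fr: "frame X N U r b"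
  shows "\<exists>db. dual_basis X N U db"
proof -
  have b: "b i \<in> carrier (sec N U)" if "i < r" for i using fr that by (auto simp: frame_def)
  let ?lc = "\<lambda>V a. \<Oplus>\<^bsub>sec N V\<^esub>i\<in>{..<r}. a i \<odot>\<^bsub>sec N V\<^esub> res N U V (b i)"
  define co where "co V s = (THE a. a \<in> {..<r} \<rightarrow>\<^sub>E carrier (reg_ring X V) \<and> s = ?lc V a)" for V s
  have ex: "\<exists>!a. a \<in> {..<r} \<rightarrow>\<^sub>E carrier (reg_ring X V) \<and> s = ?lc V a"
    if "open_in X V" "V \<subseteq> U" "s \<in> carrier (sec N V)" for V s
    by (rule frame_unique[OF fr that])
  have co_props: "co V s \<in> {..<r} \<rightarrow>\<^sub>E carrier (reg_ring X V) \<and> s = ?lc V (co V s)"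
    if "open_in X V" "V \<subseteq> U" "s \<in> carrier (sec N V)" for V s
    unfolding co_def by (rule theI'[OF ex[OF that]])
  note co = conjunct1[OF co_props] conjunct2[OF co_props]
  have cu: "co V s i = a i" if V: "open_in X V" "V \<subseteq> U" and s: "s \<in> carrier (sec N V)"
      and a: "a \<in> {..<r} \<rightarrow> carrier (reg_ring X V)" "s = ?lc V a" and i: "i < r" for V s a i
  proof -
    interpret Module.module "reg_ring X V" "sec N V" by (rule presheaf_module[OF N V(1)])
    \<comment> \<open>Uniqueness in a frame concerns coefficient families extensional on
      \<open>{..<r}\<close>, so a is first cut down to this index set.\<close>
    have "?lc V (restrict a {..<r}) = ?lc V a"
      using a(1) b res_closed[OF N U V] by (intro M.finsum_cong') auto
    then have "co V s = restrict a {..<r}"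
      using a by (intro frame_coeffs_eq[OF fr V s co[OF V s]]) auto
    then show ?thesis using i by simp
  qed
  have cr: "co V s i \<in> carrier (reg_ring X V)"
    if "open_in X V" "V \<subseteq> U" "s \<in> carrier (sec N V)" "i < r" for V s i
    using co(1)[OF that(1-3)] that(4) by auto
  define \<beta> where "\<beta> i = hom_family X N U (\<lambda>V s. co V s i)" for i
  have \<beta>: "\<beta> i \<in> mor X N (struct_sheaf X) U" if i: "i < r" for i
    unfolding \<beta>_def
  proof (rule hom_family_mor[OF N], unfold struct_sheaf_simps)
    fix V assume V: "open_in X V" "V \<subseteq> U"
    interpret Module.module "reg_ring X V" "sec N V" by (rule presheaf_module[OF N V(1)])
    have bV: "res N U V (b i) \<in> carrier (sec N V)" if "i < r" for i
      using b that res_closed[OF N U V] by simp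
    show "co V s i \<in> carrier (reg_ring X V)" if "s \<in> carrier (sec N V)" for s
      using cr V that i by blast
    show "co V (s \<oplus>\<^bsub>sec N V\<^esub> t) i = co V s i \<oplus>\<^bsub>reg_ring X V\<^esub> co V t i"
      if s: "s \<in> carrier (sec N V)" and t: "t \<in> carrier (sec N V)" for s t
    proof (rule cu[OF V _ _ _ i])
      have "?lc V (\<lambda>i. co V s i \<oplus>\<^bsub>reg_ring X V\<^esub> co V t i) = ?lc V (co V s) \<oplus>\<^bsub>sec N V\<^esub> ?lc V (co V t)"
      proof -
        have "?lc V (\<lambda>i. co V s i \<oplus>\<^bsub>reg_ring X V\<^esub> co V t i) = (\<Oplus>\<^bsub>sec N V\<^esub>i\<in>{..<r}.
            co V s i \<odot>\<^bsub>sec N V\<^esub> res N U V (b i) \<oplus>\<^bsub>sec N V\<^esub> co V t i \<odot>\<^bsub>sec N V\<^esub> res N U V (b i))"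
          using cr[OF V s] cr[OF V t] bV by (intro M.finsum_cong') (auto simp: smult_l_distr)
        also have "\<dots> = ?lc V (co V s) \<oplus>\<^bsub>sec N V\<^esub> ?lc V (co V t)"
          using cr[OF V s] cr[OF V t] bV by (intro M.finsum_addf) auto
        finally show ?thesis .
      qed
      then show "s \<oplus>\<^bsub>sec N V\<^esub> t = ?lc V (\<lambda>i. co V s i \<oplus>\<^bsub>reg_ring X V\<^esub> co V t i)"
        using co(2)[OF V s] co(2)[OF V t] by simp
    qed (use s t cr[OF V s] cr[OF V t] in auto)
    show "co V (f \<odot>\<^bsub>sec N V\<^esub> s) i = f \<odot>\<^bsub>reg_ring X V\<^esub> co V s i"
      if f: "f \<in> carrier (reg_ring X V)" and s: "s \<in> carrier (sec N V)" for f s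
    proof -
      have "co V (f \<odot>\<^bsub>sec N V\<^esub> s) i = f \<otimes>\<^bsub>reg_ring X V\<^esub> co V s i"
      proof (rule cu[OF V _ _ _ i])
        have "?lc V (\<lambda>i. f \<otimes>\<^bsub>reg_ring X V\<^esub> co V s i) = f \<odot>\<^bsub>sec N V\<^esub> ?lc V (co V s)"
          using cr[OF V s] bV f
          by (subst finsum_smult_ldistr) (auto intro!: M.finsum_cong' simp: smult_assoc1)
        then show "f \<odot>\<^bsub>sec N V\<^esub> s = ?lc V (\<lambda>i. f \<otimes>\<^bsub>reg_ring X V\<^esub> co V s i)"
          using co(2)[OF V s] by simp
      qed (use f s cr[OF V s] in auto)
      then show ?thesis by (simp add: reg_ring_simps)
    qed
    show "restrict (co V s i) W = co W (res N V W s) i"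
      if W: "open_in X W" "W \<subseteq> V" and s: "s \<in> carrier (sec N V)" for W s
    proof (rule cu[symmetric, OF W(1) _ res_closed[OF N V(1) W s] _ _ i])
      show "W \<subseteq> U" using W V by auto
      show "(\<lambda>i. restrict (co V s i) W) \<in> {..<r} \<rightarrow> carrier (reg_ring X W)"
        by (intro Pi_I reg_restrict[OF cr[OF V s] W]) simp
      have WU: "W \<subseteq> U" using W V by auto
      interpret W: Module.module "reg_ring X W" "sec N W" by (rule presheaf_module[OF N W(1)])
      have rW: "restrict (co V s i) W \<in> carrier (reg_ring X W)" if "i < r" for i
        by (rule reg_restrict[OF cr[OF V s that] W])
      have "res N V W s = res N V W (?lc V (co V s))" using co(2)[OF V s] by simp
      also have "\<dots> = (\<Oplus>\<^bsub>sec N W\<^esub>i\<in>{..<r}. res N V W (co V s i \<odot>\<^bsub>sec N V\<^esub> res N U V (b i)))"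
        using cr[OF V s] bV by (intro res_finsum[OF N V(1) W]) auto
      also have "\<dots> = ?lc W (\<lambda>i. restrict (co V s i) W)"
        using cr[OF V s] bV b W V WU rW
        by (intro W.M.finsum_cong')
          (auto simp: res_smult[OF N V(1) W] res_res[OF N U V(1) W(1)] reg_restrict res_closed[OF N U])
      finally show "res N V W s = ?lc W (\<lambda>i. restrict (co V s i) W)" .
    qed
  qed
  define db where "db = image_mset (\<lambda>i. (\<beta> i, b i)) (mset_set {..<r})"
  have "dual_basis X N U db"
    unfolding dual_basis_def
  proof (intro conjI allI impI)
    show "set_mset db \<subseteq> mor X N (struct_sheaf X) U \<times> carrier (sec N U)"
      using \<beta> b by (auto simp: db_def)
    fix V s assume Vs: "open_in X V \<and> V \<subseteq> U \<and> s \<in> carrier (sec N V)"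
    then have V: "open_in X V" "V \<subseteq> U" and s: "s \<in> carrier (sec N V)" by auto
    interpret Module.module "reg_ring X V" "sec N V" by (rule presheaf_module[OF N V(1)])
    have "msum (sec N V) (\<lambda>(\<beta>, b). \<beta> V s \<odot>\<^bsub>sec N V\<^esub> res N U V b) db =
        msum (sec N V) (\<lambda>i. co V s i \<odot>\<^bsub>sec N V\<^esub> res N U V (b i)) (mset_set {..<r})"
      unfolding db_def M.msum_image using V s by (simp add: \<beta>_def)
    also have "\<dots> = ?lc V (co V s)"
      using cr[OF V s] b res_closed[OF N U V] by (intro M.msum_mset_set) auto
    finally show "s = msum (sec N V) (\<lambda>(\<beta>, b). \<beta> V s \<odot>\<^bsub>sec N V\<^esub> res N U V b) db"
      using co(2)[OF V s] by simp
  qed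
  then show ?thesis by blast
qed

text \<open>A regular function \<open>f\<close> acts on a simple bundle \<open>F\<close> as some constant \<open>c\<close>; comparing
  coordinates in a local frame gives \<open>f = c\<close>, since the rank is positive everywhere.  This
  replaces the theorem that regular functions on a connected projective variety are constant.\<close>

lemma regular_functions_constant:
  assumes X: "open_in X X" and con: "connected_space (subtopology zariski X)"
    and vb: "vector_bundle X F" and simple: "simple_sheaf X F" and f: "f \<in> carrier (reg_ring X X)"
  shows "\<exists>c. f = const_fun X c"
proof -
  have F: "mod_sheaf X F" using vb by (simp add: vector_bundle_def)
  note F' = mod_sheaf_presheaf[OF F]
  have "hom_family X F X (\<lambda>V s. restrict f V \<odot>\<^bsub>sec F V\<^esub> s) \<in> mor X F F X"
    by (rule reg_smult_mor[OF F' f X])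
  then have "hom_family X F X (\<lambda>V s. restrict f V \<odot>\<^bsub>sec F V\<^esub> s) \<in> range (scalar_endo X F)"
    using simple by (simp add: simple_sheaf_def bij_betw_def)
  then obtain c where c': "hom_family X F X (\<lambda>V s. restrict f V \<odot>\<^bsub>sec F V\<^esub> s) = scalar_endo X F c"
    by (rule imageE)
  note c = c'[symmetric]
  \<comment> \<open>The locus where F vanishes on a neighbourhood. It describes the points of rank 0
    without reference to a frame, since a rank is attached only to a chosen frame.\<close>
  define Z where "Z = {x \<in> X. \<exists>U. open_in X U \<and> x \<in> U \<and>
    (\<forall>V s. open_in X V \<and> V \<subseteq> U \<and> s \<in> carrier (sec F V) \<longrightarrow> s = \<zero>\<^bsub>sec F V\<^esub>)}"
  have delta: "(\<Oplus>\<^bsub>sec F V\<^esub>i\<in>{..<r}. (\<lambda>i\<in>{..<r}. if i = 0 then g else \<zero>\<^bsub>reg_ring X V\<^esub>) i \<odot>\<^bsub>sec F V\<^esub> res F U V (b i)) =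
      g \<odot>\<^bsub>sec F V\<^esub> res F U V (b 0)"
    if "open_in X U" "open_in X V" "V \<subseteq> U" "frame X F U r b" "r > 0" "g \<in> carrier (reg_ring X V)"
    for U V r b g
  proof -
    interpret Module.module "reg_ring X V" "sec F V" using that presheaf_module[OF F'] by blast
    have b: "res F U V (b i) \<in> carrier (sec F V)" if "i < r" for i
      using that \<open>frame X F U r b\<close> res_closed[OF F' \<open>open_in X U\<close> \<open>open_in X V\<close> \<open>V \<subseteq> U\<close>]
      by (auto simp: frame_def)
    have "(\<Oplus>\<^bsub>sec F V\<^esub>i\<in>{..<r}. (\<lambda>i\<in>{..<r}. if i = 0 then g else \<zero>\<^bsub>reg_ring X V\<^esub>) i \<odot>\<^bsub>sec F V\<^esub> res F U V (b i)) =
      (\<Oplus>\<^bsub>sec F V\<^esub>i\<in>{..<r}. if 0 = i then g \<odot>\<^bsub>sec F V\<^esub> res F U V (b i) else \<zero>\<^bsub>sec F V\<^esub>)"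
      using b that(6) by (intro M.finsum_cong') auto
    also have "\<dots> = g \<odot>\<^bsub>sec F V\<^esub> res F U V (b 0)"
      using b that(5,6) by (intro M.finsum_singleton) auto
    finally show ?thesis .
  qed
  \<comment> \<open>When the rank is positive, multiples of the frame vector \<open>b 0\<close>
    determine their coefficient: by \<open>delta\<close> both g and h are completed by zeros to full
    coefficient families of one section.\<close>
  have coeff: "g = h"
    if "open_in X U" "open_in X V" "V \<subseteq> U" "frame X F U r b" "r > 0" "g \<in> carrier (reg_ring X V)"
      "h \<in> carrier (reg_ring X V)" "g \<odot>\<^bsub>sec F V\<^esub> res F U V (b 0) = h \<odot>\<^bsub>sec F V\<^esub> res F U V (b 0)"
    for U V r b g h
  proof -
    interpret Module.module "reg_ring X V" "sec F V" using that presheaf_module[OF F'] by blast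
    let ?a = "\<lambda>g. \<lambda>i\<in>{..<r}. if i = 0 then g else \<zero>\<^bsub>reg_ring X V\<^esub>"
    let ?s = "g \<odot>\<^bsub>sec F V\<^esub> res F U V (b 0)"
    have "?s \<in> carrier (sec F V)"
      using that(4-6) res_closed[OF F' that(1-3)] by (auto simp: frame_def)
    moreover have "?a g \<in> {..<r::nat} \<rightarrow>\<^sub>E carrier (reg_ring X V)" "?a h \<in> {..<r::nat} \<rightarrow>\<^sub>E carrier (reg_ring X V)"
      using that(6,7) by auto
    ultimately have "?a g = ?a h"
      by (intro frame_coeffs_eq[OF that(4,2,3) _ _ delta[OF that(1-6), symmetric]
            _ delta[OF that(1-5,7), folded that(8), symmetric]])
    then show "g = h" using that(5) by (auto dest: fun_cong[of _ _ 0])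
  qed
  \<comment> \<open>With positive rank, vanishing of \<open>b 0\<close> near y would make 1 and 0
    the same coefficient and hence the same function near y. With rank 0 every section is an empty
    sum.\<close>
  have rank: "r > 0 \<longleftrightarrow> y \<notin> Z" if U: "open_in X U" "y \<in> U" and fr: "frame X F U r b" for U r b y
  proof
    assume r: "r > 0"
    show "y \<notin> Z"
    proof
      assume "y \<in> Z"
      then obtain U' where U': "open_in X U'" "y \<in> U'"
        "\<And>V s. open_in X V \<Longrightarrow> V \<subseteq> U' \<Longrightarrow> s \<in> carrier (sec F V) \<Longrightarrow> s = \<zero>\<^bsub>sec F V\<^esub>"
        unfolding Z_def by blast
      define V where "V = U \<inter> U'"
      have V: "open_in X V" "V \<subseteq> U" "y \<in> V" using U U' open_in_Int by (auto simp: V_def)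
      interpret Module.module "reg_ring X V" "sec F V" using V presheaf_module[OF F'] by blast
      have b0: "res F U V (b 0) \<in> carrier (sec F V)"
        using fr r res_closed[OF F' U(1) V(1,2)] by (auto simp: frame_def)
      moreover have "res F U V (b 0) = \<zero>\<^bsub>sec F V\<^esub>" by (rule U'(3)[OF V(1) _ b0]) (simp add: V_def)
      ultimately have "\<one>\<^bsub>reg_ring X V\<^esub> \<odot>\<^bsub>sec F V\<^esub> res F U V (b 0) = \<zero>\<^bsub>reg_ring X V\<^esub> \<odot>\<^bsub>sec F V\<^esub> res F U V (b 0)"
        by simp
      then have "\<one>\<^bsub>reg_ring X V\<^esub> = \<zero>\<^bsub>reg_ring X V\<^esub>"
        by (intro coeff[OF U(1) V(1,2) fr r]) auto
      then show False using V(3) by (auto simp: reg_ring_simps dest: fun_cong[of _ _ y])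
    qed
  next
    assume y: "y \<notin> Z"
    show "r > 0"
    proof (rule ccontr)
      assume "\<not> r > 0"
      then have r0: "{..<r} = {}" by simp
      have "s = \<zero>\<^bsub>sec F V\<^esub>" if V: "open_in X V" "V \<subseteq> U" and s: "s \<in> carrier (sec F V)" for V s
      proof -
        interpret abelian_group "sec F V" using V presheaf_group[OF F'] by blast
        obtain a where "s = (\<Oplus>\<^bsub>sec F V\<^esub>i\<in>{..<r}. a i \<odot>\<^bsub>sec F V\<^esub> res F U V (b i))"
          using frame_unique[OF fr V s] by blast
        then show ?thesis unfolding r0 by simp
      qed
      then have "y \<in> Z" using U open_in_subset[OF U(1)] unfolding Z_def by blast
      with y show False by simp
    qed
  qed
  have top: "topspace (subtopology zariski X) = X"
    using openin_subset[OF X] by (simp add: inf_absorb2)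
  have "open_in X Z"
  proof (subst openin_subopen, intro ballI)
    fix x assume "x \<in> Z"
    then obtain U where U: "open_in X U" "x \<in> U"
      "\<forall>V s. open_in X V \<and> V \<subseteq> U \<and> s \<in> carrier (sec F V) \<longrightarrow> s = \<zero>\<^bsub>sec F V\<^esub>"
      unfolding Z_def by blast
    then have "U \<subseteq> Z" using open_in_subset[OF U(1)] unfolding Z_def by blast
    with U show "\<exists>T. open_in X T \<and> x \<in> T \<and> T \<subseteq> Z" by blast
  qed
  moreover have "open_in X (X - Z)"
  proof (subst openin_subopen, intro ballI)
    fix x assume x: "x \<in> X - Z"
    then obtain U r b where U: "open_in X U" "x \<in> U" "frame X F U r b"
      using vector_bundle_frame[OF vb] by blast
    then have "r > 0" using rank x by blast
    then have "U \<subseteq> X - Z" using rank U open_in_subset[OF U(1)] by blast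
    with U show "\<exists>T. open_in X T \<and> x \<in> T \<and> T \<subseteq> X - Z" by blast
  qed
  then have "closedin (subtopology zariski X) Z"
    unfolding closedin_def top by (auto simp: Z_def)
  \<comment> \<open>Both Z and its complement are open, so connectedness leaves only the extreme
    cases.\<close>
  ultimately have "Z = {} \<or> Z = X"
    using con unfolding connected_space_clopen_in top by blast
  moreover have "Z \<noteq> X"
  proof
    assume ZX: "Z = X"
    have "s = \<zero>\<^bsub>sec F V\<^esub>" if V: "open_in X V" and s: "s \<in> carrier (sec F V)" for V s
    proof (rule sheaf_eqI[OF F V s])
      interpret abelian_group "sec F V" using V presheaf_group[OF F'] by blast
      show "\<zero>\<^bsub>sec F V\<^esub> \<in> carrier (sec F V)" by simp
      fix x assume x: "x \<in> V"
      then have "x \<in> Z" using ZX open_in_subset[OF V] by blast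
      then obtain U where U: "open_in X U" "x \<in> U"
        "\<And>V s. open_in X V \<Longrightarrow> V \<subseteq> U \<Longrightarrow> s \<in> carrier (sec F V) \<Longrightarrow> s = \<zero>\<^bsub>sec F V\<^esub>"
        unfolding Z_def by blast
      have VU: "open_in X (V \<inter> U)" using V U open_in_Int by blast
      then have "res F V (V \<inter> U) s = res F V (V \<inter> U) \<zero>\<^bsub>sec F V\<^esub>"
        using U(3)[OF VU] res_closed[OF F' V VU _ s] by (simp add: res_zero[OF F' V VU])
      then show "\<exists>W. open_in X W \<and> x \<in> W \<and> W \<subseteq> V \<and> res F V W s = res F V W \<zero>\<^bsub>sec F V\<^esub>"
        using VU x U by (intro exI[of _ "V \<inter> U"]) auto
    qed
    then have z: "s = t" if "open_in X V" "s \<in> carrier (sec F V)" "t \<in> carrier (sec F V)" for V s t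
      using that by metis
    \<comment> \<open>On the zero sheaf the scalars 0 and 1 induce the same endomorphism, which the
      injectivity part of simplicity forbids.\<close>
    have "scalar_endo X F 0 = scalar_endo X F 1"
      by (rule mor_eqI[OF scalar_endo_mor[OF F' X] scalar_endo_mor[OF F' X]])
        (rule z, assumption, (rule mor_closed[OF scalar_endo_mor[OF F' X]]; assumption)+)
    then show False using simple unfolding simple_sheaf_def bij_betw_def by (auto dest: injD)
  qed
  ultimately have Z: "Z = {}" by simp
  have "f x = c" if x: "x \<in> X" for x
  proof -
    obtain U r b where U: "open_in X U" "x \<in> U" and fr: "frame X F U r b"
      using vector_bundle_frame[OF vb x] by blast
    then have r: "r > 0" using rank Z by blast
    have b0: "b 0 \<in> carrier (sec F U)" using fr r by (auto simp: frame_def)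
    have UX: "U \<subseteq> X" by (rule open_in_subset[OF U(1)])
    have "const_fun U c \<odot>\<^bsub>sec F U\<^esub> b 0 = restrict f U \<odot>\<^bsub>sec F U\<^esub> b 0"
      using fun_cong[OF fun_cong[OF c, of U], of "b 0"] U(1) UX b0 by simp
    then have "const_fun U c = restrict f U"
      using U(1) reg_const[OF U(1)] reg_restrict[OF f U(1) UX] res_id[OF F' U(1) b0]
      by (intro coeff[OF U(1) U(1) subset_refl fr r]) simp_all
    then show "f x = c" using U(2) by (auto dest: fun_cong[of _ _ x])
  qed
  then have "f = const_fun X c"
    using reg_ext[OF f] by (intro extensionalityI[of _ X]) auto
  then show ?thesis by blast
qed


section \<open>Locally split extensions\<close>

lemma short_exactD:
  assumes "short_exact X A E F i p"
  shows "i \<in> mor X A E X" "p \<in> mor X E F X"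
    "open_in X U \<Longrightarrow> inj_on (i U) (carrier (sec A U))"
    "open_in X U \<Longrightarrow> e \<in> carrier (sec E U) \<Longrightarrow> p U e = \<zero>\<^bsub>sec F U\<^esub> \<longleftrightarrow>
       (\<forall>x\<in>U. \<exists>V. open_in X V \<and> x \<in> V \<and> V \<subseteq> U \<and> res E U V e \<in> i V ` carrier (sec A V))"
  using assms by (simp_all add: short_exact_def)

text \<open>The splittings are kept as data on a cover indexed by points. They give the middle term
  the local shape of a direct sum, with which morphisms are lifted, factored and expanded
  below.\<close>

locale split_extension =
  fixes X :: "'n::finite pt set" and A :: "('n pt, 'a) msheaf" and E :: "('n pt, 'e) msheaf"
    and F :: "('n pt, 's) msheaf" and i p and U :: "'n pt \<Rightarrow> 'n pt set" and s
  assumes A: "mod_sheaf X A" and E: "mod_sheaf X E" and F: "mod_sheaf X F"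
    and exact: "short_exact X A E F i p" and cover: "pt_cover X U"
    and s: "\<And>x. x \<in> X \<Longrightarrow> s x \<in> mor X F E (U x)"
    and split: "\<And>x V f. x \<in> X \<Longrightarrow> open_in X V \<Longrightarrow> V \<subseteq> U x \<Longrightarrow> f \<in> carrier (sec F V) \<Longrightarrow> p V (s x V f) = f"
begin

lemmas A' = mod_sheaf_presheaf[OF A] and E' = mod_sheaf_presheaf[OF E] and F' = mod_sheaf_presheaf[OF F]
lemmas i = short_exactD(1)[OF exact] and p = short_exactD(2)[OF exact]
lemmas i_inj = short_exactD(3)[OF exact] and ker = short_exactD(4)[OF exact]

lemma i_closed: "open_in X V \<Longrightarrow> t \<in> carrier (sec A V) \<Longrightarrow> i V t \<in> carrier (sec E V)"
  by (rule mor_closed[OF i]) (auto dest: open_in_subset)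

lemma p_closed: "open_in X V \<Longrightarrow> e \<in> carrier (sec E V) \<Longrightarrow> p V e \<in> carrier (sec F V)"
  by (rule mor_closed[OF p]) (auto dest: open_in_subset)

lemma s_closed: "x \<in> X \<Longrightarrow> open_in X V \<Longrightarrow> V \<subseteq> U x \<Longrightarrow> f \<in> carrier (sec F V) \<Longrightarrow> s x V f \<in> carrier (sec E V)"
  by (rule mor_closed[OF s])

lemma p_i: "open_in X V \<Longrightarrow> t \<in> carrier (sec A V) \<Longrightarrow> p V (i V t) = \<zero>\<^bsub>sec F V\<^esub>"
  by (subst ker) (auto simp: i_closed res_id[OF E'] intro!: exI[of _ V])

lemma U_open: "x \<in> X \<Longrightarrow> open_in X (U x)" and U_mem: "x \<in> X \<Longrightarrow> x \<in> U x"
  using cover by (simp_all add: pt_cover_def)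

text \<open>Exactness provides preimages only locally. Injectivity of i forces them to agree on
  overlaps, so they glue: taking sections is left exact.\<close>

lemma ker_lift:
  assumes V: "open_in X V" and e: "e \<in> carrier (sec E V)" "p V e = \<zero>\<^bsub>sec F V\<^esub>"
  shows "\<exists>t\<in>carrier (sec A V). i V t = e"
proof -
  define \<U> where "\<U> = {T. open_in X T \<and> T \<subseteq> V \<and> res E V T e \<in> i T ` carrier (sec A T)}"
  have loc: "\<forall>x\<in>V. \<exists>T. open_in X T \<and> x \<in> T \<and> T \<subseteq> V \<and> res E V T e \<in> i T ` carrier (sec A T)"
    using ker[OF V e(1)] e(2) by simp
  have un: "\<Union>\<U> = V"
  proof
    show "\<Union>\<U> \<subseteq> V" by (auto simp: \<U>_def)
    show "V \<subseteq> \<Union>\<U>"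
    proof
      fix x assume "x \<in> V"
      from bspec[OF loc this] show "x \<in> \<Union>\<U>" unfolding \<U>_def by blast
    qed
  qed
  define g where "g T = inv_into (carrier (sec A T)) (i T) (res E V T e)" for T
  have g: "g T \<in> carrier (sec A T)" "i T (g T) = res E V T e" if "T \<in> \<U>" for T
    using that unfolding g_def \<U>_def by (auto intro: inv_into_into f_inv_into_f)
  have "\<exists>!t. t \<in> carrier (sec A V) \<and> (\<forall>T\<in>\<U>. res A V T t = g T)"
  proof (rule sheaf_glue[OF A _ un g(1)])
    fix T T' assume T: "T \<in> \<U>" "T' \<in> \<U>"
    then have op: "open_in X T" "open_in X T'" "open_in X (T \<inter> T')" "T \<subseteq> V" "T' \<subseteq> V"
      "T \<subseteq> X" "T' \<subseteq> X"
      by (auto simp: \<U>_def open_in_Int dest: open_in_subset)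
    have "i (T \<inter> T') (res A T (T \<inter> T') (g T)) = res E V (T \<inter> T') e"
      using mor_res[OF i op(1,3) _ op(6) g(1)[OF T(1)]] g(2)[OF T(1)] res_res[OF E' V op(1,3) _ op(4) e(1)]
      by simp
    moreover have "i (T \<inter> T') (res A T' (T \<inter> T') (g T')) = res E V (T \<inter> T') e"
      using mor_res[OF i op(2,3) _ op(7) g(1)[OF T(2)]] g(2)[OF T(2)] res_res[OF E' V op(2,3) _ op(5) e(1)]
      by simp
    ultimately show "res A T (T \<inter> T') (g T) = res A T' (T \<inter> T') (g T')"
      using g(1) T op by (intro inj_onD[OF i_inj[OF op(3)]]) (auto intro: res_closed[OF A'])
  qed (auto simp: \<U>_def)
  then obtain t where t: "t \<in> carrier (sec A V)" "\<And>T. T \<in> \<U> \<Longrightarrow> res A V T t = g T" by blast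
  have "i V t = e"
  proof (rule sheaf_eqI[OF E V i_closed[OF V t(1)] e(1)])
    fix x assume "x \<in> V"
    then obtain T where T: "T \<in> \<U>" "x \<in> T" using un by blast
    then have op: "open_in X T" "T \<subseteq> V" by (auto simp: \<U>_def)
    have "res E V T (i V t) = res E V T e"
      using mor_res[OF i V op(1,2) open_in_subset[OF V] t(1)] t(2)[OF T(1)] g(2)[OF T(1)] by simp
    then show "\<exists>T. open_in X T \<and> x \<in> T \<and> T \<subseteq> V \<and> res E V T (i V t) = res E V T e"
      using op T by blast
  qed
  with t show ?thesis by blast
qed

text \<open>The retraction of E onto A over \<open>U x\<close> complementary to the splitting: e -
  s(p(e)) is killed by p and is pulled back along i.\<close>

definition proj :: "'n pt \<Rightarrow> 'n pt set \<Rightarrow> 'e \<Rightarrow> 'a" where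
  "proj x = hom_family X E (U x) (\<lambda>V e.
     inv_into (carrier (sec A V)) (i V) (e \<ominus>\<^bsub>sec E V\<^esub> s x V (p V e)))"

lemma proj:
  assumes x: "x \<in> X" and V: "open_in X V" "V \<subseteq> U x" and e: "e \<in> carrier (sec E V)"
  shows "proj x V e \<in> carrier (sec A V)"
    and "e = i V (proj x V e) \<oplus>\<^bsub>sec E V\<^esub> s x V (p V e)"
proof -
  interpret E: abelian_group "sec E V" by (rule presheaf_group[OF E' V(1)])
  interpret F: abelian_group "sec F V" by (rule presheaf_group[OF F' V(1)])
  have sp: "s x V (p V e) \<in> carrier (sec E V)" using s_closed[OF x V p_closed[OF V(1) e]] .
  have "p V (e \<ominus>\<^bsub>sec E V\<^esub> s x V (p V e)) = \<zero>\<^bsub>sec F V\<^esub>"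
    using mor_minus[OF E' F' p V(1) open_in_subset[OF V(1)] e sp] split[OF x V p_closed[OF V(1) e]]
      p_closed[OF V(1) e] by (simp add: F.r_neg F.minus_eq)
  then have im: "e \<ominus>\<^bsub>sec E V\<^esub> s x V (p V e) \<in> i V ` carrier (sec A V)"
    using ker_lift[OF V(1) E.minus_closed[OF e sp]] by (auto simp: image_iff eq_commute)
  show "proj x V e \<in> carrier (sec A V)"
    using inv_into_into[OF im] V e by (simp add: proj_def)
  have "i V (proj x V e) = e \<ominus>\<^bsub>sec E V\<^esub> s x V (p V e)"
    using f_inv_into_f[OF im] V e by (simp add: proj_def)
  then show "e = i V (proj x V e) \<oplus>\<^bsub>sec E V\<^esub> s x V (p V e)"
    using e sp by (simp add: E.minus_eq E.a_assoc E.l_neg)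
qed

text \<open>Applying p to a decomposition of e recovers f, and injectivity of i then recovers t.
  Every identity for \<open>proj\<close> is obtained by decomposing its argument and appealing to
  this uniqueness.\<close>

lemma proj_unique:
  assumes x: "x \<in> X" and V: "open_in X V" "V \<subseteq> U x" and t: "t \<in> carrier (sec A V)"
    and f: "f \<in> carrier (sec F V)" and e: "e = i V t \<oplus>\<^bsub>sec E V\<^esub> s x V f"
  shows "proj x V e = t"
proof -
  interpret E: abelian_group "sec E V" by (rule presheaf_group[OF E' V(1)])
  interpret F: abelian_group "sec F V" by (rule presheaf_group[OF F' V(1)])
  note cl = i_closed[OF V(1) t] s_closed[OF x V f]
  have eE: "e \<in> carrier (sec E V)" using cl by (simp add: e)
  have "p V e = f"
    using mor_add[OF p V(1) open_in_subset[OF V(1)] cl] p_i[OF V(1) t] split[OF x V f] f by (simp add: e)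
  then have "i V t \<oplus>\<^bsub>sec E V\<^esub> s x V f = i V (proj x V e) \<oplus>\<^bsub>sec E V\<^esub> s x V f"
    using proj(2)[OF x V eE] e by simp
  then have "i V t = i V (proj x V e)"
    using cl i_closed[OF V(1) proj(1)[OF x V eE]] by simp
  then show ?thesis
    using i_inj[OF V(1)] t proj(1)[OF x V eE] by (simp add: inj_on_def)
qed

lemma proj_mor:
  assumes x: "x \<in> X"
  shows "proj x \<in> mor X E A (U x)"
proof -
  have "hom_family X E (U x) (proj x) \<in> mor X E A (U x)"
  proof (rule hom_family_mor[OF E'])
    fix V assume V: "open_in X V" "V \<subseteq> U x"
    interpret A: Module.module "reg_ring X V" "sec A V" by (rule presheaf_module[OF A' V(1)])
    interpret E: Module.module "reg_ring X V" "sec E V" by (rule presheaf_module[OF E' V(1)])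
    interpret F: Module.module "reg_ring X V" "sec F V" by (rule presheaf_module[OF F' V(1)])
    note VX = open_in_subset[OF V(1)]
    show "proj x V e \<in> carrier (sec A V)" if "e \<in> carrier (sec E V)" for e by (rule proj(1)[OF x V that])
    have cl: "p V e \<in> carrier (sec F V)" "s x V (p V e) \<in> carrier (sec E V)" "proj x V e \<in> carrier (sec A V)"
      "i V (proj x V e) \<in> carrier (sec E V)" if e: "e \<in> carrier (sec E V)" for e
      using p_closed[OF V(1) e] s_closed[OF x V p_closed[OF V(1) e]] proj(1)[OF x V e]
        i_closed[OF V(1) proj(1)[OF x V e]] by auto
    show "proj x V (e \<oplus>\<^bsub>sec E V\<^esub> e') = proj x V e \<oplus>\<^bsub>sec A V\<^esub> proj x V e'"
      if e: "e \<in> carrier (sec E V)" and e': "e' \<in> carrier (sec E V)" for e e'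
    proof (rule proj_unique[OF x V])
      have "e \<oplus>\<^bsub>sec E V\<^esub> e' = (i V (proj x V e) \<oplus>\<^bsub>sec E V\<^esub> s x V (p V e)) \<oplus>\<^bsub>sec E V\<^esub>
          (i V (proj x V e') \<oplus>\<^bsub>sec E V\<^esub> s x V (p V e'))"
        using proj(2)[OF x V e] proj(2)[OF x V e'] by simp
      also have "\<dots> = i V (proj x V e \<oplus>\<^bsub>sec A V\<^esub> proj x V e') \<oplus>\<^bsub>sec E V\<^esub> s x V (p V e \<oplus>\<^bsub>sec F V\<^esub> p V e')"
        using cl[OF e] cl[OF e'] by (simp add: mor_add[OF i V(1) VX] mor_add[OF s[OF x] V] E.a_ac)
      finally show "e \<oplus>\<^bsub>sec E V\<^esub> e' = \<dots>" .
    qed (use cl[OF e] cl[OF e'] in auto)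
    show "proj x V (f \<odot>\<^bsub>sec E V\<^esub> e) = f \<odot>\<^bsub>sec A V\<^esub> proj x V e"
      if f: "f \<in> carrier (reg_ring X V)" and e: "e \<in> carrier (sec E V)" for f e
    proof (rule proj_unique[OF x V])
      have "f \<odot>\<^bsub>sec E V\<^esub> e = f \<odot>\<^bsub>sec E V\<^esub> (i V (proj x V e) \<oplus>\<^bsub>sec E V\<^esub> s x V (p V e))"
        using proj(2)[OF x V e] by simp
      also have "\<dots> = i V (f \<odot>\<^bsub>sec A V\<^esub> proj x V e) \<oplus>\<^bsub>sec E V\<^esub> s x V (f \<odot>\<^bsub>sec F V\<^esub> p V e)"
        using cl[OF e] f by (simp add: mor_smult[OF i V(1) VX] mor_smult[OF s[OF x] V] E.smult_r_distr)
      finally show "f \<odot>\<^bsub>sec E V\<^esub> e = \<dots>" .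
    qed (use f cl[OF e] in auto)
    show "res A V W (proj x V e) = proj x W (res E V W e)"
      if W: "open_in X W" "W \<subseteq> V" and e: "e \<in> carrier (sec E V)" for W e
    proof (rule proj_unique[symmetric, OF x W(1)])
      have "res E V W e = res E V W (i V (proj x V e) \<oplus>\<^bsub>sec E V\<^esub> s x V (p V e))"
        using proj(2)[OF x V e] by simp
      also have "\<dots> = i W (res A V W (proj x V e)) \<oplus>\<^bsub>sec E W\<^esub> s x W (res F V W (p V e))"
        using cl[OF e] by (simp add: res_add[OF E' V(1) W] mor_res[OF i V(1) W VX]
            mor_res[OF s[OF x] V(1) W V(2)])
      finally show "res E V W e = \<dots>" .
    qed (use W V cl[OF e] in \<open>auto intro: res_closed[OF A'] res_closed[OF F']\<close>)
  qed
  moreover have "hom_family X E (U x) (proj x) = proj x"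
    unfolding proj_def by (rule hom_family_cong) simp
  ultimately show ?thesis by simp
qed

text \<open>A frame of \<open>A\<close> together with lifts of a frame of \<open>F\<close>.\<close>

lemma middle_dual_basis:
  assumes x: "x \<in> X" and T: "open_in X T" "T \<subseteq> U x"
    and dA: "dual_basis X A T dA" and dF: "dual_basis X F T dF"
  shows "\<exists>dE. dual_basis X E T dE"
proof -
  \<comment> \<open>Coordinates of A are read through the retraction and those of F through p; the
    matching vectors are images under i and under the splitting.\<close>
  define dE where "dE = image_mset (\<lambda>(\<beta>, b). (mor_comp X E T \<beta> (proj x), i T b)) dA +
    image_mset (\<lambda>(\<beta>, b). (mor_comp X E T \<beta> p, s x T b)) dF"
  note TX = open_in_subset[OF T(1)]
  have "dual_basis X E T dE"
    unfolding dual_basis_def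
  proof (intro conjI allI impI)
    have "mor_comp X E T \<beta> (proj x) \<in> mor X E (struct_sheaf X) T" if "\<beta> \<in> mor X A (struct_sheaf X) T" for \<beta>
      by (rule mor_comp_mor[OF E' proj_mor[OF x] that T(2) subset_refl])
    moreover have "mor_comp X E T \<beta> p \<in> mor X E (struct_sheaf X) T" if "\<beta> \<in> mor X F (struct_sheaf X) T" for \<beta>
      by (rule mor_comp_mor[OF E' p that TX subset_refl])
    ultimately show "set_mset dE \<subseteq> mor X E (struct_sheaf X) T \<times> carrier (sec E T)"
      using dual_basis_mem[OF dA] dual_basis_mem[OF dF] i_closed[OF T(1)] s_closed[OF x T]
      by (fastforce simp: dE_def)
    fix V e assume "open_in X V \<and> V \<subseteq> T \<and> e \<in> carrier (sec E V)"
    then have V: "open_in X V" "V \<subseteq> T" and e: "e \<in> carrier (sec E V)" by auto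
    have VU: "V \<subseteq> U x" and VX: "V \<subseteq> X" using V T TX by auto
    interpret A: Module.module "reg_ring X V" "sec A V" by (rule presheaf_module[OF A' V(1)])
    interpret E: Module.module "reg_ring X V" "sec E V" by (rule presheaf_module[OF E' V(1)])
    interpret F: Module.module "reg_ring X V" "sec F V" by (rule presheaf_module[OF F' V(1)])
    let ?a = "proj x V e" and ?f = "p V e"
    have af: "?a \<in> carrier (sec A V)" "?f \<in> carrier (sec F V)"
      using proj(1)[OF x V(1) VU e] p_closed[OF V(1) e] .
    have rA: "snd z \<in> carrier (sec A T)" "res A T V (snd z) \<in> carrier (sec A V)" "fst z V ?a \<in> carrier (reg_ring X V)"
      if "z \<in># dA" for z
      using dual_basis_mem[OF dA that] res_closed[OF A' T(1) V] mor_closed[OF dual_basis_mem(1)[OF dA that] V af(1)]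
      by auto
    have rF: "snd z \<in> carrier (sec F T)" "res F T V (snd z) \<in> carrier (sec F V)" "fst z V ?f \<in> carrier (reg_ring X V)"
      if "z \<in># dF" for z
      using dual_basis_mem[OF dF that] res_closed[OF F' T(1) V] mor_closed[OF dual_basis_mem(1)[OF dF that] V af(2)]
      by auto
    have "i V ?a = i V (msum (sec A V) (\<lambda>(\<beta>, b). \<beta> V ?a \<odot>\<^bsub>sec A V\<^esub> res A T V b) dA)"
      using dual_basis_expand[OF dA V af(1)] by simp
    also have "\<dots> = msum (sec E V) (\<lambda>z. i V (case z of (\<beta>, b) \<Rightarrow> \<beta> V ?a \<odot>\<^bsub>sec A V\<^esub> res A T V b)) dA"
      using rA by (intro mor_msum[OF A' E' i V(1) VX]) (auto simp: split_beta)
    also have "\<dots> = msum (sec E V) (\<lambda>(\<beta>, b). mor_comp X E T \<beta> (proj x) V e \<odot>\<^bsub>sec E V\<^esub> res E T V (i T b)) dA"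
      using rA V e by (intro E.M.msum_cong)
        (auto simp: split_beta mor_smult[OF i V(1) VX] mor_res[OF i T(1) V TX])
    finally have 1: "i V ?a = \<dots>" .
    have "s x V ?f = s x V (msum (sec F V) (\<lambda>(\<beta>, b). \<beta> V ?f \<odot>\<^bsub>sec F V\<^esub> res F T V b) dF)"
      using dual_basis_expand[OF dF V af(2)] by simp
    also have "\<dots> = msum (sec E V) (\<lambda>z. s x V (case z of (\<beta>, b) \<Rightarrow> \<beta> V ?f \<odot>\<^bsub>sec F V\<^esub> res F T V b)) dF"
      using rF by (intro mor_msum[OF F' E' s[OF x] V(1) VU]) (auto simp: split_beta)
    also have "\<dots> = msum (sec E V) (\<lambda>(\<beta>, b). mor_comp X E T \<beta> p V e \<odot>\<^bsub>sec E V\<^esub> res E T V (s x T b)) dF"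
      using rF V e by (intro E.M.msum_cong)
        (auto simp: split_beta mor_smult[OF s[OF x] V(1) VU] mor_res[OF s[OF x] T(1) V T(2)])
    finally have 2: "s x V ?f = \<dots>" .
    have "e = i V ?a \<oplus>\<^bsub>sec E V\<^esub> s x V ?f" by (rule proj(2)[OF x V(1) VU e])
    also have "\<dots> = msum (sec E V) (\<lambda>(\<beta>, b). \<beta> V e \<odot>\<^bsub>sec E V\<^esub> res E T V b) dE"
      unfolding 1 2 dE_def E.M.msum_union E.M.msum_image by (simp add: case_prod_unfold)
    finally show "e = msum (sec E V) (\<lambda>(\<beta>, b). \<beta> V e \<odot>\<^bsub>sec E V\<^esub> res E T V b) dE" .
  qed
  then show ?thesis by blast
qed

text \<open>Over each open the value of \<phi> lies in the kernel of p and has exactly one preimage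
  under i. Uniqueness makes the preimages additive, linear and compatible with restriction, so the
  lift is global without any cohomological condition.\<close>

lemma lift_mor:
  assumes \<phi>: "\<phi> \<in> mor X E E X"
    and z: "\<And>V e. open_in X V \<Longrightarrow> e \<in> carrier (sec E V) \<Longrightarrow> p V (\<phi> V e) = \<zero>\<^bsub>sec F V\<^esub>"
  shows "\<exists>\<psi>\<in>mor X E A X. \<forall>V e. open_in X V \<longrightarrow> e \<in> carrier (sec E V) \<longrightarrow> \<phi> V e = i V (\<psi> V e)"
proof -
  define g where "g V e = inv_into (carrier (sec A V)) (i V) (\<phi> V e)" for V e
  have g: "g V e \<in> carrier (sec A V)" "i V (g V e) = \<phi> V e"
    if V: "open_in X V" and e: "e \<in> carrier (sec E V)" for V e
  proof -
    have "\<phi> V e \<in> i V ` carrier (sec A V)"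
      using ker_lift[OF V mor_closed[OF \<phi> V open_in_subset[OF V] e] z[OF V e]]
      by (auto simp: image_iff eq_commute)
    then show "g V e \<in> carrier (sec A V)" "i V (g V e) = \<phi> V e"
      unfolding g_def by (auto intro: inv_into_into f_inv_into_f)
  qed
  have u: "g V e = t" if V: "open_in X V" and "e \<in> carrier (sec E V)" "t \<in> carrier (sec A V)" "i V t = \<phi> V e" for V e t
    using inj_onD[OF i_inj[OF V]] g[OF V that(2)] that by metis
  have "hom_family X E X g \<in> mor X E A X"
  proof (rule hom_family_mor[OF E'])
    fix V assume V: "open_in X V" "V \<subseteq> X"
    interpret A: Module.module "reg_ring X V" "sec A V" by (rule presheaf_module[OF A' V(1)])
    interpret E: Module.module "reg_ring X V" "sec E V" by (rule presheaf_module[OF E' V(1)])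
    note gV = g[OF V(1)]
    show "g V e \<in> carrier (sec A V)" if "e \<in> carrier (sec E V)" for e by (rule gV(1)[OF that])
    show "g V (e \<oplus>\<^bsub>sec E V\<^esub> e') = g V e \<oplus>\<^bsub>sec A V\<^esub> g V e'"
      if "e \<in> carrier (sec E V)" "e' \<in> carrier (sec E V)" for e e'
      using that gV by (intro u[OF V(1)]) (auto simp: mor_add[OF i V] mor_add[OF \<phi> V])
    show "g V (f \<odot>\<^bsub>sec E V\<^esub> e) = f \<odot>\<^bsub>sec A V\<^esub> g V e"
      if "f \<in> carrier (reg_ring X V)" "e \<in> carrier (sec E V)" for f e
      using that gV by (intro u[OF V(1)]) (auto simp: mor_smult[OF i V] mor_smult[OF \<phi> V])
    show "res A V W (g V e) = g W (res E V W e)"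
      if W: "open_in X W" "W \<subseteq> V" and e: "e \<in> carrier (sec E V)" for W e
      using gV[OF e] W V res_closed[OF A' V(1) W gV(1)[OF e]] res_closed[OF E' V(1) W e]
      by (intro u[OF W(1), symmetric])
        (auto simp: mor_res[OF i V(1) W V(2), symmetric] mor_res[OF \<phi> V(1) W V(2), symmetric] e)
  qed
  then show ?thesis
    using g(2) by (intro bexI[of _ "hom_family X E X g"]) (auto simp: open_in_subset)
qed

text \<open>Over \<open>U x\<close> the factorization must be \<phi> composed with the splitting. As
  \<phi> kills the image of i, it sees only the part of e coming from F, so different splittings
  give the same composite and the local factorizations glue.\<close>

lemma factor_mor:
  assumes B: "mod_sheaf X B" and \<phi>: "\<phi> \<in> mor X E B X"
    and z: "\<And>V t. open_in X V \<Longrightarrow> t \<in> carrier (sec A V) \<Longrightarrow> \<phi> V (i V t) = \<zero>\<^bsub>sec B V\<^esub>"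
  shows "\<exists>\<psi>\<in>mor X F B X. \<forall>V e. open_in X V \<longrightarrow> e \<in> carrier (sec E V) \<longrightarrow> \<phi> V e = \<psi> V (p V e)"
proof -
  note B' = mod_sheaf_presheaf[OF B]
  have eq: "\<phi> V (s x V (p V e)) = \<phi> V e"
    if x: "x \<in> X" and V: "open_in X V" "V \<subseteq> U x" and e: "e \<in> carrier (sec E V)" for x V e
  proof -
    interpret B: abelian_group "sec B V" by (rule presheaf_group[OF B' V(1)])
    note VX = open_in_subset[OF V(1)]
    have "\<phi> V e = \<phi> V (i V (proj x V e) \<oplus>\<^bsub>sec E V\<^esub> s x V (p V e))" using proj(2)[OF x V e] by simp
    also have "\<dots> = \<phi> V (s x V (p V e))"
      using s_closed[OF x V p_closed[OF V(1) e]] i_closed[OF V(1) proj(1)[OF x V e]]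
      by (simp add: mor_add[OF \<phi> V(1) VX] z[OF V(1) proj(1)[OF x V e]] mor_closed[OF \<phi> V(1) VX])
    finally show ?thesis by simp
  qed
  define \<D> where "\<D> = {D. open_in X D \<and> (\<exists>x\<in>X. D \<subseteq> U x)}"
  \<comment> \<open>An arbitrary point whose splitting is defined over D. By \<open>eq\<close> the
    resulting value does not depend on it.\<close>
  define pt where "pt D = (SOME x. x \<in> X \<and> D \<subseteq> U x)" for D
  have pt: "pt D \<in> X" "D \<subseteq> U (pt D)" if "D \<in> \<D>" for D
    using someI_ex[of "\<lambda>x. x \<in> X \<and> D \<subseteq> U x"] that by (auto simp: pt_def \<D>_def)
  define g where "g D f = \<phi> D (s (pt D) D f)" for D f
  have g: "g D (p D e) = \<phi> D e" if "D \<in> \<D>" "e \<in> carrier (sec E D)" for D e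
    using eq[OF pt(1)[OF that(1)] _ pt(2)[OF that(1)] that(2)] that
    by (simp add: g_def \<D>_def)
  have "\<exists>\<psi>\<in>mor X F B X. \<forall>V\<in>\<D>. V \<subseteq> X \<longrightarrow> (\<forall>f\<in>carrier (sec F V). \<psi> V f = g V f)"
  proof (rule mor_glue[OF F' B])
    show "X \<subseteq> \<Union>\<D>" using U_open U_mem by (auto simp: \<D>_def)
    fix V assume D: "V \<in> \<D>"
    then have V: "open_in X V" "V \<subseteq> U (pt V)" "V \<subseteq> X" and x: "pt V \<in> X"
      using pt[OF D] open_in_subset by (auto simp: \<D>_def)
    note cl = s_closed[OF x V(1,2)]
    show "open_in X V" by fact
    show "V' \<in> \<D>" if "open_in X V'" "V' \<subseteq> V" for V' using D that by (auto simp: \<D>_def)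
    show "g V f \<in> carrier (sec B V)" if "f \<in> carrier (sec F V)" for f
      using mor_closed[OF \<phi> V(1,3) cl[OF that]] by (simp add: g_def)
    show "g V (f \<oplus>\<^bsub>sec F V\<^esub> f') = g V f \<oplus>\<^bsub>sec B V\<^esub> g V f'"
      if "f \<in> carrier (sec F V)" "f' \<in> carrier (sec F V)" for f f'
      using that cl by (simp add: g_def mor_add[OF s[OF x] V(1,2)] mor_add[OF \<phi> V(1,3)])
    show "g V (r \<odot>\<^bsub>sec F V\<^esub> f) = r \<odot>\<^bsub>sec B V\<^esub> g V f"
      if "r \<in> carrier (reg_ring X V)" "f \<in> carrier (sec F V)" for r f
      using that cl by (simp add: g_def mor_smult[OF s[OF x] V(1,2)] mor_smult[OF \<phi> V(1,3)])
    show "res B V W (g V f) = g W (res F V W f)"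
      if W: "W \<in> \<D>" "W \<subseteq> V" and f: "f \<in> carrier (sec F V)" for W f
    proof -
      have oW: "open_in X W" using W by (simp add: \<D>_def)
      \<comment> \<open>The splittings chosen for V and for W may differ. The identity of
        \<open>g\<close> with \<phi> on any lift, applied to the restricted lift of f, removes the
        dependence.\<close>
      have "res B V W (g V f) = \<phi> W (res E V W (s (pt V) V f))"
        unfolding g_def by (rule mor_res[OF \<phi> V(1) oW W(2) V(3) cl[OF f]])
      also have "\<dots> = g W (p W (res E V W (s (pt V) V f)))"
        using g[OF W(1) res_closed[OF E' V(1) oW W(2) cl[OF f]]] by simp
      also have "p W (res E V W (s (pt V) V f)) = res F V W f"
        using mor_res[OF p V(1) oW W(2) V(3) cl[OF f]] split[OF x V(1,2) f] by simp
      finally show ?thesis .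
    qed
  qed
  then obtain \<psi> where \<psi>1: "\<psi> \<in> mor X F B X"
    and \<psi>_eq: "\<forall>V\<in>\<D>. V \<subseteq> X \<longrightarrow> (\<forall>f\<in>carrier (sec F V). \<psi> V f = g V f)"
    by (rule bexE)
  have "\<psi> V f = g V f" if "V \<in> \<D>" "f \<in> carrier (sec F V)" for V f
  proof -
    have "V \<subseteq> X" using that(1) open_in_subset by (auto simp: \<D>_def)
    then show ?thesis using \<psi>_eq that by simp
  qed
  note \<psi> = \<psi>1 this
  have "\<phi> = mor_comp X E X \<psi> p"
  proof (rule mor_eq_local[OF E' B \<phi> mor_comp_mor[OF E' p \<psi>(1)]])
    fix x assume x: "x \<in> X"
    have "\<phi> W e = mor_comp X E X \<psi> p W e"
      if "open_in X W" "W \<subseteq> U x" "W \<subseteq> X" "e \<in> carrier (sec E W)" for W e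
    proof -
      have "W \<in> \<D>" using that x by (auto simp: \<D>_def)
      then show ?thesis using that \<psi>(2)[of W "p W e"] p_closed[of W e] g[of W e] by simp
    qed
    then show "\<exists>V. open_in X V \<and> x \<in> V \<and>
      (\<forall>W e. open_in X W \<and> W \<subseteq> V \<and> W \<subseteq> X \<and> e \<in> carrier (sec E W) \<longrightarrow> \<phi> W e = mor_comp X E X \<psi> p W e)"
      using U_open[OF x] U_mem[OF x] by blast
  qed auto
  then have "\<phi> V e = \<psi> V (p V e)" if "open_in X V" "e \<in> carrier (sec E V)" for V e
    using that open_in_subset[of X V] by simp
  with \<psi>(1) show ?thesis by blast
qed

end


section \<open>The universal extension\<close>

text \<open>\<open>M\<close> is the space of classes W, and the fibre of the trivial subbundle is
  its dual. The last assumption is the injectivity of W into H^1 of the dual of F, phrased for the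
  chosen cocycle: if its contraction by w is a coboundary, then w = 0. This keeps equivalence
  classes out of all arguments in the locale.\<close>

locale universal_extension =
  split_extension X "trivial_bundle X (dual_space M)" E F i p U s
  for X :: "'n::finite pt set" and M :: "(complex, 'w) module" and E :: "('n pt, 'e) msheaf"
    and F :: "('n pt, 's) msheaf" and i p U s +
  fixes c :: "'n pt \<Rightarrow> 'n pt \<Rightarrow> 'n pt set \<Rightarrow> 's \<Rightarrow> 'n pt \<Rightarrow> 'w \<Rightarrow> complex" and cb
  assumes X_open: "open_in X X"
    and constants: "\<And>f. f \<in> carrier (reg_ring X X) \<Longrightarrow> \<exists>k. f = const_fun X k"
    and M: "Module.module Cfield M"
    and cb: "set_mset cb \<subseteq> carrier (dual_space M) \<times> carrier M"
      "\<And>m. m \<in> carrier M \<Longrightarrow> m = msum M (\<lambda>(l, w). l m \<odot>\<^bsub>M\<^esub> w) cb"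
    and simple: "simple_sheaf X F"
    and H0F: "carrier (H0 X F) = {\<zero>\<^bsub>H0 X F\<^esub>}"
    and H0F_dual: "carrier (H0 X (dual_sheaf X F)) = {\<zero>\<^bsub>H0 X (dual_sheaf X F)\<^esub>}"
    and cocycle: "(U, c) \<in> cocycles X (hom_sheaf X F (trivial_bundle X (dual_space M)))"
    and diff: "\<And>x y V f. x \<in> X \<Longrightarrow> y \<in> X \<Longrightarrow> open_in X V \<Longrightarrow> V \<subseteq> U x \<inter> U y \<Longrightarrow> f \<in> carrier (sec F V) \<Longrightarrow>
      s y V f = s x V f \<oplus>\<^bsub>sec E V\<^esub> i V (c x y V f)"
    and universal: "\<And>w. w \<in> carrier M \<Longrightarrow>
      ((U, \<lambda>x y. contract X F (\<lambda>v. v w) (U x \<inter> U y) (c x y)),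
       (\<lambda>x. X, \<lambda>x y. \<zero>\<^bsub>sec (dual_sheaf X F) X\<^esub>)) \<in> cohomologous X (dual_sheaf X F) \<Longrightarrow> w = \<zero>\<^bsub>M\<^esub>"
begin

abbreviation "A \<equiv> trivial_bundle X (dual_space M)"

lemma reg_cring: "open_in X V \<Longrightarrow> cring (reg_ring X V)"
  by (rule presheaf_cring[OF F'])

lemma O: "mod_sheaf X (struct_sheaf X)"
  by (rule struct_sheaf_sheaf[OF reg_cring])

lemmas O' = mod_sheaf_presheaf[OF O]

lemma c_mor: "x \<in> X \<Longrightarrow> y \<in> X \<Longrightarrow> c x y \<in> mor X F A (U x \<inter> U y)"
  using cocycles_closed[OF cocycle] by (simp add: hom_sheaf_simps)

lemma c_cocycle:
  assumes xyz: "x \<in> X" "y \<in> X" "z \<in> X" and V: "open_in X V" "V \<subseteq> U x \<inter> U y \<inter> U z" and f: "f \<in> carrier (sec F V)"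
  shows "c x z V f = c x y V f \<oplus>\<^bsub>sec A V\<^esub> c y z V f"
proof -
  define T where "T = U x \<inter> U y \<inter> U z"
  have sub: "T \<subseteq> U x \<inter> U y" "T \<subseteq> U x \<inter> U z" "T \<subseteq> U y \<inter> U z" by (auto simp: T_def)
  have "res (hom_sheaf X F A) (U x \<inter> U z) T (c x z) = res (hom_sheaf X F A) (U x \<inter> U y) T (c x y)
      \<oplus>\<^bsub>sec (hom_sheaf X F A) T\<^esub> res (hom_sheaf X F A) (U y \<inter> U z) T (c y z)"
    using cocycle xyz unfolding cocycles_def T_def by (simp add: Let_def)
  then have "hom_family X F T (c x z) V f =
      hom_family X F T (\<lambda>V f. hom_family X F T (c x y) V f \<oplus>\<^bsub>sec A V\<^esub> hom_family X F T (c y z) V f) V f"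
    using sub by (simp add: hom_sheaf_res[OF c_mor] xyz hom_sheaf_simps)
  then show ?thesis using V f by (simp add: T_def[symmetric])
qed

section \<open>Morphisms out of the trivial subbundle\<close>

lemma eval_mor:
  assumes w: "w \<in> carrier M"
  shows "hom_family X A X (\<lambda>V t. \<lambda>x\<in>V. t x w) \<in> mor X A (struct_sheaf X) X"
proof (rule hom_family_mor[OF A'], unfold struct_sheaf_simps)
  fix V assume V: "open_in X V"
  show "(\<lambda>x\<in>V. t x w) \<in> carrier (reg_ring X V)" if "t \<in> carrier (sec A V)" for t
    by (rule trivial_bundle_expand(2)[OF reg_cring M cb V that w])
qed (use w in \<open>auto simp: trivial_bundle_simps(3-5) reg_ring_simps dual_space_simps fun_eq_iff restrict_def\<close>)

text \<open>Every section is a combination of constant sections with regular coefficients, so a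
  morphism is determined by the global sections of B to which it sends the constants. This serves
  with B the structure sheaf and with B = F.\<close>

lemma trivial_mor_expand:
  fixes B :: "('n pt, 'b) msheaf"
  assumes B: "mod_presheaf X B" and \<phi>: "\<phi> \<in> mor X A B X"
    and V: "open_in X V" and t: "t \<in> carrier (sec A V)"
  shows "\<phi> V t = msum (sec B V)
    (\<lambda>(l, w). (\<lambda>x\<in>V. t x w) \<odot>\<^bsub>sec B V\<^esub> res B X V (\<phi> X (\<lambda>x\<in>X. l))) cb"
proof -
  note VX = open_in_subset[OF V]
  interpret A: Module.module "reg_ring X V" "sec A V" by (rule presheaf_module[OF A' V])
  interpret B: Module.module "reg_ring X V" "sec B V" by (rule presheaf_module[OF B V])
  \<comment> \<open>Constant sections over V are restrictions of global ones, so their images are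
    restrictions of global sections of B.\<close>
  have const: "\<phi> V (\<lambda>x\<in>V. l) = res B X V (\<phi> X (\<lambda>x\<in>X. l))" if l: "l \<in> carrier (dual_space M)" for l
  proof -
    have "res A X V (\<lambda>x\<in>X. l) = (\<lambda>x\<in>V. l)"
      unfolding trivial_bundle_simps(5) using VX by (auto simp: restrict_def fun_eq_iff)
    then show ?thesis
      using mor_res[OF \<phi> X_open V VX subset_refl trivial_bundle_const[OF X_open l]] by simp
  qed
  define g where "g = (\<lambda>z. (\<lambda>x\<in>V. t x (snd z)) \<odot>\<^bsub>sec A V\<^esub> (\<lambda>x\<in>V. fst z))"
  have t_eq: "t = msum (sec A V) g cb"
    using trivial_bundle_expand(1)[OF reg_cring M cb V t] by (simp add: g_def case_prod_unfold)
  have z: "fst z \<in> carrier (dual_space M)" "snd z \<in> carrier M" if "z \<in># cb" for z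
    using that cb(1) by auto
  note reg = trivial_bundle_expand(2)[OF reg_cring M cb V t z(2)]
  have "\<phi> V (msum (sec A V) g cb) = msum (sec B V) (\<lambda>z. \<phi> V (g z)) cb"
    unfolding g_def
    by (rule mor_msum[OF A' B \<phi> V VX]) (rule A.smult_closed[OF reg trivial_bundle_const[OF V z(1)]])
  also have "\<dots> = msum (sec B V)
      (\<lambda>(l, w). (\<lambda>x\<in>V. t x w) \<odot>\<^bsub>sec B V\<^esub> res B X V (\<phi> X (\<lambda>x\<in>X. l))) cb"
    using mor_smult[OF \<phi> V VX reg trivial_bundle_const[OF V z(1)]] const[OF z(1)]
    by (intro B.M.msum_cong) (simp add: g_def case_prod_unfold)
  finally show ?thesis using t_eq by simp
qed

text \<open>The images of the constant sections are global regular functions, hence constants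
  \<gamma>(l). A functional on the dual of M with these values is evaluation at a vector of M, by
  finite dimension.\<close>

lemma functional_on_trivial:
  assumes \<phi>: "\<phi> \<in> mor X A (struct_sheaf X) X"
  shows "\<exists>w\<in>carrier M. \<forall>V t. open_in X V \<longrightarrow> t \<in> carrier (sec A V) \<longrightarrow> \<phi> V t = (\<lambda>x\<in>V. t x w)"
proof -
  interpret M: Module.module Cfield M by (rule M)
  have "\<exists>k. \<phi> X (\<lambda>x\<in>X. l) = const_fun X k" if "l \<in> carrier (dual_space M)" for l
    using mor_closed[OF \<phi> X_open subset_refl trivial_bundle_const[OF X_open that]]
    by (intro constants) simp
  then obtain \<gamma> where \<gamma>: "\<And>l. l \<in> carrier (dual_space M) \<Longrightarrow> \<phi> X (\<lambda>x\<in>X. l) = const_fun X (\<gamma> l)"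
    by metis
  \<comment> \<open>The identification of M with its double dual in coordinates: for a functional t
    on M, t(w) is the sum of the \<gamma>(l) t(w'), which is the expansion obtained for
    \<phi>.\<close>
  define w where "w = msum M (\<lambda>(l, w'). \<gamma> l \<odot>\<^bsub>M\<^esub> w') cb"
  have z: "fst z \<in> carrier (dual_space M)" "snd z \<in> carrier M" if "z \<in># cb" for z
    using that cb(1) by auto
  have "\<phi> V t = (\<lambda>x\<in>V. t x w)" if V: "open_in X V" and t: "t \<in> carrier (sec A V)" for V t
  proof -
    interpret R: cring "reg_ring X V" by (rule reg_cring[OF V])
    define g where "g z = (\<lambda>x\<in>V. t x (snd z) * \<gamma> (fst z))" for z
    have g: "g z = (\<lambda>x\<in>V. t x (snd z)) \<otimes>\<^bsub>reg_ring X V\<^esub> const_fun V (\<gamma> (fst z))" for z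
      by (simp add: g_def reg_ring_simps cong: restrict_cong)
    have gc: "g z \<in> carrier (reg_ring X V)" if "z \<in># cb" for z
      unfolding g
      by (rule R.m_closed[OF trivial_bundle_expand(2)[OF reg_cring M cb V t z(2)[OF that]] reg_const[OF V]])
    have "\<phi> V t = msum (reg_ring X V)
        (\<lambda>(l, w). (\<lambda>x\<in>V. t x w) \<odot>\<^bsub>reg_ring X V\<^esub> restrict (\<phi> X (\<lambda>x\<in>X. l)) V) cb"
      using trivial_mor_expand[OF O' \<phi> V t] by simp
    also have "\<dots> = msum (reg_ring X V) g cb"
    proof (rule R.msum_cong)
      fix y assume y: "y \<in># cb"
      have "restrict (\<phi> X (\<lambda>x\<in>X. fst y)) V = const_fun V (\<gamma> (fst y))"
        unfolding \<gamma>[OF z(1)[OF y]] by (rule restrict_const_fun[OF open_in_subset[OF V]])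
      then show "(\<lambda>(l, w). (\<lambda>x\<in>V. t x w) \<odot>\<^bsub>reg_ring X V\<^esub> restrict (\<phi> X (\<lambda>x\<in>X. l)) V) y = g y"
        unfolding case_prod_unfold g by (simp only: reg_ring_simps)
    qed
    finally have \<phi>t: "\<phi> V t = msum (reg_ring X V) g cb" .
    show ?thesis
    proof (rule extensionalityI[of _ V])
      show "\<phi> V t \<in> extensional V" unfolding \<phi>t by (rule reg_ext[OF R.msum_closed])
      fix x assume x: "x \<in> V"
      note tx = trivial_bundle_value[OF t x]
      have "\<phi> V t x = msum Cfield (\<lambda>z. g z x) cb"
        unfolding \<phi>t using x
        by (intro R.msum_hom gc) (auto simp: reg_ring_simps intro: M.R.abelian_monoid_axioms)
      also have "\<dots> = msum Cfield (\<lambda>z. t x ((\<lambda>(l, w'). \<gamma> l \<odot>\<^bsub>M\<^esub> w') z)) cb"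
        using x z tx by (intro M.R.msum_cong) (auto simp: g_def dual_space_iff split_beta)
      also have "\<dots> = t x w"
        unfolding w_def using z tx dual_space_zero[OF M tx] M.smult_closed
        by (intro M.msum_hom[symmetric])
          (auto simp: dual_space_iff split_beta intro: M.R.abelian_monoid_axioms)
      finally show "\<phi> V t x = (\<lambda>x\<in>V. t x w) x" using x by simp
    qed simp
  qed
  moreover have "w \<in> carrier M" by (simp add: w_def)
  ultimately show ?thesis by blast
qed

text \<open>Put b(x) = \<psi> composed with \<open>s x\<close>. Applying \<psi> to s(y) = s(x) +
  i(c(x,y)) gives b(y) - b(x) = \<psi>(i(c(x,y))), and by hypothesis on \<psi> the right side is the
  contraction of c by w. So the contraction is the coboundary of b.\<close>

lemma functional_restriction:
  assumes \<psi>: "\<psi> \<in> mor X E (struct_sheaf X) X" and w: "w \<in> carrier M"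
    and \<psi>i: "\<And>V t. open_in X V \<Longrightarrow> t \<in> carrier (sec A V) \<Longrightarrow> \<psi> V (i V t) = (\<lambda>x\<in>V. t x w)"
  shows "w = \<zero>\<^bsub>M\<^esub>"
proof (rule universal[OF w])
  let ?D = "dual_sheaf X F"
  define \<kappa> where "\<kappa> = hom_family X A X (\<lambda>V t. \<lambda>x\<in>V. t x w)"
  have \<kappa>: "\<kappa> \<in> mor X A (struct_sheaf X) X" unfolding \<kappa>_def by (rule eval_mor[OF w])
  define d where "d = (\<lambda>x y. contract X F (\<lambda>v. v w) (U x \<inter> U y) (c x y))"
  have d_eq: "d x y = hom_family X F (U x \<inter> U y) (\<lambda>V f. \<lambda>z\<in>V. c x y V f z w)" for x y
    by (simp add: d_def contract_def hom_family_def)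
  have UX: "U x \<subseteq> X" if "x \<in> X" for x using U_open[OF that] open_in_subset by blast
  have d_mor: "d x y \<in> mor X F (struct_sheaf X) (U x \<inter> U y)" if xy: "x \<in> X" "y \<in> X" for x y
  proof -
    \<comment> \<open>Contraction by w is composition with evaluation at w, which makes the
      contracted cochain a morphism without further checks.\<close>
    have "mor_comp X F (U x \<inter> U y) \<kappa> (c x y) \<in> mor X F (struct_sheaf X) (U x \<inter> U y)"
      using UX[OF xy(1)] by (intro mor_comp_mor[OF F' c_mor[OF xy] \<kappa>]) auto
    also have "mor_comp X F (U x \<inter> U y) \<kappa> (c x y) = d x y"
      unfolding mor_comp_def d_eq
    proof (rule hom_family_cong)
      fix V f assume V: "open_in X V" "V \<subseteq> U x \<inter> U y" "f \<in> carrier (sec F V)"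
      then show "\<kappa> V (c x y V f) = (\<lambda>z\<in>V. c x y V f z w)"
        using mor_closed[OF c_mor[OF xy] V] open_in_subset[OF V(1)] by (simp add: \<kappa>_def)
    qed
    finally show ?thesis .
  qed
  have d_res: "res ?D (U x \<inter> U y) T (d x y) = hom_family X F T (\<lambda>V f. \<lambda>z\<in>V. c x y V f z w)"
    if "x \<in> X" "y \<in> X" "T \<subseteq> U x \<inter> U y" for x y T
  proof -
    have "res ?D (U x \<inter> U y) T (d x y) = hom_family X F T (d x y)"
      by (rule hom_sheaf_res[OF d_mor[OF that(1,2)] that(3)])
    also have "\<dots> = hom_family X F T (\<lambda>V f. \<lambda>z\<in>V. c x y V f z w)"
      unfolding d_eq by (intro hom_family_cong hom_family_apply) (use that(3) in \<open>blast+\<close>)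
    finally show ?thesis .
  qed
  \<comment> \<open>The 0-cochain bounding d: values of the functional on the local lifts of
    sections of F.\<close>
  define b where "b x = mor_comp X F (U x) \<psi> (s x)" for x
  have b: "b x \<in> mor X F (struct_sheaf X) (U x)" if "x \<in> X" for x
    unfolding b_def using UX[OF that] by (intro mor_comp_mor[OF F' s[OF that] \<psi>]) auto
  have "((U, d), (\<lambda>x. X, \<lambda>x y. \<zero>\<^bsub>sec ?D X\<^esub>)) \<in> cohomologous X ?D"
  \<comment> \<open>The cover U refines itself and the constant cover X carrying the zero cocycle,
    so no smaller cover is needed.\<close>
  proof (rule cohomologousI[OF _ _ cover])
    show "(\<lambda>x. X, \<lambda>x y. \<zero>\<^bsub>sec ?D X\<^esub>) \<in> cocycles X ?D"
      by (rule zero_cocycle[OF hom_presheaf[OF F' O'] X_open])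
    show "(U, d) \<in> cocycles X ?D"
      unfolding cocycles_def mem_Collect_eq prod.case Let_def
    proof (intro conjI ballI cover)
      fix x y assume xy: "x \<in> X" "y \<in> X"
      show "d x y \<in> carrier (sec ?D (U x \<inter> U y))" unfolding hom_sheaf_simps by (rule d_mor[OF xy])
      fix z assume z: "z \<in> X"
      let ?T = "U x \<inter> U y \<inter> U z"
      have "res ?D (U x \<inter> U z) ?T (d x z) = hom_family X F ?T (\<lambda>V f. \<lambda>u\<in>V. c x z V f u w)"
        by (rule d_res) (use xy z in auto)
      also have "\<dots> = hom_family X F ?T (\<lambda>V f. \<lambda>u\<in>V. c x y V f u w)
          \<oplus>\<^bsub>sec ?D ?T\<^esub> hom_family X F ?T (\<lambda>V f. \<lambda>u\<in>V. c y z V f u w)"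
        unfolding hom_sheaf_simps
      proof (rule hom_family_cong)
        fix V f assume V: "open_in X V" "V \<subseteq> ?T" and f: "f \<in> carrier (sec F V)"
        show "(\<lambda>u\<in>V. c x z V f u w) = hom_family X F ?T (\<lambda>V f. \<lambda>u\<in>V. c x y V f u w) V f
            \<oplus>\<^bsub>sec (struct_sheaf X) V\<^esub> hom_family X F ?T (\<lambda>V f. \<lambda>u\<in>V. c y z V f u w) V f"
          using V f w unfolding c_cocycle[OF xy z V f]
          by (auto simp: reg_ring_simps trivial_bundle_simps(3) dual_space_simps fun_eq_iff restrict_def)
      qed
      also have "hom_family X F ?T (\<lambda>V f. \<lambda>u\<in>V. c x y V f u w) = res ?D (U x \<inter> U y) ?T (d x y)"
        by (rule d_res[symmetric]) (use xy z in auto)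
      also have "hom_family X F ?T (\<lambda>V f. \<lambda>u\<in>V. c y z V f u w) = res ?D (U y \<inter> U z) ?T (d y z)"
        by (rule d_res[symmetric]) (use xy z in auto)
      finally show "res ?D (U x \<inter> U z) ?T (d x z) =
          res ?D (U x \<inter> U y) ?T (d x y) \<oplus>\<^bsub>sec ?D ?T\<^esub> res ?D (U y \<inter> U z) ?T (d y z)" .
    qed
    show "b x \<in> carrier (sec ?D (U x))" if "x \<in> X" for x
      unfolding hom_sheaf_simps by (rule b[OF that])
    show "U x \<subseteq> X" if "x \<in> X" for x by (rule UX[OF that])
    fix x y assume xy: "x \<in> X" "y \<in> X"
    define T where "T = U x \<inter> U y"
    have T: "T \<subseteq> U x" "T \<subseteq> U y" "T \<subseteq> X" "T \<subseteq> U x \<inter> U y" using UX[OF xy(1)] by (auto simp: T_def)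
    have oT: "open_in X T" unfolding T_def by (rule open_in_Int[OF U_open[OF xy(1)] U_open[OF xy(2)]])
    have zr: "res ?D (X \<inter> X) T \<zero>\<^bsub>sec ?D X\<^esub> = \<zero>\<^bsub>sec ?D T\<^esub>"
      using res_zero[OF hom_presheaf[OF F' O'] X_open oT T(3)] by simp
    have "res ?D (U x \<inter> U y) T (d x y) \<oplus>\<^bsub>sec ?D T\<^esub> res ?D (U x) T (b x) = \<zero>\<^bsub>sec ?D T\<^esub> \<oplus>\<^bsub>sec ?D T\<^esub> res ?D (U y) T (b y)"
      unfolding d_res[OF xy T(4)] hom_sheaf_res[OF b[OF xy(1)] T(1)] hom_sheaf_res[OF b[OF xy(2)] T(2)]
        hom_sheaf_simps
    proof (rule hom_family_cong)
      fix V f assume V: "open_in X V" "V \<subseteq> T" and f: "f \<in> carrier (sec F V)"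
      have Vs: "V \<subseteq> U x" "V \<subseteq> U y" "V \<subseteq> U x \<inter> U y" "V \<subseteq> X" using V T by auto
      interpret R: cring "reg_ring X V" by (rule reg_cring[OF V(1)])
      have cV: "c x y V f \<in> carrier (sec A V)" by (rule mor_closed[OF c_mor[OF xy] V(1) Vs(3) f])
      have sV: "s x V f \<in> carrier (sec E V)" "s y V f \<in> carrier (sec E V)"
        using s_closed[OF xy(1) V(1) Vs(1) f] s_closed[OF xy(2) V(1) Vs(2) f] .
      have \<psi>c: "\<psi> V (s x V f) \<in> carrier (reg_ring X V)" "\<psi> V (s y V f) \<in> carrier (reg_ring X V)"
        "\<psi> V (i V (c x y V f)) \<in> carrier (reg_ring X V)"
        using mor_closed[OF \<psi> V(1) Vs(4)] sV i_closed[OF V(1) cV] by auto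
      have "\<psi> V (s y V f) = \<psi> V (s x V f) \<oplus>\<^bsub>reg_ring X V\<^esub> \<psi> V (i V (c x y V f))"
        unfolding diff[OF xy V(1) Vs(3) f] using mor_add[OF \<psi> V(1) Vs(4) sV(1) i_closed[OF V(1) cV]] by simp
      then have "(\<lambda>z\<in>V. c x y V f z w) \<oplus>\<^bsub>reg_ring X V\<^esub> \<psi> V (s x V f) =
          \<zero>\<^bsub>reg_ring X V\<^esub> \<oplus>\<^bsub>reg_ring X V\<^esub> \<psi> V (s y V f)"
        using \<psi>c by (simp add: \<psi>i[OF V(1) cV, symmetric] R.a_comm)
      then show "hom_family X F T (\<lambda>V f. \<lambda>z\<in>V. c x y V f z w) V f \<oplus>\<^bsub>sec (struct_sheaf X) V\<^esub> hom_family X F T (b x) V f =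
          hom_family X F T (\<lambda>V f. \<zero>\<^bsub>sec (struct_sheaf X) V\<^esub>) V f \<oplus>\<^bsub>sec (struct_sheaf X) V\<^esub> hom_family X F T (b y) V f"
        using V f Vs by (simp add: b_def)
    qed
    then show "let T = U x \<inter> U y in
       res ?D (U x \<inter> U y) T (d x y) \<oplus>\<^bsub>sec ?D T\<^esub> res ?D (U x) T (b x) =
       res ?D (X \<inter> X) T \<zero>\<^bsub>sec ?D X\<^esub> \<oplus>\<^bsub>sec ?D T\<^esub> res ?D (U y) T (b y)"
      unfolding Let_def T_def[symmetric] zr .
  qed auto
  then show "((U, \<lambda>x y. contract X F (\<lambda>v. v w) (U x \<inter> U y) (c x y)),
      (\<lambda>x. X, \<lambda>x y. \<zero>\<^bsub>sec ?D X\<^esub>)) \<in> cohomologous X ?D"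
    by (simp add: d_def)
qed

section \<open>Homomorphisms out of the middle term\<close>

lemma no_functional:
  assumes \<psi>: "\<psi> \<in> mor X E (struct_sheaf X) X" and V: "open_in X V" and e: "e \<in> carrier (sec E V)"
  shows "\<psi> V e = \<zero>\<^bsub>reg_ring X V\<^esub>"
proof -
  have "mor_comp X A X \<psi> i \<in> mor X A (struct_sheaf X) X"
    by (rule mor_comp_mor[OF A' i \<psi>]) auto
  from functional_on_trivial[OF this] obtain w where w: "w \<in> carrier M"
    and "\<And>V t. open_in X V \<Longrightarrow> t \<in> carrier (sec A V) \<Longrightarrow> mor_comp X A X \<psi> i V t = (\<lambda>x\<in>V. t x w)"
    by blast
  then have \<psi>i: "\<psi> V (i V t) = (\<lambda>x\<in>V. t x w)" if "open_in X V" "t \<in> carrier (sec A V)" for V t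
    using that mor_comp_apply[OF that(1) open_in_subset[OF that(1)] that(2), of \<psi> i] by simp
  have w0: "w = \<zero>\<^bsub>M\<^esub>" by (rule functional_restriction[OF \<psi> w \<psi>i])
  have "\<psi> V (i V t) = \<zero>\<^bsub>sec (struct_sheaf X) V\<^esub>" if V: "open_in X V" and t: "t \<in> carrier (sec A V)" for V t
    unfolding \<psi>i[OF that] w0 struct_sheaf_simps reg_ring_simps
    by (rule restrict_ext) (rule dual_space_zero[OF M trivial_bundle_value[OF t]])
  from factor_mor[OF O \<psi> this] obtain \<psi>' where \<psi>': "\<psi>' \<in> mor X F (struct_sheaf X) X"
    "\<And>V e. open_in X V \<Longrightarrow> e \<in> carrier (sec E V) \<Longrightarrow> \<psi> V e = \<psi>' V (p V e)"
    by blast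
  \<comment> \<open>Global sections of the dual sheaf are the morphisms from F to the structure
    sheaf, so vanishing of H^0 leaves only the zero family.\<close>
  have "\<psi>' = hom_family X F X (\<lambda>V f. \<zero>\<^bsub>reg_ring X V\<^esub>)"
    using H0F_dual \<psi>'(1) by (auto simp: H0_def hom_sheaf_simps)
  then show ?thesis
    using \<psi>'(2)[OF V e] p_closed[OF V e] V open_in_subset[OF V] by simp
qed

text \<open>The endomorphism lifts to a morphism from E to the trivial bundle. Its composite with
  evaluation at each w in M is a functional on E, hence zero, and evaluations separate the points of
  the dual of M.\<close>

lemma endo_zero:
  assumes \<phi>: "\<phi> \<in> mor X E E X"
    and z: "\<And>V e. open_in X V \<Longrightarrow> e \<in> carrier (sec E V) \<Longrightarrow> p V (\<phi> V e) = \<zero>\<^bsub>sec F V\<^esub>"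
    and V: "open_in X V" and e: "e \<in> carrier (sec E V)"
  shows "\<phi> V e = \<zero>\<^bsub>sec E V\<^esub>"
proof -
  interpret D: Module.module Cfield "dual_space M" by (rule dual_space_module[OF M])
  interpret A: abelian_group "sec A V" by (rule presheaf_group[OF A' V])
  note VX = open_in_subset[OF V]
  from lift_mor[OF \<phi> z] obtain \<psi> where \<psi>: "\<psi> \<in> mor X E A X"
    "\<And>V e. open_in X V \<Longrightarrow> e \<in> carrier (sec E V) \<Longrightarrow> \<phi> V e = i V (\<psi> V e)"
    by blast
  have \<psi>e: "\<psi> V e \<in> carrier (sec A V)" by (rule mor_closed[OF \<psi>(1) V VX e])
  have "\<psi> V e = \<zero>\<^bsub>sec A V\<^esub>"
  proof (rule trivial_bundle_eqI[OF \<psi>e A.zero_closed])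
    fix x assume x: "x \<in> V"
    have "\<psi> V e x = \<zero>\<^bsub>dual_space M\<^esub>"
    proof (rule dual_space_eqI[OF trivial_bundle_value[OF \<psi>e x] D.zero_closed])
      fix w assume w: "w \<in> carrier M"
      let ?\<kappa> = "hom_family X A X (\<lambda>V t. \<lambda>x\<in>V. t x w)"
      have "mor_comp X E X ?\<kappa> \<psi> \<in> mor X E (struct_sheaf X) X"
        by (rule mor_comp_mor[OF E' \<psi>(1) eval_mor[OF w]]) auto
      from no_functional[OF this V e] have "(\<lambda>x\<in>V. \<psi> V e x w) = \<zero>\<^bsub>reg_ring X V\<^esub>"
        using V VX e \<psi>e by simp
      then show "\<psi> V e x w = \<zero>\<^bsub>dual_space M\<^esub> w"
        using x w by (auto simp: reg_ring_simps dual_space_simps dest: fun_cong[of _ _ x])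
    qed
    then show "\<psi> V e x = \<zero>\<^bsub>sec A V\<^esub> x" using x by (simp add: trivial_bundle_simps)
  qed
  then show ?thesis using \<psi>(2)[OF V e] mor_zero[OF A' E' i V VX] by simp
qed

text \<open>On the trivial subbundle \<phi> is governed by the images of the constant sections.
  These lie in H^0(F) = 0, so \<phi> kills the subbundle and descends to an endomorphism of F, which
  is a scalar.\<close>

lemma hom_middle_quotient:
  assumes \<phi>: "\<phi> \<in> mor X E F X"
  shows "\<exists>k. \<forall>V e. open_in X V \<longrightarrow> e \<in> carrier (sec E V) \<longrightarrow> \<phi> V e = const_fun V k \<odot>\<^bsub>sec F V\<^esub> p V e"
proof -
  have "\<phi> V (i V t) = \<zero>\<^bsub>sec F V\<^esub>" if V: "open_in X V" and t: "t \<in> carrier (sec A V)" for V t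
  proof -
    note VX = open_in_subset[OF V]
    interpret F: Module.module "reg_ring X V" "sec F V" by (rule presheaf_module[OF F' V])
    define \<eta> where "\<eta> = mor_comp X A X \<phi> i"
    have \<eta>: "\<eta> \<in> mor X A F X" unfolding \<eta>_def by (rule mor_comp_mor[OF A' i \<phi>]) auto
    have "\<eta> X (\<lambda>x\<in>X. l) = \<zero>\<^bsub>sec F X\<^esub>" if "l \<in> carrier (dual_space M)" for l
      using mor_closed[OF \<eta> X_open subset_refl trivial_bundle_const[OF X_open that]] H0F by (simp add: H0_def)
    moreover have "fst z \<in> carrier (dual_space M)" "(\<lambda>x\<in>V. t x (snd z)) \<in> carrier (reg_ring X V)"
      if "z \<in># cb" for z
      using that cb(1) by (auto intro!: trivial_bundle_expand(2)[OF reg_cring M cb V t])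
    ultimately have "\<eta> V t = \<zero>\<^bsub>sec F V\<^esub>"
      unfolding trivial_mor_expand[OF F' \<eta> V t]
      by (intro F.M.msum_zero) (simp add: case_prod_unfold res_zero[OF F' X_open V VX])
    then show ?thesis using V VX t by (simp add: \<eta>_def)
  qed
  from factor_mor[OF F \<phi> this] obtain \<phi>' where \<phi>': "\<phi>' \<in> mor X F F X"
    "\<And>V e. open_in X V \<Longrightarrow> e \<in> carrier (sec E V) \<Longrightarrow> \<phi> V e = \<phi>' V (p V e)"
    by blast
  have "\<phi>' \<in> range (scalar_endo X F)"
    using \<phi>'(1) simple by (simp add: simple_sheaf_def bij_betw_def)
  then obtain k where "\<phi>' = scalar_endo X F k" by (rule imageE)
  then show ?thesis using \<phi>'(2) p_closed by auto
qed

lemma p_scalar: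
  "open_in X V \<Longrightarrow> e \<in> carrier (sec E V) \<Longrightarrow>
    p V (const_fun V k \<odot>\<^bsub>sec E V\<^esub> e) = const_fun V k \<odot>\<^bsub>sec F V\<^esub> p V e"
  by (rule mor_smult[OF p]) (auto intro: reg_const dest: open_in_subset)

text \<open>The difference of the two, formed in the group of global homomorphisms, is killed by p
  and so vanishes. This is injectivity of Hom(E, E) -> Hom(E, F) in the form used below.\<close>

lemma endo_eqI:
  assumes \<phi>: "\<phi> \<in> mor X E E X" and \<psi>: "\<psi> \<in> mor X E E X"
    and eq: "\<And>V e. open_in X V \<Longrightarrow> e \<in> carrier (sec E V) \<Longrightarrow> p V (\<phi> V e) = p V (\<psi> V e)"
  shows "\<phi> = \<psi>"
proof -
  interpret H: abelian_group "sec (hom_sheaf X E E) X"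
    by (rule presheaf_group[OF hom_presheaf[OF E' E'] X_open])
  define \<delta> where "\<delta> = \<phi> \<ominus>\<^bsub>sec (hom_sheaf X E E) X\<^esub> \<psi>"
  have H: "\<phi> \<in> carrier (sec (hom_sheaf X E E) X)" "\<psi> \<in> carrier (sec (hom_sheaf X E E) X)"
    using \<phi> \<psi> by (simp_all add: hom_sheaf_simps(1))
  have \<delta>: "\<delta> \<in> mor X E E X"
    using H.minus_closed[OF H] by (simp add: \<delta>_def hom_sheaf_simps(1))
  have sum: "\<phi> = \<delta> \<oplus>\<^bsub>sec (hom_sheaf X E E) X\<^esub> \<psi>"
    using H by (simp add: \<delta>_def H.minus_eq H.a_assoc H.l_neg)
  have ap: "\<phi> V e = \<delta> V e \<oplus>\<^bsub>sec E V\<^esub> \<psi> V e" if "open_in X V" "e \<in> carrier (sec E V)" for V e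
    using arg_cong[OF sum, of "\<lambda>f. f V e"] that open_in_subset[of X V] by (simp add: hom_sheaf_simps)
  show ?thesis
  proof (rule mor_eqI[OF \<phi> \<psi>])
    fix V e assume V: "open_in X V" "V \<subseteq> X" and e: "e \<in> carrier (sec E V)"
    interpret E: abelian_group "sec E V" by (rule presheaf_group[OF E' V(1)])
    have "\<delta> V e = \<zero>\<^bsub>sec E V\<^esub>"
    proof (rule endo_zero[OF \<delta> _ V(1) e])
      fix V e assume V: "open_in X V" and e: "e \<in> carrier (sec E V)"
      interpret F: abelian_group "sec F V" by (rule presheaf_group[OF F' V])
      note VX = open_in_subset[OF V]
      note cl = mor_closed[OF \<delta> V VX e] mor_closed[OF \<psi> V VX e] mor_closed[OF \<phi> V VX e]
      have "p V (\<delta> V e) \<oplus>\<^bsub>sec F V\<^esub> p V (\<psi> V e) = p V (\<psi> V e)"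
        using mor_add[OF p V VX cl(1,2)] ap[OF V e] eq[OF V e] by simp
      then show "p V (\<delta> V e) = \<zero>\<^bsub>sec F V\<^esub>"
        using p_closed[OF V cl(1)] p_closed[OF V cl(2)] by simp
    qed
    then show "\<phi> V e = \<psi> V e" using ap[OF V(1) e] mor_closed[OF \<psi> V e] by simp
  qed
qed

text \<open>Distinct scalars act differently on E because p reaches every local section of F through
  a splitting, and they act differently on F. Conversely p composed with an endomorphism is a
  multiple of p, and the same multiple of the identity has the same composite.\<close>

lemma simple_middle: "simple_sheaf X E"
  unfolding simple_sheaf_def bij_betw_def
proof
  show "inj (scalar_endo X E)"
  proof (rule injI)
    fix k k' assume eq: "scalar_endo X E k = scalar_endo X E k'"
    have "scalar_endo X F k = scalar_endo X F k'"
    proof (rule mor_eq_local[OF F' F scalar_endo_mor[OF F' X_open] scalar_endo_mor[OF F' X_open]])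
      fix x assume x: "x \<in> X"
      have "scalar_endo X F k V f = scalar_endo X F k' V f"
        if V: "open_in X V" "V \<subseteq> U x" and f: "f \<in> carrier (sec F V)" for V f
      proof -
        have sf: "s x V f \<in> carrier (sec E V)" by (rule s_closed[OF x V f])
        have "p V (scalar_endo X E k V (s x V f)) = p V (scalar_endo X E k' V (s x V f))"
          by (simp add: eq)
        then show ?thesis using V f sf by (simp add: p_scalar split[OF x V f])
      qed
      then show "\<exists>T. open_in X T \<and> x \<in> T \<and>
        (\<forall>V f. open_in X V \<and> V \<subseteq> T \<and> V \<subseteq> X \<and> f \<in> carrier (sec F V) \<longrightarrow>
          scalar_endo X F k V f = scalar_endo X F k' V f)"
        using U_open[OF x] U_mem[OF x] by blast
    qed
    then show "k = k'" using simple by (auto simp: simple_sheaf_def bij_betw_def dest: injD)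
  qed
  show "range (scalar_endo X E) = mor X E E X"
  proof
    show "range (scalar_endo X E) \<subseteq> mor X E E X" using scalar_endo_mor[OF E' X_open] by auto
    show "mor X E E X \<subseteq> range (scalar_endo X E)"
    proof
      fix \<phi> assume \<phi>: "\<phi> \<in> mor X E E X"
      have "mor_comp X E X p \<phi> \<in> mor X E F X" by (rule mor_comp_mor[OF E' \<phi> p]) auto
      from hom_middle_quotient[OF this] obtain k where k: "\<And>V e. open_in X V \<Longrightarrow> e \<in> carrier (sec E V) \<Longrightarrow>
        mor_comp X E X p \<phi> V e = const_fun V k \<odot>\<^bsub>sec F V\<^esub> p V e" by blast
      have "\<phi> = scalar_endo X E k"
      proof (rule endo_eqI[OF \<phi> scalar_endo_mor[OF E' X_open]])
        fix V e assume V: "open_in X V" and e: "e \<in> carrier (sec E V)"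
        show "p V (\<phi> V e) = p V (scalar_endo X E k V e)"
          using k[OF V e] V e open_in_subset[OF V] by (simp add: p_scalar)
      qed
      then show "\<phi> \<in> range (scalar_endo X E)" by simp
    qed
  qed
qed

text \<open>Each homomorphism from E to F is a multiple of p, so scalar endomorphisms of E already
  exhaust the target. This is the asserted isomorphism before it is transported to tensor
  products.\<close>

lemma comp_p_bij: "bij_betw (mor_comp X E X p) (mor X E E X) (mor X E F X)"
proof (rule bij_betw_imageI)
  show "inj_on (mor_comp X E X p) (mor X E E X)"
  proof (rule inj_onI)
    fix \<phi> \<psi> assume \<phi>: "\<phi> \<in> mor X E E X" and \<psi>: "\<psi> \<in> mor X E E X"
      and eq: "mor_comp X E X p \<phi> = mor_comp X E X p \<psi>"
    show "\<phi> = \<psi>"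
    proof (rule endo_eqI[OF \<phi> \<psi>])
      fix V e assume "open_in X V" "e \<in> carrier (sec E V)"
      then show "p V (\<phi> V e) = p V (\<psi> V e)"
        using arg_cong[OF eq, of "\<lambda>f. f V e"] open_in_subset[of X V] by simp
    qed
  qed
  show "mor_comp X E X p ` mor X E E X = mor X E F X"
  proof
    show "mor_comp X E X p ` mor X E E X \<subseteq> mor X E F X"
      using mor_comp_mor[OF E' _ p subset_refl subset_refl] by blast
    show "mor X E F X \<subseteq> mor_comp X E X p ` mor X E E X"
    proof
      fix \<phi> assume \<phi>: "\<phi> \<in> mor X E F X"
      from hom_middle_quotient[OF \<phi>] obtain k where k: "\<And>V e. open_in X V \<Longrightarrow> e \<in> carrier (sec E V) \<Longrightarrow>
        \<phi> V e = const_fun V k \<odot>\<^bsub>sec F V\<^esub> p V e" by blast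
      have k_mor: "scalar_endo X E k \<in> mor X E E X" by (rule scalar_endo_mor[OF E' X_open])
      have "\<phi> = mor_comp X E X p (scalar_endo X E k)"
        by (rule mor_eqI[OF \<phi> mor_comp_mor[OF E' k_mor p subset_refl subset_refl]])
          (simp add: k p_scalar)
      with k_mor show "\<phi> \<in> mor_comp X E X p ` mor X E E X" by blast
    qed
  qed
qed

end


section \<open>Tensor products with a dual sheaf\<close>

lemma tensor_eq_formal:
  assumes "Module.module R M" "Module.module R N" "tensor_eq R M N l k"
  shows "l \<in> formal_tensors M N \<and> k \<in> formal_tensors M N"
proof -
  interpret M: Module.module R M by fact
  interpret N: Module.module R N by fact
  show ?thesis using assms(3)
    by (induction rule: tensor_eq.induct) (auto simp: formal_tensors_def)
qed

text \<open>The rule \<open>plus\<close> changes only one summand at a time and fixes a formal sum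
  beside it. Two applications joined by transitivity give the congruence.\<close>

lemma tensor_eq_add:
  assumes M: "Module.module R M" and N: "Module.module R N" and "tensor_eq R M N l k" "tensor_eq R M N l' k'"
  shows "tensor_eq R M N (l + l') (k + k')"
proof -
  note f = tensor_eq_formal[OF M N]
  have "tensor_eq R M N (l + l') (k + l')" using assms f by (intro tensor_eq.plus) auto
  moreover have "tensor_eq R M N (l' + k) (k' + k)" using assms f by (intro tensor_eq.plus) auto
  ultimately show ?thesis by (metis tensor_eq.trans add.commute)
qed

text \<open>Only vanishing of the left factor is a generating relation; the zero scalar is moved
  across to obtain the other side.\<close>

lemma tensor_eq_zero_right:
  assumes M: "Module.module R M" and N: "Module.module R N" and a: "a \<in> carrier M"
  shows "tensor_eq R M N {#(a, \<zero>\<^bsub>N\<^esub>)#} {#}"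
proof -
  interpret M: Module.module R M by fact
  interpret N: Module.module R N by fact
  have "tensor_eq R M N {#(\<zero>\<^bsub>R\<^esub> \<odot>\<^bsub>M\<^esub> a, \<zero>\<^bsub>N\<^esub>)#} {#(a, \<zero>\<^bsub>R\<^esub> \<odot>\<^bsub>N\<^esub> \<zero>\<^bsub>N\<^esub>)#}"
    using a by (intro tensor_eq.smult) auto
  then have "tensor_eq R M N {#(\<zero>\<^bsub>M\<^esub>, \<zero>\<^bsub>N\<^esub>)#} {#(a, \<zero>\<^bsub>N\<^esub>)#}" using a by simp
  then show ?thesis
    using tensor_eq.zero[of "\<zero>\<^bsub>N\<^esub>" N R M] by (metis N.zero_closed tensor_eq.sym tensor_eq.trans)
qed

lemma tensor_eq_zeros:
  assumes M: "Module.module R M" and N: "Module.module R N"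
    and "\<And>z. z \<in># l \<Longrightarrow> h z \<in> carrier N"
  shows "tensor_eq R M N (image_mset (\<lambda>z. (\<zero>\<^bsub>M\<^esub>, h z)) l) {#}"
  using assms(3)
proof (induction l)
  case empty
  then show ?case by (auto intro: tensor_eq.refl simp: formal_tensors_def)
next
  case (add z l)
  then have "tensor_eq R M N ({#(\<zero>\<^bsub>M\<^esub>, h z)#} + image_mset (\<lambda>z. (\<zero>\<^bsub>M\<^esub>, h z)) l) ({#} + {#})"
    by (intro tensor_eq_add[OF M N] tensor_eq.zero) auto
  then show ?case by simp
qed

lemma tensor_eq_add_lefts:
  assumes M: "Module.module R M" and N: "Module.module R N"
    and "\<And>z. z \<in># l \<Longrightarrow> f z \<in> carrier M" "\<And>z. z \<in># l \<Longrightarrow> g z \<in> carrier M" "\<And>z. z \<in># l \<Longrightarrow> h z \<in> carrier N"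
  shows "tensor_eq R M N (image_mset (\<lambda>z. (f z \<oplus>\<^bsub>M\<^esub> g z, h z)) l)
    (image_mset (\<lambda>z. (f z, h z)) l + image_mset (\<lambda>z. (g z, h z)) l)"
  using assms(3-)
proof (induction l)
  case empty
  then show ?case by (auto intro: tensor_eq.refl simp: formal_tensors_def)
next
  case (add z l)
  have "tensor_eq R M N ({#(f z \<oplus>\<^bsub>M\<^esub> g z, h z)#} + image_mset (\<lambda>z. (f z \<oplus>\<^bsub>M\<^esub> g z, h z)) l)
      ({#(f z, h z), (g z, h z)#} + (image_mset (\<lambda>z. (f z, h z)) l + image_mset (\<lambda>z. (g z, h z)) l))"
    using add by (intro tensor_eq_add[OF M N] tensor_eq.add_left) auto
  then show ?case by (simp add: add_mset_commute)
qed

text \<open>Scalars pass from the left to the right factor and additivity on the right collects the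
  terms. With r the coordinates and h the vectors of a dual basis, the collected vector is the one
  being expanded.\<close>

lemma tensor_eq_smults:
  assumes M: "Module.module R M" and N: "Module.module R N"
    and "\<And>z. z \<in># l \<Longrightarrow> r z \<in> carrier R" "a \<in> carrier M" "\<And>z. z \<in># l \<Longrightarrow> h z \<in> carrier N"
  shows "tensor_eq R M N (image_mset (\<lambda>z. (r z \<odot>\<^bsub>M\<^esub> a, h z)) l) {#(a, msum N (\<lambda>z. r z \<odot>\<^bsub>N\<^esub> h z) l)#}"
  using assms(3-)
proof (induction l)
  case empty
  then show ?case using tensor_eq_zero_right[OF M N] by (auto intro: tensor_eq.sym)
next
  case (add z l)
  interpret M: Module.module R M by fact
  interpret N: Module.module R N by fact
  have cl: "r z \<in> carrier R" "h z \<in> carrier N" "r z \<odot>\<^bsub>N\<^esub> h z \<in> carrier N" using add.prems by auto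
  have "tensor_eq R M N ({#(r z \<odot>\<^bsub>M\<^esub> a, h z)#} + image_mset (\<lambda>z. (r z \<odot>\<^bsub>M\<^esub> a, h z)) l)
      ({#(a, r z \<odot>\<^bsub>N\<^esub> h z)#} + {#(a, msum N (\<lambda>z. r z \<odot>\<^bsub>N\<^esub> h z) l)#})"
    using add cl by (intro tensor_eq_add[OF M N] tensor_eq.smult) auto
  moreover have "tensor_eq R M N {#(a, r z \<odot>\<^bsub>N\<^esub> h z \<oplus>\<^bsub>N\<^esub> msum N (\<lambda>z. r z \<odot>\<^bsub>N\<^esub> h z) l)#}
      ({#(a, r z \<odot>\<^bsub>N\<^esub> h z)#} + {#(a, msum N (\<lambda>z. r z \<odot>\<^bsub>N\<^esub> h z) l)#})"
    using tensor_eq.add_right[of a M "r z \<odot>\<^bsub>N\<^esub> h z" N "msum N (\<lambda>z. r z \<odot>\<^bsub>N\<^esub> h z) l" R] cl add.prems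
    by (simp add: add_mset_commute)
  ultimately have "tensor_eq R M N ({#(r z \<odot>\<^bsub>M\<^esub> a, h z)#} + image_mset (\<lambda>z. (r z \<odot>\<^bsub>M\<^esub> a, h z)) l)
      {#(a, r z \<odot>\<^bsub>N\<^esub> h z \<oplus>\<^bsub>N\<^esub> msum N (\<lambda>z. r z \<odot>\<^bsub>N\<^esub> h z) l)#}"
    by (rule tensor_eq.trans[OF _ tensor_eq.sym])
  then show ?case using cl by simp
qed

lemma hom_family_idem: "W \<subseteq> V \<Longrightarrow> hom_family X A W (hom_family X A V \<phi>) = hom_family X A W \<phi>"
  by (rule hom_family_cong) auto

lemma hom_family_eq_mono:
  "hom_family X A V \<phi> = hom_family X A V \<psi> \<Longrightarrow> W \<subseteq> V \<Longrightarrow> hom_family X A W \<phi> = hom_family X A W \<psi>"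
  by (metis hom_family_idem)

lemma hom_family_eq_apply:
  "hom_family X A V \<phi> = hom_family X A V \<psi> \<Longrightarrow> open_in X W \<Longrightarrow> W \<subseteq> V \<Longrightarrow> s \<in> carrier (sec A W) \<Longrightarrow> \<phi> W s = \<psi> W s"
  by (metis hom_family_apply)

text \<open>A homomorphism \<phi> from E to N is the sum of the (\<beta> composed with \<phi>)
  tensor b over a dual basis of N. Hence local dual bases are asked of N alone, and E may be any
  presheaf of modules.\<close>

locale dual_tensor =
  fixes X :: "'n::finite pt set" and E :: "('n pt, 'e) msheaf" and N :: "('n pt, 't) msheaf"
  assumes X_open: "open_in X X" and E: "mod_presheaf X E" and N_sheaf: "mod_sheaf X N"
    and local_basis: "\<And>x. x \<in> X \<Longrightarrow> \<exists>U db. open_in X U \<and> x \<in> U \<and> dual_basis X N U db"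
begin

abbreviation "D \<equiv> dual_sheaf X E"
abbreviation "H \<equiv> hom_sheaf X E N"
abbreviation "formal V \<equiv> formal_tensors (sec D V) (sec N V)"
abbreviation "teq V \<equiv> tensor_eq (reg_ring X V) (sec D V) (sec N V)"

lemmas N = mod_sheaf_presheaf[OF N_sheaf]

lemma O: "mod_presheaf X (struct_sheaf X)"
  by (rule struct_sheaf_presheaf[OF presheaf_cring[OF N]])

lemmas D = hom_presheaf[OF E O] and H = hom_presheaf[OF E N]
lemmas D_module = presheaf_module[OF D] and H_module = presheaf_module[OF H] and N_module = presheaf_module[OF N]

lemma formal_iff: "l \<in> formal V \<longleftrightarrow> (\<forall>z. z \<in># l \<longrightarrow> fst z \<in> mor X E (struct_sheaf X) V \<and> snd z \<in> carrier (sec N V))"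
  by (auto simp: formal_tensors_def hom_sheaf_simps)

section \<open>Evaluation of formal sums as homomorphisms from E to N\<close>

definition pure :: "'n pt set \<Rightarrow> ('n pt set \<Rightarrow> 'e \<Rightarrow> 'n pt \<Rightarrow> complex) \<Rightarrow> 't \<Rightarrow> 'n pt set \<Rightarrow> 'e \<Rightarrow> 't" where
  "pure V a b = hom_family X E V (\<lambda>W e. a W e \<odot>\<^bsub>sec N W\<^esub> res N V W b)"

lemma pure_mor:
  assumes V: "open_in X V" and a: "a \<in> mor X E (struct_sheaf X) V" and b: "b \<in> carrier (sec N V)"
  shows "pure V a b \<in> mor X E N V"
  unfolding pure_def
proof (rule hom_family_mor[OF E])
  fix W assume W: "open_in X W" "W \<subseteq> V"
  interpret N: Module.module "reg_ring X W" "sec N W" by (rule N_module[OF W(1)])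
  have aW: "a W e \<in> carrier (reg_ring X W)" if "e \<in> carrier (sec E W)" for e
    using mor_closed[OF a W that] by simp
  have bW: "res N V W b \<in> carrier (sec N W)" by (rule res_closed[OF N V W b])
  show "a W e \<odot>\<^bsub>sec N W\<^esub> res N V W b \<in> carrier (sec N W)" if "e \<in> carrier (sec E W)" for e
    using aW[OF that] bW by simp
  show "a W (e \<oplus>\<^bsub>sec E W\<^esub> e') \<odot>\<^bsub>sec N W\<^esub> res N V W b =
      a W e \<odot>\<^bsub>sec N W\<^esub> res N V W b \<oplus>\<^bsub>sec N W\<^esub> a W e' \<odot>\<^bsub>sec N W\<^esub> res N V W b"
    if "e \<in> carrier (sec E W)" "e' \<in> carrier (sec E W)" for e e'
    using aW that bW mor_add[OF a W that] by (simp add: N.smult_l_distr)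
  show "a W (f \<odot>\<^bsub>sec E W\<^esub> e) \<odot>\<^bsub>sec N W\<^esub> res N V W b = f \<odot>\<^bsub>sec N W\<^esub> (a W e \<odot>\<^bsub>sec N W\<^esub> res N V W b)"
    if "f \<in> carrier (reg_ring X W)" "e \<in> carrier (sec E W)" for f e
  proof -
    have "a W (f \<odot>\<^bsub>sec E W\<^esub> e) = f \<otimes>\<^bsub>reg_ring X W\<^esub> a W e"
      using mor_smult[OF a W that] by (simp add: reg_ring_simps)
    then show ?thesis using that aW bW by (simp add: N.smult_assoc1)
  qed
  show "res N W T (a W e \<odot>\<^bsub>sec N W\<^esub> res N V W b) = a T (res E W T e) \<odot>\<^bsub>sec N T\<^esub> res N V T b"
    if T: "open_in X T" "T \<subseteq> W" and e: "e \<in> carrier (sec E W)" for T e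
    using res_smult[OF N W(1) T aW[OF e] bW] mor_res[OF a W(1) T W(2) e] res_res[OF N V W(1) T(1,2) W(2) b]
    by simp
qed

lemma pure_res:
  assumes V: "open_in X V" and a: "a \<in> mor X E (struct_sheaf X) V" and b: "b \<in> carrier (sec N V)"
    and W: "open_in X W" "W \<subseteq> V"
  shows "hom_family X E W (pure V a b) = pure W (res D V W a) (res N V W b)"
  unfolding pure_def hom_sheaf_res[OF a W(2)]
  using W res_res[OF N V W(1) _ _ W(2) b] by (intro hom_family_cong) auto

lemma pure_zero:
  assumes V: "open_in X V" and b: "b \<in> carrier (sec N V)"
  shows "pure V \<zero>\<^bsub>sec D V\<^esub> b = \<zero>\<^bsub>sec H V\<^esub>"
  unfolding pure_def hom_sheaf_simps
proof (rule hom_family_cong)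
  fix W e assume W: "open_in X W" "W \<subseteq> V" "e \<in> carrier (sec E W)"
  interpret N: Module.module "reg_ring X W" "sec N W" by (rule N_module[OF W(1)])
  show "hom_family X E V (\<lambda>V s. \<zero>\<^bsub>sec (struct_sheaf X) V\<^esub>) W e \<odot>\<^bsub>sec N W\<^esub> res N V W b = \<zero>\<^bsub>sec N W\<^esub>"
    using W res_closed[OF N V W(1,2) b] by simp
qed

lemma pure_add_left:
  assumes V: "open_in X V" and a: "a \<in> mor X E (struct_sheaf X) V" "a' \<in> mor X E (struct_sheaf X) V"
    and b: "b \<in> carrier (sec N V)"
  shows "pure V (a \<oplus>\<^bsub>sec D V\<^esub> a') b = pure V a b \<oplus>\<^bsub>sec H V\<^esub> pure V a' b"
  unfolding pure_def hom_sheaf_simps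
proof (rule hom_family_cong)
  fix W e assume W: "open_in X W" "W \<subseteq> V" "e \<in> carrier (sec E W)"
  interpret N: Module.module "reg_ring X W" "sec N W" by (rule N_module[OF W(1)])
  show "hom_family X E V (\<lambda>V s. a V s \<oplus>\<^bsub>sec (struct_sheaf X) V\<^esub> a' V s) W e \<odot>\<^bsub>sec N W\<^esub> res N V W b =
    hom_family X E V (\<lambda>W e. a W e \<odot>\<^bsub>sec N W\<^esub> res N V W b) W e \<oplus>\<^bsub>sec N W\<^esub>
    hom_family X E V (\<lambda>W e. a' W e \<odot>\<^bsub>sec N W\<^esub> res N V W b) W e"
    using W res_closed[OF N V W(1,2) b] mor_closed[OF a(1) W] mor_closed[OF a(2) W]
    by (simp add: N.smult_l_distr)
qed

lemma pure_add_right: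
  assumes V: "open_in X V" and a: "a \<in> mor X E (struct_sheaf X) V"
    and b: "b \<in> carrier (sec N V)" "b' \<in> carrier (sec N V)"
  shows "pure V a (b \<oplus>\<^bsub>sec N V\<^esub> b') = pure V a b \<oplus>\<^bsub>sec H V\<^esub> pure V a b'"
  unfolding pure_def hom_sheaf_simps
proof (rule hom_family_cong)
  fix W e assume W: "open_in X W" "W \<subseteq> V" "e \<in> carrier (sec E W)"
  interpret N: Module.module "reg_ring X W" "sec N W" by (rule N_module[OF W(1)])
  show "a W e \<odot>\<^bsub>sec N W\<^esub> res N V W (b \<oplus>\<^bsub>sec N V\<^esub> b') =
    hom_family X E V (\<lambda>W e. a W e \<odot>\<^bsub>sec N W\<^esub> res N V W b) W e \<oplus>\<^bsub>sec N W\<^esub>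
    hom_family X E V (\<lambda>W e. a W e \<odot>\<^bsub>sec N W\<^esub> res N V W b') W e"
    using W res_closed[OF N V W(1,2)] b mor_closed[OF a W] res_add[OF N V W(1,2) b]
    by (simp add: N.smult_r_distr)
qed

lemma pure_smult_left:
  assumes V: "open_in X V" and f: "f \<in> carrier (reg_ring X V)" and a: "a \<in> mor X E (struct_sheaf X) V"
    and b: "b \<in> carrier (sec N V)"
  shows "pure V (f \<odot>\<^bsub>sec D V\<^esub> a) b = f \<odot>\<^bsub>sec H V\<^esub> pure V a b"
  unfolding pure_def hom_sheaf_simps
proof (rule hom_family_cong)
  fix W e assume W: "open_in X W" "W \<subseteq> V" "e \<in> carrier (sec E W)"
  interpret N: Module.module "reg_ring X W" "sec N W" by (rule N_module[OF W(1)])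
  have "restrict f W \<odot>\<^bsub>reg_ring X W\<^esub> a W e = restrict f W \<otimes>\<^bsub>reg_ring X W\<^esub> a W e"
    by (simp add: reg_ring_simps)
  then show "hom_family X E V (\<lambda>V s. restrict f V \<odot>\<^bsub>sec (struct_sheaf X) V\<^esub> a V s) W e \<odot>\<^bsub>sec N W\<^esub> res N V W b =
    restrict f W \<odot>\<^bsub>sec N W\<^esub> hom_family X E V (\<lambda>W e. a W e \<odot>\<^bsub>sec N W\<^esub> res N V W b) W e"
    using W res_closed[OF N V W(1,2) b] mor_closed[OF a W] reg_restrict[OF f W(1,2)]
    by (simp add: N.smult_assoc1)
qed

lemma pure_smult_right:
  assumes V: "open_in X V" and f: "f \<in> carrier (reg_ring X V)" and a: "a \<in> mor X E (struct_sheaf X) V"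
    and b: "b \<in> carrier (sec N V)"
  shows "pure V a (f \<odot>\<^bsub>sec N V\<^esub> b) = f \<odot>\<^bsub>sec H V\<^esub> pure V a b"
  unfolding pure_def hom_sheaf_simps
proof (rule hom_family_cong)
  fix W e assume W: "open_in X W" "W \<subseteq> V" "e \<in> carrier (sec E W)"
  interpret N: Module.module "reg_ring X W" "sec N W" by (rule N_module[OF W(1)])
  show "a W e \<odot>\<^bsub>sec N W\<^esub> res N V W (f \<odot>\<^bsub>sec N V\<^esub> b) =
    restrict f W \<odot>\<^bsub>sec N W\<^esub> hom_family X E V (\<lambda>W e. a W e \<odot>\<^bsub>sec N W\<^esub> res N V W b) W e"
    using W res_closed[OF N V W(1,2) b] mor_closed[OF a W] reg_restrict[OF f W(1,2)]
      res_smult[OF N V W(1,2) f b] N.smult_left_commute[of "a W e" "restrict f W" "res N V W b"]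
    by simp
qed

text \<open>The evaluation \<open>E\<^sup>* \<otimes> N \<rightarrow> Hom(E, N)\<close> on formal sums.\<close>

definition ev :: "'n pt set \<Rightarrow> (('n pt set \<Rightarrow> 'e \<Rightarrow> 'n pt \<Rightarrow> complex) \<times> 't) multiset \<Rightarrow> 'n pt set \<Rightarrow> 'e \<Rightarrow> 't" where
  "ev V l = msum (sec H V) (\<lambda>z. pure V (fst z) (snd z)) l"

lemma ev_mor: "open_in X V \<Longrightarrow> ev V l \<in> mor X E N V"
proof -
  assume V: "open_in X V"
  interpret H: abelian_group "sec H V" by (rule presheaf_group[OF H V])
  show ?thesis unfolding ev_def using H.msum_closed by (simp add: hom_sheaf_simps(1))
qed

lemma ev_union: "open_in X V \<Longrightarrow> ev V (l + k) = ev V l \<oplus>\<^bsub>sec H V\<^esub> ev V k"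
  unfolding ev_def by (rule abelian_monoid.msum_union) (rule abelian_group.axioms(1)[OF presheaf_group[OF H]])

lemma ev_empty: "ev V {#} = \<zero>\<^bsub>sec H V\<^esub>"
  by (simp add: ev_def)

lemma ev_add_mset:
  assumes "open_in X V" "a \<in> mor X E (struct_sheaf X) V" "b \<in> carrier (sec N V)"
  shows "ev V (add_mset (a, b) l) = pure V a b \<oplus>\<^bsub>sec H V\<^esub> ev V l"
proof -
  interpret H: abelian_group "sec H V" by (rule presheaf_group[OF H assms(1)])
  show ?thesis unfolding ev_def
    using H.msum_add_mset[of "\<lambda>z. pure V (fst z) (snd z)" "(a, b)" l] pure_mor[OF assms]
    by (simp add: hom_sheaf_simps(1))
qed

lemma formal_res:
  assumes "l \<in> formal V" "open_in X V" "open_in X W" "W \<subseteq> V"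
  shows "res_tensor D N V W l \<in> formal W"
  using assms res_closed[OF D assms(2-4), unfolded hom_sheaf_simps(1)] res_closed[OF N assms(2-4)]
  unfolding formal_iff res_tensor_def by (fastforce simp: split_beta)

lemma ev_res:
  assumes l: "l \<in> formal V" and V: "open_in X V" and W: "open_in X W" "W \<subseteq> V"
  shows "ev W (res_tensor D N V W l) = hom_family X E W (ev V l)"
proof -
  interpret HW: abelian_group "sec H W" by (rule presheaf_group[OF H W(1)])
  have z: "fst z \<in> mor X E (struct_sheaf X) V" "snd z \<in> carrier (sec N V)" if "z \<in># l" for z
    using l that unfolding formal_iff by blast+
  have "hom_family X E W (ev V l) = res H V W (ev V l)"
    by (rule hom_sheaf_res[OF ev_mor[OF V] W(2), symmetric])
  also have "\<dots> = msum (sec H W) (\<lambda>z. res H V W (pure V (fst z) (snd z))) l"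
    unfolding ev_def using pure_mor[OF V z] by (intro res_msum[OF H V W]) (simp add: hom_sheaf_simps(1))
  also have "\<dots> = ev W (res_tensor D N V W l)"
    unfolding ev_def res_tensor_def HW.msum_image
    using z hom_sheaf_res[OF pure_mor[OF V z] W(2)] pure_res[OF V z W]
    by (intro HW.msum_cong) (simp add: split_beta)
  finally show ?thesis by simp
qed

text \<open>Each generating relation of the tensor product becomes an identity between rank-one
  homomorphisms. This is well-definedness of the evaluation on the tensor product.\<close>

lemma teq_ev:
  assumes V: "open_in X V" and "teq V l k"
  shows "ev V l = ev V k"
  using assms(2)
proof (induction rule: tensor_eq.induct)
  case (plus l k j)
  then show ?case by (simp add: ev_union[OF V])
next
  case (zero b)
  interpret H: abelian_group "sec H V" by (rule presheaf_group[OF H V])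
  have "\<zero>\<^bsub>sec D V\<^esub> \<in> mor X E (struct_sheaf X) V"
    using abelian_groupE(2)[OF presheaf_group[OF D V]] by (simp only: hom_sheaf_simps(1))
  then show ?case using zero pure_zero[OF V] by (simp add: ev_add_mset[OF V] ev_empty)
next
  case (add_left a a' b)
  interpret H: abelian_group "sec H V" by (rule presheaf_group[OF H V])
  have a: "a \<in> mor X E (struct_sheaf X) V" "a' \<in> mor X E (struct_sheaf X) V"
    "a \<oplus>\<^bsub>sec D V\<^esub> a' \<in> mor X E (struct_sheaf X) V"
    using add_left abelian_groupE(1)[OF presheaf_group[OF D V]] by (simp_all only: hom_sheaf_simps(1))
  have "pure V a b \<in> carrier (sec H V)" "pure V a' b \<in> carrier (sec H V)"
    using pure_mor[OF V] a add_left by (simp_all add: hom_sheaf_simps(1))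
  then show ?case
    using a add_left by (simp add: ev_add_mset[OF V] ev_empty pure_add_left[OF V] H.a_assoc)
next
  case (add_right a b b')
  interpret H: abelian_group "sec H V" by (rule presheaf_group[OF H V])
  interpret N: abelian_group "sec N V" by (rule presheaf_group[OF N V])
  have a: "a \<in> mor X E (struct_sheaf X) V" using add_right by (simp only: hom_sheaf_simps(1))
  have "pure V a b \<in> carrier (sec H V)" "pure V a b' \<in> carrier (sec H V)"
    using pure_mor[OF V a] add_right by (simp_all add: hom_sheaf_simps(1))
  then show ?case
    using a add_right by (simp add: ev_add_mset[OF V] ev_empty pure_add_right[OF V] H.a_assoc)
next
  case (smult r a b)
  interpret N: Module.module "reg_ring X V" "sec N V" by (rule N_module[OF V])
  interpret D: Module.module "reg_ring X V" "sec D V" by (rule D_module[OF V])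
  have a: "a \<in> mor X E (struct_sheaf X) V" "r \<odot>\<^bsub>sec D V\<^esub> a \<in> mor X E (struct_sheaf X) V"
    using smult D.smult_closed[of r a] by (simp_all only: hom_sheaf_simps(1))
  then show ?case
    using smult by (simp add: ev_add_mset[OF V] ev_empty pure_smult_left[OF V] pure_smult_right[OF V])
qed simp_all

section \<open>Inverting the evaluation over an open set with a dual basis\<close>

definition can :: "'n pt set \<Rightarrow> (('n pt set \<Rightarrow> 't \<Rightarrow> 'n pt \<Rightarrow> complex) \<times> 't) multiset
    \<Rightarrow> ('n pt set \<Rightarrow> 'e \<Rightarrow> 't) \<Rightarrow> (('n pt set \<Rightarrow> 'e \<Rightarrow> 'n pt \<Rightarrow> complex) \<times> 't) multiset" where
  "can V db \<phi> = image_mset (\<lambda>z. (mor_comp X E V (fst z) \<phi>, snd z)) db"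

context
  fixes V db
  assumes V: "open_in X V" and db: "dual_basis X N V db"
begin

lemma coord_mor: "\<phi> \<in> mor X E N V \<Longrightarrow> z \<in># db \<Longrightarrow> mor_comp X E V (fst z) \<phi> \<in> mor X E (struct_sheaf X) V"
  by (rule mor_comp_mor[OF E _ dual_basis_mem(1)[OF db]]) auto

lemma can_formal: "\<phi> \<in> mor X E N V \<Longrightarrow> can V db \<phi> \<in> formal V"
  using coord_mor dual_basis_mem[OF db] by (auto simp: formal_iff can_def)

text \<open>At a section e both sides are the expansion of \<phi>(e) in the dual basis.\<close>

lemma ev_can:
  assumes \<phi>: "\<phi> \<in> mor X E N V"
  shows "ev V (can V db \<phi>) = \<phi>"
proof (rule mor_eqI[OF ev_mor[OF V] \<phi>])
  fix W e assume W: "open_in X W" "W \<subseteq> V" and e: "e \<in> carrier (sec E W)"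
  interpret H: abelian_group "sec H V" by (rule presheaf_group[OF H V])
  interpret NW: abelian_group "sec N W" by (rule presheaf_group[OF N W(1)])
  note z = coord_mor[OF \<phi>] dual_basis_mem(2)[OF db]
  have pz: "pure V (mor_comp X E V (fst z) \<phi>) (snd z) \<in> carrier (sec H V)" if "z \<in># db" for z
    using pure_mor[OF V z[OF that]] by (simp add: hom_sheaf_simps(1))
  have "ev V (can V db \<phi>) W e = msum (sec H V) (\<lambda>z. pure V (mor_comp X E V (fst z) \<phi>) (snd z)) db W e"
    by (simp add: ev_def can_def H.msum_image)
  also have "\<dots> = msum (sec N W) (\<lambda>z. pure V (mor_comp X E V (fst z) \<phi>) (snd z) W e) db"
    by (rule H.msum_hom[where h = "\<lambda>\<psi>. \<psi> W e"])
      (use W e pz in \<open>auto simp: hom_sheaf_simps mor_closed intro: NW.abelian_monoid_axioms\<close>)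
  also have "\<dots> = msum (sec N W) (\<lambda>(\<beta>, b). \<beta> W (\<phi> W e) \<odot>\<^bsub>sec N W\<^esub> res N V W b) db"
    using W e by (intro NW.msum_cong) (simp add: pure_def split_beta)
  also have "\<dots> = \<phi> W e"
    using dual_basis_expand[OF db W mor_closed[OF \<phi> W e]] by simp
  finally show "ev V (can V db \<phi>) W e = \<phi> W e" .
qed

text \<open>For a pure tensor a, b the canonical sum has terms \<beta>(b) a tensor b'. Moving the
  scalars to the right collects the expansion of b itself. Additivity extends this to formal sums,
  so a formal sum is determined modulo the tensor relations by its evaluation.\<close>

lemma teq_can:
  assumes "l \<in> formal V"
  shows "teq V l (can V db (ev V l))"
  using assms
proof (induction l)
  case empty
  have "mor_comp X E V (fst z) \<zero>\<^bsub>sec H V\<^esub> = \<zero>\<^bsub>sec D V\<^esub>" if z: "z \<in># db" for z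
    unfolding mor_comp_def hom_sheaf_simps
    by (rule hom_family_cong) (simp add: mor_zero[OF N O dual_basis_mem(1)[OF db z], simplified])
  then have "can V db \<zero>\<^bsub>sec H V\<^esub> = image_mset (\<lambda>z. (\<zero>\<^bsub>sec D V\<^esub>, snd z)) db"
    unfolding can_def by (intro image_mset_cong) simp
  then show ?case
    using tensor_eq_zeros[OF D_module[OF V] N_module[OF V], where l = db and h = snd]
      dual_basis_mem(2)[OF db]
    by (simp add: ev_empty tensor_eq.sym)
next
  case (add ab l)
  interpret D: Module.module "reg_ring X V" "sec D V" by (rule D_module[OF V])
  obtain a b where ab: "ab = (a, b)" by (cases ab)
  have a: "a \<in> mor X E (struct_sheaf X) V" and b: "b \<in> carrier (sec N V)" and l: "l \<in> formal V"
    using add.prems by (auto simp: formal_iff ab)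
  have p: "pure V a b \<in> mor X E N V" by (rule pure_mor[OF V a b])
  have e: "ev V l \<in> mor X E N V" by (rule ev_mor[OF V])
  have \<beta>b: "fst z V b \<in> carrier (reg_ring X V)" if "z \<in># db" for z
    using mor_closed[OF dual_basis_mem(1)[OF db that] V subset_refl b] by simp
  \<comment> \<open>A coordinate \<beta> sends e to \<beta>(a(e) b) = a(e) \<beta>(b), so the left
    factor is a scalar multiple of a.\<close>
  have c1: "mor_comp X E V (fst z) (pure V a b) = fst z V b \<odot>\<^bsub>sec D V\<^esub> a" if z: "z \<in># db" for z
    unfolding mor_comp_def hom_sheaf_simps
  proof (rule hom_family_cong)
    fix W e assume W: "open_in X W" "W \<subseteq> V" and e: "e \<in> carrier (sec E W)"
    interpret R: cring "reg_ring X W" by (rule presheaf_cring[OF N W(1)])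
    note \<beta> = dual_basis_mem(1)[OF db z]
    have aW: "a W e \<in> carrier (reg_ring X W)" using mor_closed[OF a W e] by simp
    have "fst z W (pure V a b W e) = a W e \<odot>\<^bsub>reg_ring X W\<^esub> fst z W (res N V W b)"
      using mor_smult[OF \<beta> W aW res_closed[OF N V W b]] W e by (simp add: pure_def)
    also have "fst z W (res N V W b) = restrict (fst z V b) W"
      using mor_res[OF \<beta> V W subset_refl b] by simp
    finally show "fst z W (pure V a b W e) = restrict (fst z V b) W \<odot>\<^bsub>sec (struct_sheaf X) W\<^esub> a W e"
      by (auto simp: reg_ring_simps fun_eq_iff restrict_def)
  qed
  have c2: "mor_comp X E V (fst z) (pure V a b \<oplus>\<^bsub>sec H V\<^esub> ev V l) =
      mor_comp X E V (fst z) (pure V a b) \<oplus>\<^bsub>sec D V\<^esub> mor_comp X E V (fst z) (ev V l)" if z: "z \<in># db" for z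
    unfolding mor_comp_def hom_sheaf_simps
    using mor_add[OF dual_basis_mem(1)[OF db z]] mor_closed[OF p] mor_closed[OF e]
    by (intro hom_family_cong) simp
  have "teq V (can V db (pure V a b)) {#(a, msum (sec N V) (\<lambda>z. fst z V b \<odot>\<^bsub>sec N V\<^esub> snd z) db)#}"
  proof -
    have "can V db (pure V a b) = image_mset (\<lambda>z. (fst z V b \<odot>\<^bsub>sec D V\<^esub> a, snd z)) db"
      unfolding can_def using c1 by (intro image_mset_cong) simp
    then show ?thesis
      using tensor_eq_smults[OF D_module[OF V] N_module[OF V],
          where l = db and r = "\<lambda>z. fst z V b" and a = a and h = snd]
        \<beta>b a dual_basis_mem(2)[OF db]
      by (simp add: hom_sheaf_simps(1))
  qed
  \<comment> \<open>The collected right factor is the expansion of b in the dual basis, taken over V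
    itself.\<close>
  also have "msum (sec N V) (\<lambda>z. fst z V b \<odot>\<^bsub>sec N V\<^esub> snd z) db = b"
  proof -
    interpret N: abelian_group "sec N V" by (rule presheaf_group[OF N V])
    have "msum (sec N V) (\<lambda>z. fst z V b \<odot>\<^bsub>sec N V\<^esub> snd z) db =
        msum (sec N V) (\<lambda>(\<beta>, b'). \<beta> V b \<odot>\<^bsub>sec N V\<^esub> res N V V b') db"
      using dual_basis_mem[OF db] by (intro N.msum_cong) (auto simp: split_beta res_id[OF N V])
    then show ?thesis using dual_basis_expand[OF db V subset_refl b] by simp
  qed
  finally have t1: "teq V {#(a, b)#} (can V db (pure V a b))" by (rule tensor_eq.sym)
  have "can V db (pure V a b \<oplus>\<^bsub>sec H V\<^esub> ev V l) =
      image_mset (\<lambda>z. (mor_comp X E V (fst z) (pure V a b) \<oplus>\<^bsub>sec D V\<^esub> mor_comp X E V (fst z) (ev V l), snd z)) db"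
    unfolding can_def using c2 by (intro image_mset_cong) simp
  then have t2: "teq V (can V db (pure V a b \<oplus>\<^bsub>sec H V\<^esub> ev V l)) (can V db (pure V a b) + can V db (ev V l))"
    using tensor_eq_add_lefts[OF D_module[OF V] N_module[OF V], where l = db and h = snd
        and f = "\<lambda>z. mor_comp X E V (fst z) (pure V a b)" and g = "\<lambda>z. mor_comp X E V (fst z) (ev V l)"]
      coord_mor[OF p] coord_mor[OF e] dual_basis_mem(2)[OF db]
    by (simp add: can_def hom_sheaf_simps(1))
  have "teq V ({#(a, b)#} + l) (can V db (pure V a b) + can V db (ev V l))"
    by (rule tensor_eq_add[OF D_module[OF V] N_module[OF V] t1 add.IH[OF l]])
  from tensor_eq.trans[OF this tensor_eq.sym[OF t2]] show ?case
    by (simp add: ab ev_add_mset[OF V a b])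
qed

text \<open>Two formal sums with equal evaluations share a canonical form. From here on the
  inductively generated relation is replaced by equality of homomorphisms.\<close>

lemma teq_iff_ev: "l \<in> formal V \<Longrightarrow> k \<in> formal V \<Longrightarrow> teq V l k \<longleftrightarrow> ev V l = ev V k"
proof
  assume l: "l \<in> formal V" and k: "k \<in> formal V" and eq: "ev V l = ev V k"
  from tensor_eq.sym[OF teq_can[OF k]] have "teq V (can V db (ev V l)) k" unfolding eq .
  with teq_can[OF l] show "teq V l k" by (rule tensor_eq.trans)
qed (rule teq_ev[OF V])

end

section \<open>Germs of homomorphisms and global sections of the tensor sheaf\<close>

lemma local_basis_small:
  assumes "open_in X U" "x \<in> U"
  shows "\<exists>V db. open_in X V \<and> x \<in> V \<and> V \<subseteq> U \<and> dual_basis X N V db"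
proof -
  obtain T db where T: "open_in X T" "x \<in> T" "dual_basis X N T db"
    using local_basis open_in_subset[OF assms(1)] assms(2) by blast
  then show ?thesis
    using dual_basis_restrict[OF N T(3,1) open_in_Int[OF T(1) assms(1)]] open_in_Int[OF T(1) assms(1)] assms(2)
    by blast
qed

text \<open>The germ of \<phi> in the encoding of \<open>tensor_germ\<close>: representatives are
  again formal sums, but agreement near x is tested on their evaluations.\<close>

definition hom_germ :: "'n pt \<Rightarrow> 'n pt set \<Rightarrow> ('n pt set \<Rightarrow> 'e \<Rightarrow> 't) \<Rightarrow> ('n, 'n pt set \<Rightarrow> 'e \<Rightarrow> 'n pt \<Rightarrow> complex, 't) tensor_germ" where
  "hom_germ x U \<phi> = {(V, k). open_in X V \<and> x \<in> V \<and> k \<in> formal V \<and>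
     (\<exists>W. open_in X W \<and> x \<in> W \<and> W \<subseteq> U \<inter> V \<and> hom_family X E W \<phi> = hom_family X E W (ev V k))}"

lemma hom_germ_mem:
  "(V, k) \<in> hom_germ x U \<phi> \<longleftrightarrow> open_in X V \<and> x \<in> V \<and> k \<in> formal V \<and>
     (\<exists>W. open_in X W \<and> x \<in> W \<and> W \<subseteq> U \<inter> V \<and> hom_family X E W \<phi> = hom_family X E W (ev V k))"
  by (simp add: hom_germ_def)

text \<open>Evaluation turns tensor relations into equalities on any neighbourhood. The converse
  holds over opens with a dual basis, and germs allow shrinking to one.\<close>

lemma tensor_germ_eq:
  assumes U: "open_in X U" and l: "l \<in> formal U"
  shows "tensor_germ X D N x U l = hom_germ x U (ev U l)"
proof -
  have "(\<exists>W. open_in X W \<and> x \<in> W \<and> W \<subseteq> U \<inter> V \<and> teq W (res_tensor D N U W l) (res_tensor D N V W k)) \<longleftrightarrow>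
     (\<exists>W. open_in X W \<and> x \<in> W \<and> W \<subseteq> U \<inter> V \<and> hom_family X E W (ev U l) = hom_family X E W (ev V k))"
    if V: "open_in X V" "x \<in> V" and k: "k \<in> formal V" for V k
  proof
    assume "\<exists>W. open_in X W \<and> x \<in> W \<and> W \<subseteq> U \<inter> V \<and> teq W (res_tensor D N U W l) (res_tensor D N V W k)"
    then obtain W where W: "open_in X W" "x \<in> W" "W \<subseteq> U" "W \<subseteq> V"
      "teq W (res_tensor D N U W l) (res_tensor D N V W k)" by blast
    have "hom_family X E W (ev U l) = hom_family X E W (ev V k)"
      using teq_ev[OF W(1,5)] ev_res[OF l U W(1,3)] ev_res[OF k V(1) W(1,4)] by simp
    with W show "\<exists>W. open_in X W \<and> x \<in> W \<and> W \<subseteq> U \<inter> V \<and> hom_family X E W (ev U l) = hom_family X E W (ev V k)"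
      by blast
  next
    assume "\<exists>W. open_in X W \<and> x \<in> W \<and> W \<subseteq> U \<inter> V \<and> hom_family X E W (ev U l) = hom_family X E W (ev V k)"
    then obtain W' where W': "open_in X W'" "x \<in> W'" "W' \<subseteq> U" "W' \<subseteq> V"
      "hom_family X E W' (ev U l) = hom_family X E W' (ev V k)" by blast
    \<comment> \<open>The given neighbourhood is shrunk until N has a dual basis on it; only then
      does equal evaluation imply equality of the formal sums.\<close>
    obtain W db where W: "open_in X W" "x \<in> W" "W \<subseteq> W'" "dual_basis X N W db"
      using local_basis_small[OF W'(1,2)] by blast
    have sub: "W \<subseteq> U" "W \<subseteq> V" using W(3) W'(3,4) by auto
    have "ev W (res_tensor D N U W l) = ev W (res_tensor D N V W k)"
      unfolding ev_res[OF l U W(1) sub(1)] ev_res[OF k V(1) W(1) sub(2)]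
      by (rule hom_family_eq_mono[OF W'(5) W(3)])
    then have "teq W (res_tensor D N U W l) (res_tensor D N V W k)"
      using teq_iff_ev[OF W(1,4)] formal_res[OF l U W(1) sub(1)] formal_res[OF k V(1) W(1) sub(2)] by simp
    with W(1,2) sub show "\<exists>W. open_in X W \<and> x \<in> W \<and> W \<subseteq> U \<inter> V \<and> teq W (res_tensor D N U W l) (res_tensor D N V W k)"
      by blast
  qed
  then show ?thesis unfolding tensor_germ_def hom_germ_def by (intro Collect_cong) auto
qed

lemma hom_germ_eqI:
  assumes T: "open_in X T" "x \<in> T" "T \<subseteq> U" "T \<subseteq> U'" and eq: "hom_family X E T \<phi> = hom_family X E T \<psi>"
  shows "hom_germ x U \<phi> = hom_germ x U' \<psi>"
proof -
  have sub: "hom_germ x U \<phi> \<subseteq> hom_germ x U' \<psi>"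
    if "T \<subseteq> U" "T \<subseteq> U'" "hom_family X E T \<phi> = hom_family X E T \<psi>" for U U' \<phi> \<psi>
  proof
    fix y assume "y \<in> hom_germ x U \<phi>"
    obtain V k where y: "y = (V, k)" by (rule prod.exhaust)
    from \<open>y \<in> hom_germ x U \<phi>\<close> obtain W where V: "open_in X V" "x \<in> V" "k \<in> formal V"
      and W: "open_in X W" "x \<in> W" "W \<subseteq> U \<inter> V" "hom_family X E W \<phi> = hom_family X E W (ev V k)"
      unfolding y hom_germ_mem by (elim conjE exE)
    have "hom_family X E (W \<inter> T) \<psi> = hom_family X E (W \<inter> T) (ev V k)"
      using hom_family_eq_mono[OF that(3), of "W \<inter> T"] hom_family_eq_mono[OF W(4), of "W \<inter> T"] by simp
    moreover have "open_in X (W \<inter> T)" using W(1) T(1) by (rule open_in_Int)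
    ultimately show "y \<in> hom_germ x U' \<psi>"
      unfolding y hom_germ_mem using V W(2,3) T(2) that(2)
      by (intro conjI exI[of _ "W \<inter> T"]) auto
  qed
  show ?thesis using sub[OF T(3,4) eq] sub[OF T(4,3) eq[symmetric]] by blast
qed

text \<open>The canonical sum over a small neighbourhood is a representative. Existence matters
  because germs are sets and the operations of the tensor sheaf are unions over representatives,
  which would be empty otherwise.\<close>

lemma hom_germ_nonempty:
  assumes U: "open_in X U" "x \<in> U" and \<phi>: "\<phi> \<in> mor X E N U"
  shows "hom_germ x U \<phi> \<noteq> {}"
proof -
  obtain V db where V: "open_in X V" "x \<in> V" "V \<subseteq> U" and db: "dual_basis X N V db"
    using local_basis_small[OF U] by blast
  have r: "hom_family X E V \<phi> \<in> mor X E N V" by (rule mor_restrict[OF E \<phi> V(3)])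
  have "(V, can V db (hom_family X E V \<phi>)) \<in> hom_germ x U \<phi>"
    unfolding hom_germ_mem ev_can[OF V(1) db r] using V can_formal[OF V(1) db r]
    by (intro conjI exI[of _ V]) (auto simp: hom_family_idem)
  then show ?thesis by blast
qed

text \<open>Equal germs share a representative k. Both homomorphisms agree with its evaluation near
  x, hence with each other on the intersection of the two neighbourhoods.\<close>

lemma hom_germ_eqD:
  assumes U: "open_in X U" "x \<in> U" and \<phi>: "\<phi> \<in> mor X E N U"
    and eq: "hom_germ x U \<phi> = hom_germ x U' \<psi>"
  shows "\<exists>T. open_in X T \<and> x \<in> T \<and> T \<subseteq> U \<and> T \<subseteq> U' \<and> hom_family X E T \<phi> = hom_family X E T \<psi>"
proof -
  obtain V k where Vk: "(V, k) \<in> hom_germ x U \<phi>" using hom_germ_nonempty[OF U \<phi>] by (metis ex_in_conv surj_pair)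
  then obtain W where W: "open_in X W" "x \<in> W" "W \<subseteq> U \<inter> V" "hom_family X E W \<phi> = hom_family X E W (ev V k)"
    unfolding hom_germ_mem by (elim conjE exE)
  from Vk obtain W' where W': "open_in X W'" "x \<in> W'" "W' \<subseteq> U' \<inter> V" "hom_family X E W' \<psi> = hom_family X E W' (ev V k)"
    unfolding eq hom_germ_mem by (elim conjE exE)
  have "hom_family X E (W \<inter> W') \<phi> = hom_family X E (W \<inter> W') \<psi>"
    using hom_family_eq_mono[OF W(4), of "W \<inter> W'"] hom_family_eq_mono[OF W'(4), of "W \<inter> W'"] by simp
  then show ?thesis using W(1-3) W'(1-3) open_in_Int[OF W(1) W'(1)] by blast
qed

definition hom_section :: "('n pt set \<Rightarrow> 'e \<Rightarrow> 't) \<Rightarrow> 'n pt \<Rightarrow> ('n, 'n pt set \<Rightarrow> 'e \<Rightarrow> 'n pt \<Rightarrow> complex, 't) tensor_germ" where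
  "hom_section \<phi> = (\<lambda>x\<in>X. hom_germ x X \<phi>)"

abbreviation "T0 \<equiv> H0 X (tensor_sheaf X D N)"

lemma T0_carrier: "carrier T0 = {\<sigma> \<in> extensional X. \<forall>x\<in>X. \<exists>V l. open_in X V \<and> x \<in> V \<and> V \<subseteq> X \<and>
    l \<in> formal V \<and> (\<forall>y\<in>V. \<sigma> y = tensor_germ X D N y V l)}"
  by (simp add: H0_def tensor_sheaf_def)

lemma hom_section_closed:
  assumes \<phi>: "\<phi> \<in> mor X E N X"
  shows "hom_section \<phi> \<in> carrier T0"
  unfolding T0_carrier
proof (intro CollectI conjI ballI)
  fix x assume x: "x \<in> X"
  obtain V db where V: "open_in X V" "x \<in> V" "V \<subseteq> X" and db: "dual_basis X N V db"
    using local_basis_small[OF X_open x] by blast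
  have r: "hom_family X E V \<phi> \<in> mor X E N V" by (rule mor_restrict[OF E \<phi> V(3)])
  let ?l = "can V db (hom_family X E V \<phi>)"
  have "hom_section \<phi> y = tensor_germ X D N y V ?l" if y: "y \<in> V" for y
  proof -
    have "hom_germ y X \<phi> = hom_germ y V (ev V ?l)"
      unfolding ev_can[OF V(1) db r] using V y by (intro hom_germ_eqI[of V]) (auto simp: hom_family_idem)
    then show ?thesis
      using y V(3) tensor_germ_eq[OF V(1) can_formal[OF V(1) db r]] by (auto simp: hom_section_def)
  qed
  with V can_formal[OF V(1) db r] show "\<exists>V l. open_in X V \<and> x \<in> V \<and> V \<subseteq> X \<and>
    l \<in> formal V \<and> (\<forall>y\<in>V. hom_section \<phi> y = tensor_germ X D N y V l)" by blast
qed (simp add: hom_section_def)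

text \<open>Equal germs at every point mean local equality around every point, and homomorphisms
  into a sheaf are determined locally.\<close>

lemma hom_section_inj: "inj_on hom_section (mor X E N X)"
proof (rule inj_onI)
  fix \<phi> \<psi> assume \<phi>: "\<phi> \<in> mor X E N X" and \<psi>: "\<psi> \<in> mor X E N X" and eq: "hom_section \<phi> = hom_section \<psi>"
  show "\<phi> = \<psi>"
  proof (rule mor_eq_local[OF E N_sheaf \<phi> \<psi>])
    fix x assume x: "x \<in> X"
    have "hom_germ x X \<phi> = hom_germ x X \<psi>"
      using fun_cong[OF eq, of x] x by (simp add: hom_section_def)
    from hom_germ_eqD[OF X_open x \<phi> this] obtain T where T: "open_in X T" "x \<in> T"
      "hom_family X E T \<phi> = hom_family X E T \<psi>" by blast
    then show "\<exists>V. open_in X V \<and> x \<in> V \<and>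
      (\<forall>W s. open_in X W \<and> W \<subseteq> V \<and> W \<subseteq> X \<and> s \<in> carrier (sec E W) \<longrightarrow> \<phi> W s = \<psi> W s)"
      using hom_family_eq_apply[OF T(3)] by blast
  qed
qed

text \<open>The formal sums representing \<sigma> locally evaluate to homomorphisms with the germs
  of \<sigma>. As germs determine homomorphisms locally, these agree on overlaps and glue.\<close>

lemma hom_section_surj:
  assumes \<sigma>: "\<sigma> \<in> carrier T0"
  shows "\<exists>\<phi>\<in>mor X E N X. \<sigma> = hom_section \<phi>"
proof -
  define P where "P V l \<longleftrightarrow> l \<in> formal V \<and> (\<forall>y\<in>V. \<sigma> y = tensor_germ X D N y V l)" for V l
  define \<D> where "\<D> = {V. open_in X V \<and> (\<exists>l. P V l)}"
  \<comment> \<open>One representative is chosen for each open. The choices for V and W are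
    unrelated as formal sums; only their evaluations are compatible.\<close>
  define L where "L V = (SOME l. P V l)" for V
  have op: "open_in X V" if "V \<in> \<D>" for V using that by (simp add: \<D>_def)
  have PL: "P V (L V)" if "V \<in> \<D>" for V
    using that someI_ex[of "P V"] by (auto simp: \<D>_def L_def)
  have L: "L V \<in> formal V" if "V \<in> \<D>" for V using PL[OF that] by (simp add: P_def)
  have germ: "\<sigma> y = hom_germ y V (ev V (L V))" if "V \<in> \<D>" "y \<in> V" for V y
    using PL[OF that(1)] that(2) tensor_germ_eq[OF op[OF that(1)] L[OF that(1)]] by (simp add: P_def)
  \<comment> \<open>Both evaluations have the germ \<sigma>(y) at every y in W, so they agree near
    y, and therefore on W.\<close>
  have cons: "hom_family X E W (ev V (L V)) = ev W (L W)" if VW: "V \<in> \<D>" "W \<in> \<D>" "W \<subseteq> V" for V W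
  proof (rule mor_eq_local[OF E N_sheaf mor_restrict[OF E ev_mor[OF op[OF VW(1)]] VW(3)] ev_mor[OF op[OF VW(2)]]])
    fix y assume y: "y \<in> W"
    then have yV: "y \<in> V" using VW(3) by auto
    have "hom_germ y V (ev V (L V)) = hom_germ y W (ev W (L W))"
      using germ[OF VW(1) yV] germ[OF VW(2) y] by simp
    from hom_germ_eqD[OF op[OF VW(1)] yV ev_mor[OF op[OF VW(1)]] this] obtain T where T: "open_in X T" "y \<in> T"
      "hom_family X E T (ev V (L V)) = hom_family X E T (ev W (L W))" by blast
    then show "\<exists>T. open_in X T \<and> y \<in> T \<and> (\<forall>S s. open_in X S \<and> S \<subseteq> T \<and> S \<subseteq> W \<and> s \<in> carrier (sec E S) \<longrightarrow>
        hom_family X E W (ev V (L V)) S s = ev W (L W) S s)"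
      using hom_family_eq_apply[OF T(3)] by auto
  qed
  \<comment> \<open>Restricting a representative keeps the germs, so the family contains every
    smaller open, as gluing of morphisms requires.\<close>
  have down: "W \<in> \<D>" if VW: "V \<in> \<D>" "open_in X W" "W \<subseteq> V" for V W
  proof -
    let ?l = "res_tensor D N V W (L V)"
    have f: "?l \<in> formal W" by (rule formal_res[OF L[OF VW(1)] op[OF VW(1)] VW(2,3)])
    have "\<sigma> y = tensor_germ X D N y W ?l" if y: "y \<in> W" for y
    proof -
      have "\<sigma> y = hom_germ y V (ev V (L V))" using germ[OF VW(1)] VW(3) y by auto
      also have "\<dots> = hom_germ y W (ev W ?l)"
        unfolding ev_res[OF L[OF VW(1)] op[OF VW(1)] VW(2,3)]
        using VW y by (intro hom_germ_eqI[of W]) (auto simp: hom_family_idem)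
      finally show ?thesis using tensor_germ_eq[OF VW(2) f] by simp
    qed
    with f VW(2) show ?thesis by (auto simp: \<D>_def P_def)
  qed
  have cov: "X \<subseteq> \<Union>\<D>"
  proof
    fix x assume "x \<in> X"
    then obtain V l where "open_in X V" "x \<in> V" "l \<in> formal V" "\<forall>y\<in>V. \<sigma> y = tensor_germ X D N y V l"
      using \<sigma> unfolding T0_carrier by blast
    then show "x \<in> \<Union>\<D>" unfolding \<D>_def P_def by blast
  qed
  have "\<exists>\<phi>\<in>mor X E N X. \<forall>V\<in>\<D>. V \<subseteq> X \<longrightarrow> (\<forall>s\<in>carrier (sec E V). \<phi> V s = ev V (L V) V s)"
  proof (rule mor_glue[OF E N_sheaf op _ cov])
    fix V assume V: "V \<in> \<D>"
    note oV = op[OF V]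
    note m = ev_mor[OF oV, of "L V"]
    show "W \<in> \<D>" if "open_in X W" "W \<subseteq> V" for W by (rule down[OF V that])
    show "ev V (L V) V s \<in> carrier (sec N V)" if "s \<in> carrier (sec E V)" for s
      by (rule mor_closed[OF m oV subset_refl that])
    show "ev V (L V) V (s \<oplus>\<^bsub>sec E V\<^esub> t) = ev V (L V) V s \<oplus>\<^bsub>sec N V\<^esub> ev V (L V) V t"
      if "s \<in> carrier (sec E V)" "t \<in> carrier (sec E V)" for s t
      by (rule mor_add[OF m oV subset_refl that])
    show "ev V (L V) V (f \<odot>\<^bsub>sec E V\<^esub> s) = f \<odot>\<^bsub>sec N V\<^esub> ev V (L V) V s"
      if "f \<in> carrier (reg_ring X V)" "s \<in> carrier (sec E V)" for f s
      by (rule mor_smult[OF m oV subset_refl that])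
    show "res N V W (ev V (L V) V s) = ev W (L W) W (res E V W s)"
      if W: "W \<in> \<D>" "W \<subseteq> V" and s: "s \<in> carrier (sec E V)" for W s
    proof -
      have "res N V W (ev V (L V) V s) = ev V (L V) W (res E V W s)"
        by (rule mor_res[OF m oV op[OF W(1)] W(2) subset_refl s])
      also have "\<dots> = hom_family X E W (ev V (L V)) W (res E V W s)"
        using op[OF W(1)] res_closed[OF E oV op[OF W(1)] W(2) s] by simp
      finally show ?thesis unfolding cons[OF V W] .
    qed
  qed
  then obtain \<phi> where \<phi>: "\<phi> \<in> mor X E N X"
    and \<phi>_eq: "\<forall>V\<in>\<D>. V \<subseteq> X \<longrightarrow> (\<forall>s\<in>carrier (sec E V). \<phi> V s = ev V (L V) V s)"
    by (rule bexE)
  have "\<sigma> = hom_section \<phi>"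
  proof (rule extensionalityI[of _ X])
    show "\<sigma> \<in> extensional X" using \<sigma> unfolding T0_carrier by simp
    show "hom_section \<phi> \<in> extensional X" by (simp add: hom_section_def)
    fix y assume y: "y \<in> X"
    then obtain V where V: "V \<in> \<D>" "y \<in> V" using cov by blast
    note oV = op[OF V(1)]
    have "hom_family X E V \<phi> = hom_family X E V (ev V (L V))"
    proof (rule hom_family_cong)
      fix W s assume W: "open_in X W" "W \<subseteq> V" and s: "s \<in> carrier (sec E W)"
      have WD: "W \<in> \<D>" by (rule down[OF V(1) W])
      have "\<phi> W s = ev W (L W) W s" using \<phi>_eq WD s open_in_subset[OF W(1)] by simp
      also have "\<dots> = ev V (L V) W s" using cons[OF V(1) WD W(2), symmetric] W s by simp
      finally show "\<phi> W s = ev V (L V) W s" .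
    qed
    then have "hom_germ y X \<phi> = hom_germ y V (ev V (L V))"
      using oV V(2) open_in_subset[OF oV] by (intro hom_germ_eqI[of V]) auto
    then show "\<sigma> y = hom_section \<phi> y" using germ[OF V] y by (simp add: hom_section_def)
  qed
  with \<phi> show ?thesis by blast
qed

lemma hom_section_bij: "bij_betw hom_section (mor X E N X) (carrier T0)"
  using hom_section_inj hom_section_closed hom_section_surj by (auto simp: bij_betw_def)

section \<open>Compatibility of the correspondence with the module structure\<close>

lemma hom_germ_witness:
  assumes "(V, l) \<in> hom_germ x X \<phi>"
  obtains W where "open_in X V" "x \<in> V" "l \<in> formal V" "open_in X W" "x \<in> W" "W \<subseteq> V"
    "hom_family X E W \<phi> = hom_family X E W (ev V l)"
proof -
  from assms obtain W where "open_in X V" "x \<in> V" "l \<in> formal V" "open_in X W" "x \<in> W" "W \<subseteq> X \<inter> V"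
    "hom_family X E W \<phi> = hom_family X E W (ev V l)"
    unfolding hom_germ_mem by (elim conjE exE)
  then show thesis using that by simp
qed

text \<open>Addition in the tensor sheaf is a union over all pairs of representatives. Every pair
  yields the germ of \<phi> + \<psi>, because evaluation is additive and commutes with restriction,
  and at least one pair exists.\<close>

lemma hom_section_add:
  assumes \<phi>: "\<phi> \<in> mor X E N X" and \<psi>: "\<psi> \<in> mor X E N X"
  shows "hom_section (\<phi> \<oplus>\<^bsub>sec H X\<^esub> \<psi>) = hom_section \<phi> \<oplus>\<^bsub>T0\<^esub> hom_section \<psi>"
proof -
  have "(\<Union>(V, l)\<in>hom_germ x X \<phi>. \<Union>(W, k)\<in>hom_germ x X \<psi>.
      tensor_germ X D N x (V \<inter> W) (res_tensor D N V (V \<inter> W) l + res_tensor D N W (V \<inter> W) k)) =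
      hom_germ x X (\<phi> \<oplus>\<^bsub>sec H X\<^esub> \<psi>)" (is "?L = ?R") if x: "x \<in> X" for x
  proof -
    have eq: "tensor_germ X D N x (V \<inter> W) (res_tensor D N V (V \<inter> W) l + res_tensor D N W (V \<inter> W) k) = ?R"
      if l: "(V, l) \<in> hom_germ x X \<phi>" and k: "(W, k) \<in> hom_germ x X \<psi>" for V W l k
    proof -
      obtain S where V: "open_in X V" "x \<in> V" "l \<in> formal V" and S: "open_in X S" "x \<in> S" "S \<subseteq> V"
        and Se: "hom_family X E S \<phi> = hom_family X E S (ev V l)"
        by (rule hom_germ_witness[OF l])
      obtain S' where W: "open_in X W" "x \<in> W" "k \<in> formal W" and S': "open_in X S'" "x \<in> S'" "S' \<subseteq> W"
        and Se': "hom_family X E S' \<psi> = hom_family X E S' (ev W k)"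
        by (rule hom_germ_witness[OF k])
      let ?I = "V \<inter> W" and ?T = "S \<inter> S'"
      have I: "open_in X ?I" using V W open_in_Int by blast
      have T: "open_in X ?T" "?T \<subseteq> ?I" "?T \<subseteq> X" using S S' open_in_Int open_in_subset by blast+
      let ?l = "res_tensor D N V ?I l" and ?k = "res_tensor D N W ?I k"
      have f: "?l \<in> formal ?I" "?k \<in> formal ?I"
        using formal_res[OF V(3,1) I] formal_res[OF W(3,1) I] by auto
      then have flk: "?l + ?k \<in> formal ?I" by (auto simp: formal_tensors_def)
      have "hom_family X E ?T (ev ?I (?l + ?k)) = hom_family X E ?T (\<phi> \<oplus>\<^bsub>sec H X\<^esub> \<psi>)"
        unfolding ev_union[OF I] hom_sheaf_simps(3) ev_res[OF V(3,1) I Int_lower1] ev_res[OF W(3,1) I Int_lower2]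
      proof (rule hom_family_cong)
        fix Q e assume Q: "open_in X Q" "Q \<subseteq> ?T" and e: "e \<in> carrier (sec E Q)"
        have sub: "Q \<subseteq> ?I" "Q \<subseteq> X" "Q \<subseteq> S" "Q \<subseteq> S'" using Q T by auto
        show "hom_family X E ?I (\<lambda>V' s. hom_family X E ?I (ev V l) V' s \<oplus>\<^bsub>sec N V'\<^esub> hom_family X E ?I (ev W k) V' s) Q e =
          hom_family X E X (\<lambda>V s. \<phi> V s \<oplus>\<^bsub>sec N V\<^esub> \<psi> V s) Q e"
          using Q e sub hom_family_eq_apply[OF Se Q(1) sub(3) e] hom_family_eq_apply[OF Se' Q(1) sub(4) e]
          by simp
      qed
      then have "hom_germ x ?I (ev ?I (?l + ?k)) = ?R"
        using T S(2) S'(2) by (intro hom_germ_eqI[of ?T]) auto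
      then show ?thesis using tensor_germ_eq[OF I flk] by simp
    qed
    \<comment> \<open>One pair of representatives keeps the union from being empty.\<close>
    obtain a b where a: "a \<in> hom_germ x X \<phi>" and b: "b \<in> hom_germ x X \<psi>"
      using hom_germ_nonempty[OF X_open x] \<phi> \<psi> by blast
    show ?thesis
    proof
      show "?L \<subseteq> ?R" using eq by blast
      show "?R \<subseteq> ?L" using eq[of "fst a" "snd a" "fst b" "snd b"] a b by fastforce
    qed
  qed
  note germ = this
  have "hom_section \<phi> \<oplus>\<^bsub>T0\<^esub> hom_section \<psi> = (\<lambda>x\<in>X. \<Union>(V, l)\<in>hom_section \<phi> x. \<Union>(W, k)\<in>hom_section \<psi> x.
      tensor_germ X D N x (V \<inter> W) (res_tensor D N V (V \<inter> W) l + res_tensor D N W (V \<inter> W) k))"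
    by (simp add: H0_def tensor_sheaf_def)
  also have "\<dots> = hom_section (\<phi> \<oplus>\<^bsub>sec H X\<^esub> \<psi>)"
    unfolding hom_section_def[of "\<phi> \<oplus>\<^bsub>sec H X\<^esub> \<psi>"]
  proof (rule restrict_ext)
    fix x assume x: "x \<in> X"
    show "(\<Union>(V, l)\<in>hom_section \<phi> x. \<Union>(W, k)\<in>hom_section \<psi> x.
      tensor_germ X D N x (V \<inter> W) (res_tensor D N V (V \<inter> W) l + res_tensor D N W (V \<inter> W) k)) =
      hom_germ x X (\<phi> \<oplus>\<^bsub>sec H X\<^esub> \<psi>)"
      unfolding hom_section_def restrict_apply'[OF x] by (rule germ[OF x])
  qed
  finally show ?thesis by simp
qed

text \<open>As for sums: the scalar acts on left factors, evaluation carries it to the homomorphism,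
  and every representative gives the same germ.\<close>

lemma hom_section_smult:
  assumes \<phi>: "\<phi> \<in> mor X E N X" and f: "f \<in> carrier (reg_ring X X)"
  shows "hom_section (f \<odot>\<^bsub>sec H X\<^esub> \<phi>) = f \<odot>\<^bsub>sec (tensor_sheaf X D N) X\<^esub> hom_section \<phi>"
proof -
  have "(\<Union>(V, l)\<in>hom_germ x X \<phi>. tensor_germ X D N x (X \<inter> V)
      (image_mset (\<lambda>(a, b). (restrict f (X \<inter> V) \<odot>\<^bsub>sec D (X \<inter> V)\<^esub> a, b)) (res_tensor D N V (X \<inter> V) l))) =
      hom_germ x X (f \<odot>\<^bsub>sec H X\<^esub> \<phi>)" (is "?L = ?R") if x: "x \<in> X" for x
  proof -
    have eq: "tensor_germ X D N x (X \<inter> V) (image_mset (\<lambda>(a, b). (restrict f (X \<inter> V) \<odot>\<^bsub>sec D (X \<inter> V)\<^esub> a, b))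
        (res_tensor D N V (X \<inter> V) l)) = ?R" if Vl: "(V, l) \<in> hom_germ x X \<phi>" for V l
    proof -
      obtain S where V: "open_in X V" "x \<in> V" "l \<in> formal V" and S: "open_in X S" "x \<in> S" "S \<subseteq> V"
        and Se: "hom_family X E S \<phi> = hom_family X E S (ev V l)"
        by (rule hom_germ_witness[OF Vl])
      \<comment> \<open>Scalar multiplication in the tensor sheaf restricts to
        \<open>X \<inter> V\<close>, which is V itself.\<close>
      have VX: "V \<subseteq> X" and XV: "X \<inter> V = V" using open_in_subset[OF V(1)] by auto
      have fV: "restrict f V \<in> carrier (reg_ring X V)" by (rule reg_restrict[OF f V(1) VX])
      let ?k = "res_tensor D N V V l"
      let ?l = "image_mset (\<lambda>(a, b). (restrict f V \<odot>\<^bsub>sec D V\<^esub> a, b)) ?k"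
      have k: "?k \<in> formal V" by (rule formal_res[OF V(3,1,1)]) simp
      interpret D: Module.module "reg_ring X V" "sec D V" by (rule D_module[OF V(1)])
      interpret H: Module.module "reg_ring X V" "sec H V" by (rule H_module[OF V(1)])
      have z: "fst z \<in> carrier (sec D V)" "fst z \<in> mor X E (struct_sheaf X) V" "snd z \<in> carrier (sec N V)" if "z \<in># ?k" for z
        using k that unfolding formal_iff hom_sheaf_simps(1) by blast+
      have pz: "pure V (fst z) (snd z) \<in> carrier (sec H V)" if "z \<in># ?k" for z
        using pure_mor[OF V(1) z(2,3)[OF that]] by (simp add: hom_sheaf_simps(1))
      have lf: "?l \<in> formal V"
        using z(1,3) fV D.smult_closed by (fastforce simp: formal_tensors_def)
      have "ev V ?l = msum (sec H V) (\<lambda>z. pure V (restrict f V \<odot>\<^bsub>sec D V\<^esub> fst z) (snd z)) ?k"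
        unfolding ev_def H.M.msum_image by (simp add: split_beta)
      also have "\<dots> = msum (sec H V) (\<lambda>z. restrict f V \<odot>\<^bsub>sec H V\<^esub> pure V (fst z) (snd z)) ?k"
        using z by (intro H.M.msum_cong pure_smult_left[OF V(1) fV])
      also have "\<dots> = restrict f V \<odot>\<^bsub>sec H V\<^esub> ev V ?k"
        unfolding ev_def
        by (rule H.M.msum_hom[OF H.M.abelian_monoid_axioms pz H.smult_closed[OF fV] H.smult_r_distr[OF fV]
              H.smult_r_null[OF fV], symmetric])
      \<comment> \<open>Restricting a formal sum from V to V does not change its evaluation, which
        is already in normal form over V.\<close>
      finally have ev_l: "ev V ?l = restrict f V \<odot>\<^bsub>sec H V\<^esub> ev V l"
        using ev_res[OF V(3,1,1) subset_refl] mor_family[OF ev_mor[OF V(1)]] by simp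
      have "hom_family X E S (ev V ?l) = hom_family X E S (f \<odot>\<^bsub>sec H X\<^esub> \<phi>)"
        unfolding ev_l unfolding hom_sheaf_simps(4)
      proof (rule hom_family_cong)
        fix Q e assume Q: "open_in X Q" "Q \<subseteq> S" and e: "e \<in> carrier (sec E Q)"
        have sub: "Q \<subseteq> V" "Q \<subseteq> X" using Q S VX by auto
        show "hom_family X E V (\<lambda>V' s. restrict (restrict f V) V' \<odot>\<^bsub>sec N V'\<^esub> ev V l V' s) Q e =
            hom_family X E X (\<lambda>V s. restrict f V \<odot>\<^bsub>sec N V\<^esub> \<phi> V s) Q e"
          using Q e sub hom_family_eq_apply[OF Se Q e] by (simp add: Int_absorb1)
      qed
      then have "hom_germ x V (ev V ?l) = ?R"
        using S VX by (intro hom_germ_eqI[of S]) auto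
      then show ?thesis using tensor_germ_eq[OF V(1) lf] by (simp add: XV)
    qed
    obtain a where a: "a \<in> hom_germ x X \<phi>" using hom_germ_nonempty[OF X_open x \<phi>] by blast
    show ?thesis
    proof
      show "?L \<subseteq> ?R" using eq by blast
      show "?R \<subseteq> ?L" using eq[of "fst a" "snd a"] a by fastforce
    qed
  qed
  note germ = this
  have "f \<odot>\<^bsub>sec (tensor_sheaf X D N) X\<^esub> hom_section \<phi> = (\<lambda>x\<in>X. \<Union>(V, l)\<in>hom_section \<phi> x.
      tensor_germ X D N x (X \<inter> V) (image_mset (\<lambda>(a, b). (restrict f (X \<inter> V) \<odot>\<^bsub>sec D (X \<inter> V)\<^esub> a, b))
        (res_tensor D N V (X \<inter> V) l)))"
    by (simp add: tensor_sheaf_def)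
  also have "\<dots> = hom_section (f \<odot>\<^bsub>sec H X\<^esub> \<phi>)"
    unfolding hom_section_def[of "f \<odot>\<^bsub>sec H X\<^esub> \<phi>"]
  proof (rule restrict_ext)
    fix x assume x: "x \<in> X"
    show "(\<Union>(V, l)\<in>hom_section \<phi> x. tensor_germ X D N x (X \<inter> V)
      (image_mset (\<lambda>(a, b). (restrict f (X \<inter> V) \<odot>\<^bsub>sec D (X \<inter> V)\<^esub> a, b)) (res_tensor D N V (X \<inter> V) l))) =
      hom_germ x X (f \<odot>\<^bsub>sec H X\<^esub> \<phi>)"
      unfolding hom_section_def restrict_apply'[OF x] by (rule germ[OF x])
  qed
  finally show ?thesis by simp
qed

end


section \<open>Naturality of the tensor product\<close>

text \<open>On a pure tensor, p(a(e) b) = a(e) p(b): applying p to right factors is composition with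
  p after evaluation. Additivity gives this for formal sums, and a representative exists at each
  point, so the map on sections is composition with p.\<close>

lemma H0_tensor_map_hom_section:
  fixes E :: "('n::finite pt, 'e) msheaf" and N :: "('n pt, 't) msheaf" and N' :: "('n pt, 'u) msheaf"
  assumes T: "dual_tensor X E N" and T': "dual_tensor X E N'"
    and p: "p \<in> mor X N N' X" and \<phi>: "\<phi> \<in> mor X E N X"
  shows "H0_tensor_map X (dual_sheaf X E) N N' p (dual_tensor.hom_section X E N \<phi>) =
    dual_tensor.hom_section X E N' (mor_comp X E X p \<phi>)"
proof -
  interpret T: dual_tensor X E N by (rule T)
  interpret T': dual_tensor X E N' by (rule T')
  let ?D = "dual_sheaf X E" and ?p\<phi> = "mor_comp X E X p \<phi>"
  have germ: "(\<Union>(V, l)\<in>T.hom_germ x X \<phi>. tensor_germ X ?D N' x V (image_mset (\<lambda>(a, b). (a, p V b)) l)) =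
      T'.hom_germ x X ?p\<phi>" (is "?L = ?R") if x: "x \<in> X" for x
  proof -
    have eq: "tensor_germ X ?D N' x V (image_mset (\<lambda>(a, b). (a, p V b)) l) = ?R"
      if Vl: "(V, l) \<in> T.hom_germ x X \<phi>" for V l
    proof -
      obtain S where V: "open_in X V" "x \<in> V" "l \<in> T.formal V" and S: "open_in X S" "x \<in> S" "S \<subseteq> V"
        and Se: "hom_family X E S \<phi> = hom_family X E S (T.ev V l)"
        by (rule T.hom_germ_witness[OF Vl])
      have VX: "V \<subseteq> X" by (rule open_in_subset[OF V(1)])
      let ?l = "image_mset (\<lambda>(a, b). (a, p V b)) l"
      have z: "fst z \<in> mor X E (struct_sheaf X) V" "snd z \<in> carrier (sec N V)" if "z \<in># l" for z
        using V(3) that unfolding T.formal_iff by blast+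
      have pz: "p V (snd z) \<in> carrier (sec N' V)" if "z \<in># l" for z
        by (rule mor_closed[OF p V(1) VX z(2)[OF that]])
      have lf: "?l \<in> T'.formal V"
        unfolding T'.formal_iff using z(1) pz by (fastforce simp: split_beta)
      interpret H: abelian_group "sec (hom_sheaf X E N) V" by (rule presheaf_group[OF T.H V(1)])
      interpret H': abelian_group "sec (hom_sheaf X E N') V" by (rule presheaf_group[OF T'.H V(1)])
      have "T'.ev V ?l Q e = p Q (T.ev V l Q e)" if Q: "open_in X Q" "Q \<subseteq> V" and e: "e \<in> carrier (sec E Q)" for Q e
      proof -
        interpret NQ: abelian_group "sec N Q" by (rule presheaf_group[OF T.N Q(1)])
        interpret NQ': abelian_group "sec N' Q" by (rule presheaf_group[OF T'.N Q(1)])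
        have QX: "Q \<subseteq> X" using Q VX by auto
        have pur: "T.pure V (fst z) (snd z) \<in> carrier (sec (hom_sheaf X E N) V)" if "z \<in># l" for z
          using T.pure_mor[OF V(1) z[OF that]] by (simp add: hom_sheaf_simps(1))
        have pur': "T'.pure V (fst z) (p V (snd z)) \<in> carrier (sec (hom_sheaf X E N') V)" if "z \<in># l" for z
          using T'.pure_mor[OF V(1) z(1)[OF that] pz[OF that]] by (simp add: hom_sheaf_simps(1))
        have "T'.ev V ?l Q e = msum (sec (hom_sheaf X E N') V) (\<lambda>z. T'.pure V (fst z) (p V (snd z))) l Q e"
          unfolding T'.ev_def H'.msum_image by (simp add: split_beta)
        also have "\<dots> = msum (sec N' Q) (\<lambda>z. T'.pure V (fst z) (p V (snd z)) Q e) l"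
          by (rule H'.msum_hom[where h = "\<lambda>\<psi>. \<psi> Q e", OF NQ'.abelian_monoid_axioms pur'])
            (use Q e in \<open>auto simp: hom_sheaf_simps mor_closed\<close>)
        \<comment> \<open>Termwise the two sides differ by linearity of p over the regular function
          a(e) and by its compatibility with restriction of b.\<close>
        also have "\<dots> = msum (sec N' Q) (\<lambda>z. p Q (T.pure V (fst z) (snd z) Q e)) l"
        proof (rule NQ'.msum_cong)
          fix y assume y: "y \<in># l"
          have a: "fst y Q e \<in> carrier (reg_ring X Q)" using mor_closed[OF z(1)[OF y] Q e] by simp
          have b: "res N V Q (snd y) \<in> carrier (sec N Q)" by (rule res_closed[OF T.N V(1) Q z(2)[OF y]])
          show "T'.pure V (fst y) (p V (snd y)) Q e = p Q (T.pure V (fst y) (snd y) Q e)"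
            using Q e mor_smult[OF p Q(1) QX a b] mor_res[OF p V(1) Q VX z(2)[OF y]]
            by (simp add: T.pure_def T'.pure_def)
        qed
        also have "\<dots> = p Q (msum (sec N Q) (\<lambda>z. T.pure V (fst z) (snd z) Q e) l)"
          using mor_closed[OF T.pure_mor[OF V(1) z] Q e]
          by (intro mor_msum[OF T.N T'.N p Q(1) QX, symmetric])
        also have "msum (sec N Q) (\<lambda>z. T.pure V (fst z) (snd z) Q e) l = T.ev V l Q e"
          unfolding T.ev_def
          by (rule H.msum_hom[where h = "\<lambda>\<psi>. \<psi> Q e", OF NQ.abelian_monoid_axioms pur, symmetric])
            (use Q e in \<open>auto simp: hom_sheaf_simps mor_closed\<close>)
        finally show ?thesis .
      qed
      then have "hom_family X E S (T'.ev V ?l) = hom_family X E S ?p\<phi>"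
        using S(3) VX hom_family_eq_apply[OF Se]
        by (intro hom_family_cong) (simp add: order_trans[of _ S V] order_trans[of _ V X])
      then have "T'.hom_germ x V (T'.ev V ?l) = ?R"
        using S VX by (intro T'.hom_germ_eqI[of S]) auto
      then show ?thesis using T'.tensor_germ_eq[OF V(1) lf] by simp
    qed
    obtain a where a: "a \<in> T.hom_germ x X \<phi>" using T.hom_germ_nonempty[OF T.X_open x \<phi>] by blast
    show ?thesis
    proof
      show "?L \<subseteq> ?R" using eq by blast
      show "?R \<subseteq> ?L" using eq[of "fst a" "snd a"] a by fastforce
    qed
  qed
  show ?thesis
    unfolding H0_tensor_map_def T'.hom_section_def
  proof (rule restrict_ext)
    fix x assume x: "x \<in> X"
    show "(\<Union>(V, l)\<in>T.hom_section \<phi> x. tensor_germ X ?D N' x V (image_mset (\<lambda>(a, b). (a, p V b)) l)) =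
      T'.hom_germ x X ?p\<phi>"
      unfolding T.hom_section_def restrict_apply'[OF x] by (rule germ[OF x])
  qed
qed

text \<open>Under the identifications of H^0 with Hom(E, E) and Hom(E, F) the map is composition
  with p, so linearity and bijectivity are inherited from there.\<close>

lemma (in universal_extension) tensor_map_iso:
  assumes TE: "dual_tensor X E E" and TF: "dual_tensor X E F"
  shows "linear_iso (H0 X (tensor_sheaf X (dual_sheaf X E) E)) (H0 X (tensor_sheaf X (dual_sheaf X E) F))
    (H0_tensor_map X (dual_sheaf X E) E F p)"
proof -
  interpret TE: dual_tensor X E E by (rule TE)
  interpret TF: dual_tensor X E F by (rule TF)
  let ?h = "H0_tensor_map X (dual_sheaf X E) E F p" and ?p = "mor_comp X E X p"
  have nat: "?h (TE.hom_section \<phi>) = TF.hom_section (?p \<phi>)" if "\<phi> \<in> mor X E E X" for \<phi>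
    by (rule H0_tensor_map_hom_section[OF TE TF p that])
  have p_mor: "?p \<phi> \<in> mor X E F X" if "\<phi> \<in> mor X E E X" for \<phi>
    by (rule mor_comp_mor[OF E' that p subset_refl subset_refl])
  have HE: "carrier (sec (hom_sheaf X E E) X) = mor X E E X" by (rule hom_sheaf_simps(1))
  have add_mor: "\<phi> \<oplus>\<^bsub>sec (hom_sheaf X E E) X\<^esub> \<psi> \<in> mor X E E X"
    if "\<phi> \<in> mor X E E X" "\<psi> \<in> mor X E E X" for \<phi> \<psi>
    using abelian_groupE(1)[OF presheaf_group[OF hom_presheaf[OF E' E'] X_open]] that unfolding HE by blast
  have smult_mor: "f \<odot>\<^bsub>sec (hom_sheaf X E E) X\<^esub> \<phi> \<in> mor X E E X"
    if "f \<in> carrier (reg_ring X X)" "\<phi> \<in> mor X E E X" for f \<phi>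
    using Module.module.smult_closed[OF presheaf_module[OF hom_presheaf[OF E' E'] X_open]] that unfolding HE by blast
  have p_add: "?p (\<phi> \<oplus>\<^bsub>sec (hom_sheaf X E E) X\<^esub> \<psi>) = ?p \<phi> \<oplus>\<^bsub>sec (hom_sheaf X E F) X\<^esub> ?p \<psi>"
    if \<phi>: "\<phi> \<in> mor X E E X" and \<psi>: "\<psi> \<in> mor X E E X" for \<phi> \<psi>
    unfolding mor_comp_def hom_sheaf_simps
    using mor_add[OF p] mor_closed[OF \<phi>] mor_closed[OF \<psi>] by (intro hom_family_cong) simp
  have p_smult: "?p (f \<odot>\<^bsub>sec (hom_sheaf X E E) X\<^esub> \<phi>) = f \<odot>\<^bsub>sec (hom_sheaf X E F) X\<^esub> ?p \<phi>"
    if f: "f \<in> carrier (reg_ring X X)" and \<phi>: "\<phi> \<in> mor X E E X" for f \<phi>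
    unfolding mor_comp_def hom_sheaf_simps
    using mor_smult[OF p] reg_restrict[OF f] mor_closed[OF \<phi>] by (intro hom_family_cong) simp
  have "?h \<in> module_hom Cfield TE.T0 TF.T0"
    unfolding module_hom_def
  proof (intro CollectI conjI allI impI)
    show "?h \<in> carrier TE.T0 \<rightarrow> carrier TF.T0"
    proof
      fix \<sigma> assume "\<sigma> \<in> carrier TE.T0"
      then obtain \<phi> where "\<phi> \<in> mor X E E X" "\<sigma> = TE.hom_section \<phi>" using TE.hom_section_surj by blast
      then show "?h \<sigma> \<in> carrier TF.T0" using nat p_mor TF.hom_section_closed by simp
    qed
  next
    fix \<sigma> \<tau> assume "\<sigma> \<in> carrier TE.T0 \<and> \<tau> \<in> carrier TE.T0"
    then obtain \<phi> \<psi> where *: "\<phi> \<in> mor X E E X" "\<psi> \<in> mor X E E X" "\<sigma> = TE.hom_section \<phi>" "\<tau> = TE.hom_section \<psi>"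
      using TE.hom_section_surj by metis
    have "?h (\<sigma> \<oplus>\<^bsub>TE.T0\<^esub> \<tau>) = ?h (TE.hom_section (\<phi> \<oplus>\<^bsub>sec (hom_sheaf X E E) X\<^esub> \<psi>))"
      unfolding *(3,4) TE.hom_section_add[OF *(1,2)] ..
    also have "\<dots> = TF.hom_section (?p \<phi> \<oplus>\<^bsub>sec (hom_sheaf X E F) X\<^esub> ?p \<psi>)"
      unfolding nat[OF add_mor[OF *(1,2)]] p_add[OF *(1,2)] ..
    also have "\<dots> = ?h \<sigma> \<oplus>\<^bsub>TF.T0\<^esub> ?h \<tau>"
      unfolding TF.hom_section_add[OF p_mor[OF *(1)] p_mor[OF *(2)]] *(3,4) nat[OF *(1)] nat[OF *(2)] ..
    finally show "?h (\<sigma> \<oplus>\<^bsub>TE.T0\<^esub> \<tau>) = ?h \<sigma> \<oplus>\<^bsub>TF.T0\<^esub> ?h \<tau>" .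
  next
    fix k \<sigma> assume "k \<in> carrier Cfield \<and> \<sigma> \<in> carrier TE.T0"
    then obtain \<phi> where *: "\<phi> \<in> mor X E E X" "\<sigma> = TE.hom_section \<phi>" using TE.hom_section_surj by metis
    let ?k = "const_fun X k"
    have k: "?k \<in> carrier (reg_ring X X)" by (rule reg_const[OF X_open])
    \<comment> \<open>Complex scalars act on H^0 through constant functions, which reduces
      homogeneity to linearity over regular functions.\<close>
    have sm: "k \<odot>\<^bsub>H0 X B\<^esub> \<rho> = ?k \<odot>\<^bsub>sec B X\<^esub> \<rho>" for B :: "('n pt, 'z) msheaf" and \<rho>
      by (simp add: H0_def)
    have "?h (k \<odot>\<^bsub>TE.T0\<^esub> \<sigma>) = ?h (TE.hom_section (?k \<odot>\<^bsub>sec (hom_sheaf X E E) X\<^esub> \<phi>))"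
      unfolding sm *(2) TE.hom_section_smult[OF *(1) k] ..
    also have "\<dots> = TF.hom_section (?k \<odot>\<^bsub>sec (hom_sheaf X E F) X\<^esub> ?p \<phi>)"
      unfolding nat[OF smult_mor[OF k *(1)]] p_smult[OF k *(1)] ..
    also have "\<dots> = k \<odot>\<^bsub>TF.T0\<^esub> ?h \<sigma>"
      unfolding sm TF.hom_section_smult[OF p_mor[OF *(1)] k] *(2) nat[OF *(1)] ..
    finally show "?h (k \<odot>\<^bsub>TE.T0\<^esub> \<sigma>) = k \<odot>\<^bsub>TF.T0\<^esub> ?h \<sigma>" .
  qed
  moreover have "bij_betw ?h (carrier TE.T0) (carrier TF.T0)"
  proof -
    \<comment> \<open>In the commuting square three sides are bijections: composition with p and the
      two identifications. So is the fourth.\<close>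
    have "bij_betw (TF.hom_section \<circ> ?p) (mor X E E X) (carrier TF.T0)"
      by (rule bij_betw_trans[OF comp_p_bij TF.hom_section_bij])
    then have "bij_betw (?h \<circ> TE.hom_section) (mor X E E X) (carrier TF.T0)"
      by (rule bij_betw_cong[THEN iffD1, rotated]) (simp add: nat)
    then show ?thesis using bij_betw_comp_iff[OF TE.hom_section_bij] by blast
  qed
  ultimately show ?thesis by (simp add: linear_iso_def)
qed

section \<open>Local dual bases of the middle term\<close>

lemma (in universal_extension) trivial_dual_basis:
  assumes T: "open_in X T"
  shows "\<exists>db. dual_basis X A T db"
proof -
  \<comment> \<open>Evaluations at the vectors w are the coordinates and the constants l the
    generators, the fibre being the dual of M.\<close>
  define db where "db = image_mset (\<lambda>(l, w). (hom_family X A T (\<lambda>V t. \<lambda>x\<in>V. t x w), \<lambda>x\<in>T. l)) cb"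
  have "dual_basis X A T db"
    unfolding dual_basis_def
  proof (intro conjI allI impI)
    have "hom_family X A T (\<lambda>V t. \<lambda>x\<in>V. t x w) \<in> mor X A (struct_sheaf X) T" if "w \<in> carrier M" for w
      using mor_restrict[OF A' eval_mor[OF that] open_in_subset[OF T]] hom_family_idem[OF open_in_subset[OF T]]
      by metis
    then show "set_mset db \<subseteq> mor X A (struct_sheaf X) T \<times> carrier (sec A T)"
      using cb(1) trivial_bundle_const[OF T] by (fastforce simp: db_def)
    fix V t assume *: "open_in X V \<and> V \<subseteq> T \<and> t \<in> carrier (sec A V)"
    then have V: "open_in X V" "V \<subseteq> T" and t: "t \<in> carrier (sec A V)" by auto
    interpret A: abelian_group "sec A V" by (rule presheaf_group[OF A' V(1)])
    have "msum (sec A V) (\<lambda>(\<beta>, b). \<beta> V t \<odot>\<^bsub>sec A V\<^esub> res A T V b) db =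
        msum (sec A V) (\<lambda>(l, w). (\<lambda>x\<in>V. t x w) \<odot>\<^bsub>sec A V\<^esub> (\<lambda>x\<in>V. l)) cb"
      unfolding db_def A.msum_image
      using V t by (intro A.msum_cong) (simp add: split_beta trivial_bundle_simps(5) Int_absorb1)
    then show "t = msum (sec A V) (\<lambda>(\<beta>, b). \<beta> V t \<odot>\<^bsub>sec A V\<^esub> res A T V b) db"
      using trivial_bundle_expand(1)[OF reg_cring M cb V(1) t] by simp
  qed
  then show ?thesis by blast
qed

text \<open>Near x the frame domain of F is intersected with the domain \<open>U x\<close> of the
  splitting. There both outer terms have dual bases and the extension splits, which supplies a dual
  basis of E.\<close>

lemma (in universal_extension) dual_tensors:
  assumes vb: "vector_bundle X F"
  shows "dual_tensor X E E" "dual_tensor X E F"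
proof -
  have F_basis: "\<exists>T db. open_in X T \<and> x \<in> T \<and> dual_basis X F T db" if "x \<in> X" for x
    using vector_bundle_frame[OF vb that] frame_dual_basis[OF F'] by blast
  have "\<exists>T db. open_in X T \<and> x \<in> T \<and> dual_basis X E T db" if x: "x \<in> X" for x
  proof -
    obtain T db where T: "open_in X T" "x \<in> T" and db: "dual_basis X F T db" using F_basis[OF x] by blast
    let ?T = "T \<inter> U x"
    have T': "open_in X ?T" by (rule open_in_Int[OF T(1) U_open[OF x]])
    obtain dA where "dual_basis X A ?T dA" using trivial_dual_basis[OF T'] by blast
    from middle_dual_basis[OF x T' Int_lower2 this dual_basis_restrict[OF F' db T(1) T' Int_lower1]]
    show ?thesis using T' T(2) U_mem[OF x] by blast
  qed
  then show "dual_tensor X E E" by unfold_locales (use X_open E E' in auto)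
  show "dual_tensor X E F" by unfold_locales (use X_open F E' F_basis in auto)
qed

section \<open>Passage from cohomology classes to cochain data, and the conclusion\<close>

theorem lemma3p14:
  fixes X :: "'n::finite pt set"
    and F :: "('n pt, 's) msheaf"
    and E :: "('n pt, 'e) msheaf"
    and W :: "('n, 'n pt set \<Rightarrow> 's \<Rightarrow> 'n pt \<Rightarrow> complex) cochain set set"
    and v :: nat
  assumes "K3_surface X"
    and "vector_bundle X F" and "simple_sheaf X F"
    and "carrier (H0 X F) = {\<zero>\<^bsub>H0 X F\<^esub>}"
    and "carrier (H0 X (dual_sheaf X F)) = {\<zero>\<^bsub>H0 X (dual_sheaf X F)\<^esub>}"
    and "VectorSpace.subspace Cfield W (H1 X (dual_sheaf X F))"
    and "vectorspace.fin_dim Cfield ((H1 X (dual_sheaf X F))\<lparr>carrier := W\<rparr>)"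
    and "vectorspace.dim Cfield ((H1 X (dual_sheaf X F))\<lparr>carrier := W\<rparr>) = v"
    and "v \<ge> 1"
    and "extension_bundle X F W E i p"
  shows "simple_sheaf X E \<and>
    linear_iso (H0 X (tensor_sheaf X (dual_sheaf X E) E)) (H0 X (tensor_sheaf X (dual_sheaf X E) F))
      (H0_tensor_map X (dual_sheaf X E) E F p)"
proof -
  define M where "M = (H1 X (dual_sheaf X F))\<lparr>carrier := W\<rparr>"
  let ?A = "trivial_bundle X (dual_space M)"
  have "closedin zariski X" using assms(1) by (simp add: K3_surface_def)
  then have top: "topspace (subtopology zariski X) = X"
    using closedin_subset by (auto simp: topspace_subtopology)
  have X: "open_in X X" using openin_topspace[of "subtopology zariski X"] unfolding top .
  have F: "mod_sheaf X F" using assms(2) by (simp add: vector_bundle_def)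
  note F' = mod_sheaf_presheaf[OF F]
  have R: "cring (reg_ring X V)" if "open_in X V" for V by (rule presheaf_cring[OF F' that])
  have D': "mod_presheaf X (dual_sheaf X F)" by (rule hom_presheaf[OF F' struct_sheaf_presheaf[OF R]])
  have vs: "vectorspace Cfield (H1 X (dual_sheaf X F))" and sub: "submodule Cfield W (H1 X (dual_sheaf X F))"
    using assms(6) by (simp_all add: VectorSpace.subspace_def)
  have M_vs: "vectorspace Cfield M"
    unfolding M_def by (rule vectorspace.subspace_is_vs[OF vs assms(6)])
  then have M: "Module.module Cfield M" by (simp add: vectorspace_def)
  have M_carrier: "carrier M = W" and M_zero: "\<zero>\<^bsub>M\<^esub> = \<zero>\<^bsub>H1 X (dual_sheaf X F)\<^esub>" by (simp_all add: M_def)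
  have WH: "W \<subseteq> carrier (H1 X (dual_sheaf X F))" using sub by (simp add: LinearCombinations.submodule_def)
  obtain cb where cb: "set_mset cb \<subseteq> carrier (dual_space M) \<times> carrier M"
    "\<And>m. m \<in> carrier M \<Longrightarrow> m = msum M (\<lambda>(l, w). l m \<odot>\<^bsub>M\<^esub> w) cb"
    using finite_coordinates[OF M_vs] assms(7) unfolding M_def[symmetric] by blast
  have ext: "mod_sheaf X E" "short_exact X ?A E F i p"
    and "\<exists>e. extension_class X ?A E F i p e \<and>
           (\<forall>w\<in>W. H1_map X (dual_sheaf X F) (contract X F (\<lambda>v. v w)) e = w)"
    using assms(10) by (simp_all add: extension_bundle_def Let_def M_def)
  \<comment> \<open>u is a representative of the extension class arising from actual splittings; the
    cover, the splittings and the cocycle of the locale are all read off from it.\<close>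
  then obtain e u where u: "u \<in> e" "extension_cocycle X ?A E F i p u"
    and e: "\<And>w. w \<in> W \<Longrightarrow> H1_map X (dual_sheaf X F) (contract X F (\<lambda>v. v w)) e = w"
    by (auto simp: extension_class_def)
  obtain U c where u_eq: "u = (U, c)" by (cases u)
  from u(2) obtain s where cocycle: "(U, c) \<in> cocycles X (hom_sheaf X F ?A)"
    and s: "\<forall>x\<in>X. s x \<in> mor X F E (U x) \<and>
            (\<forall>V. open_in X V \<and> V \<subseteq> U x \<longrightarrow> (\<forall>f\<in>carrier (sec F V). p V (s x V f) = f))"
    and diffs: "\<forall>x\<in>X. \<forall>y\<in>X. \<forall>V. open_in X V \<and> V \<subseteq> U x \<inter> U y \<longrightarrow> (\<forall>f\<in>carrier (sec F V).
             s y V f = s x V f \<oplus>\<^bsub>sec E V\<^esub> i V (c x y V f))"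
    unfolding u_eq extension_cocycle_def prod.case by (elim conjE exE)
  have s_mor: "s x \<in> mor X F E (U x)" if "x \<in> X" for x using s that by simp
  have s_split: "p V (s x V f) = f" if "x \<in> X" "open_in X V" "V \<subseteq> U x" "f \<in> carrier (sec F V)" for x V f
    using s that by simp
  have diff: "s y V f = s x V f \<oplus>\<^bsub>sec E V\<^esub> i V (c x y V f)"
    if "x \<in> X" "y \<in> X" "open_in X V" "V \<subseteq> U x \<inter> U y" "f \<in> carrier (sec F V)" for x y V f
    using diffs[rule_format, OF that(1,2) conjI[OF that(3,4)] that(5)] .
  interpret universal_extension X M E F i p U s c cb
  proof (intro universal_extension.intro split_extension.intro universal_extension_axioms.intro)
    show "mod_sheaf X ?A" by (rule trivial_bundle_sheaf[OF R dual_space_module[OF M]])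
    show "\<exists>k. f = const_fun X k" if "f \<in> carrier (reg_ring X X)" for f
      using regular_functions_constant[OF X _ assms(2,3) that] assms(1) by (simp add: K3_surface_def)
    show "w = \<zero>\<^bsub>M\<^esub>" if w: "w \<in> carrier M"
      and coh: "((U, \<lambda>x y. contract X F (\<lambda>v. v w) (U x \<inter> U y) (c x y)),
       (\<lambda>x. X, \<lambda>x y. \<zero>\<^bsub>sec (dual_sheaf X F) X\<^esub>)) \<in> cohomologous X (dual_sheaf X F)" for w
    proof -
      have wW: "w \<in> W" using w M_carrier by simp
      \<comment> \<open>The induced map is a union over all representatives of e, and u is one of
        them. If its contraction bounds, the zero cocycle lies in the image of e, which by
        universality is the class w.\<close>
      have "(\<lambda>x. X, \<lambda>x y. \<zero>\<^bsub>sec (dual_sheaf X F) X\<^esub>) \<in> H1_map X (dual_sheaf X F) (contract X F (\<lambda>v. v w)) e"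
        unfolding H1_map_def using u(1) coh by (intro UN_I[of u]) (simp_all add: u_eq)
      then show ?thesis
        unfolding e[OF wW] M_zero using wW WH by (intro H1_zeroI[OF D' X]) auto
    qed
  qed (rule ext F X M cb assms(3-5) s_mor s_split diff cocycle cocycles_cover[OF cocycle]; assumption?)+
  show ?thesis
    using simple_middle tensor_map_iso[OF dual_tensors[OF assms(2)]] by blast
qed

end
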